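(* Let $n\ge3$ be an integer and let $D_1,D_2,D,\Delta,\alpha$ be the constants depending on $n$ defined in the context. Then for all polynomials $P\in S(n+1,\beta)$ we have $$|P|_\beta\le 1+(D_1+D_2/n)(1-\beta)+(D+\Delta)(1-\beta)^2+\mathcal O\big((1-\beta)^{\alpha+1}\big).$$
   Context: $\beta$ denotes a real number with $0\le\beta\le 1$. $S(n+1,\beta)$ is the set of complex polynomials of degree $n+1$ with all roots in the closed unit disk and at least one root at $\beta$. For a polynomial $P$, $|P|_\beta$ is the distance between $\beta$ and the closest root of the derivative $P'$. Constants: for $n\ge3$ let $k$ be the largest integer with $k\le(n+1)/3$, and let $u_1=\cos\frac{2\pi k}{n+1}$, $u_2=\cos\frac{2\pi(k+1)}{n+1}$, $D_1=\frac{-2u_1u_2-1}{2(1-u_1)(1-u_2)}$, $D_2=\frac{-1}{2(1-u_1)(1-u_2)}$, $D_3=(-1-4D_1-3D_1^2+2D_2^2)/2$, $D_4=(3D_1-4D_2+3D_1^2-2D_1D_2-6D_2^2)/2$, $D_5=(2+4D_1+5D_2+2D_1^2+4D_1D_2+3D_2^2)/2$, $D_6=(2D_2+2D_1D_2+3D_2^2)/2$, $D=D_3n+D_4+D_5/n+D_6/n^2$. If $n=3$ or $n=5$ then $\alpha=3/2$; otherwise $\alpha=2$. If $n=5$ then $\Delta=7/225$; otherwise $\Delta=0$. The inequality $A\le B+\mathcal O((1-\beta)^s)$ means that there are constants $C$ and $\beta_0<1$, depending only on $n$ (in particular not on $P$), such that $A\le B+C(1-\beta)^s$ for all $\beta\in(\beta_0,1)$.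 *)

theory Defs
  imports "HOL-Analysis.Analysis" "HOL-Computational_Algebra.Polynomial"
begin

definition S :: "nat \<Rightarrow> real \<Rightarrow> complex poly set" where
  "S m \<beta> = {P. degree P = m \<and> (\<forall>z. poly P z = 0 \<longrightarrow> z \<in> cball 0 1)
                 \<and> poly P (complex_of_real \<beta>) = 0}"

text \<open>The distance from \<open>\<beta>\<close> to the closest critical point.  The minimum is over a
  finite nonempty set, hence meaningful, exactly when the derivative is not constant,
  i.e. for \<open>degree P \<ge> 2\<close>.\<close>

definition crit_dist :: "complex poly \<Rightarrow> real \<Rightarrow> real" where
  "crit_dist P \<beta> = Min ((\<lambda>w. dist (complex_of_real \<beta>) w) ` {w. poly (pderiv P) w = 0})"

definition k_const :: "nat \<Rightarrow> int" where
  "k_const n = \<lfloor>(real n + 1) / 3\<rfloor>"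

definition u1 :: "nat \<Rightarrow> real" where
  "u1 n = cos (2 * pi * of_int (k_const n) / (real n + 1))"

definition u2 :: "nat \<Rightarrow> real" where
  "u2 n = cos (2 * pi * (of_int (k_const n) + 1) / (real n + 1))"

definition D1 :: "nat \<Rightarrow> real" where
  "D1 n = (- 2 * u1 n * u2 n - 1) / (2 * (1 - u1 n) * (1 - u2 n))"

definition D2 :: "nat \<Rightarrow> real" where
  "D2 n = - 1 / (2 * (1 - u1 n) * (1 - u2 n))"

definition D3 :: "nat \<Rightarrow> real" where
  "D3 n = (- 1 - 4 * D1 n - 3 * (D1 n)^2 + 2 * (D2 n)^2) / 2"

definition D4 :: "nat \<Rightarrow> real" where
  "D4 n = (3 * D1 n - 4 * D2 n + 3 * (D1 n)^2 - 2 * D1 n * D2 n - 6 * (D2 n)^2) / 2"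

definition D5 :: "nat \<Rightarrow> real" where
  "D5 n = (2 + 4 * D1 n + 5 * D2 n + 2 * (D1 n)^2 + 4 * D1 n * D2 n + 3 * (D2 n)^2) / 2"

definition D6 :: "nat \<Rightarrow> real" where
  "D6 n = (2 * D2 n + 2 * D1 n * D2 n + 3 * (D2 n)^2) / 2"

definition D_const :: "nat \<Rightarrow> real" where
  "D_const n = D3 n * real n + D4 n + D5 n / real n + D6 n / (real n)^2"

definition alpha_const :: "nat \<Rightarrow> real" where
  "alpha_const n = (if n = 3 \<or> n = 5 then 3 / 2 else 2)"

definition Delta_const :: "nat \<Rightarrow> real" where
  "Delta_const n = (if n = 5 then 7 / 225 else 0)"

end

theory Submission
  imports Defs "HOL-Computational_Algebra.Fundamental_Theorem_Algebra"
begin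

text \<open>
  Near \<open>\<beta> = 1\<close> a polynomial of degree \<open>n + 1\<close> whose critical distance \<open>r\<close> is at least as
  large as the asserted bound is a small perturbation of \<open>z ^ (n + 1) - 1\<close>.  The bound is the value,
  up to second order in \<open>1 - \<beta>\<close>, of an extremal problem for such perturbations.

  Let \<open>h^2 = 1 - \<beta>\<close>.  The sums of \<open>1 / (\<beta> - \<zeta>)\<close> over the critical points \<open>\<zeta>\<close> and of
  \<open>2 / (\<beta> - z)\<close> over the zeros \<open>z\<close> other than \<open>\<beta>\<close> agree.  The first has real part at most
  \<open>n / r\<close>, the second at least \<open>n - O(h^2)\<close>; hence every critical point has real part \<open>O(h^2)\<close> and
  imaginary part \<open>O(h)\<close> (\<open>critical_points_near_origin\<close>).  An affine change of variable puts the zero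
  \<open>\<beta>\<close> at \<open>1\<close> and the centroid of the critical points at \<open>0\<close>.  Two facts are then exact: \<open>r ^ n\<close> is at
  most the product of the distances from \<open>\<beta>\<close> to the critical points, and all zeros satisfy one inequality
  that expresses \<open>|z| \<le> 1\<close>.  The zeros near \<open>(n + 1)\<close>-st roots of unity expand in the elementary
  symmetric functions of the critical points (\<open>root_near\<close>, \<open>root_expand\<close>).

  To first order this is a linear program in two real unknowns, the position of the centroid and the
  second elementary symmetric function.  Its dual solution is carried by the two pairs of roots of
  unity whose angles are adjacent to \<open>2 * pi / 3\<close>, which is where \<open>u1\<close> and \<open>u2\<close> come from, and
  its value is \<open>D1 + D2 / n\<close> (\<open>lp_identity\<close>).  A polynomial that reaches the bound leaves slack
  \<open>O(h^4)\<close> in every inequality that enters (\<open>lp_tight\<close>).  This determines the two unknowns to first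
  order and places the critical points, up to \<open>O(h^4)\<close>, on a parabola (\<open>x_expand\<close>).

  In the second-order expansion all terms are now known except one, the gap
  \<open>(\<Sum>y^2)^2 / 2 - (\<Sum>y^4)\<close> of the imaginary parts \<open>y\<close> of the critical points.  Its coefficient \<open>kappa / 4\<close>
  is not positive for \<open>n \<ge> 4\<close> (\<open>kappa_nonpos\<close>), so a lower bound for the gap is needed.  If the imaginary parts
  of the constraints at both angles are available, they force \<open>\<Sum>y^3\<close> to be negligible, and then the gap is
  essentially nonnegative (\<open>quartic_deficit\<close>).  For \<open>n = 3\<close> and \<open>n = 5\<close> the second angle is \<open>pi\<close> and
  gives no such information, which is why the error exponent is smaller there.  With
  three critical points the gap vanishes identically; with five it can be negative,
  and its minimum contributes \<open>Delta_const\<close> (\<open>quartic_five\<close>).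
\<close>

section \<open>Orders of magnitude in powers of a null sequence\<close>

text \<open>The natural scale is the square root \<open>h\<close> of \<open>1 - \<beta>\<close>, because the imaginary parts of the critical points
  have that size; powers of \<open>1 - \<beta>\<close> are the even powers of \<open>h\<close>.\<close>

locale small_scale =
  fixes h :: "nat \<Rightarrow> real"
  assumes h_pos: "0 < h i"
    and h_lim: "h \<longlonglongrightarrow> 0"
begin

text \<open>The first notion is the estimate \<open>f = O(h ^ s)\<close>.  The second is its one-sided version, which is what the
  inequalities \<open>|z| \<le> 1\<close> provide.\<close>

definition ord :: "nat \<Rightarrow> (nat \<Rightarrow> 'a::real_normed_field) \<Rightarrow> bool" where
  "ord s f \<longleftrightarrow> (\<exists>C. \<forall>\<^sub>F i in sequentially. norm (f i) \<le> C * h i ^ s)"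

definition ub :: "nat \<Rightarrow> (nat \<Rightarrow> real) \<Rightarrow> bool" where
  "ub s f \<longleftrightarrow> (\<exists>C. \<forall>\<^sub>F i in sequentially. f i \<le> C * h i ^ s)"

lemma h_le_1: "\<forall>\<^sub>F i in sequentially. h i \<le> 1"
  using order_tendstoD(2)[OF h_lim, of 1] by (auto elim: eventually_mono)

lemma h_nonneg [simp]: "0 \<le> h i"
  using h_pos[of i] by simp

lemma ordE:
  assumes "ord s f"
  obtains C where "C \<ge> 0" "\<forall>\<^sub>F i in sequentially. norm (f i) \<le> C * h i ^ s"
proof -
  obtain C where C: "\<forall>\<^sub>F i in sequentially. norm (f i) \<le> C * h i ^ s"
    using assms unfolding ord_def by blast
  have "\<forall>\<^sub>F i in sequentially. norm (f i) \<le> max C 0 * h i ^ s"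
    using C
  proof (rule eventually_mono)
    fix i assume "norm (f i) \<le> C * h i ^ s"
    also have "\<dots> \<le> max C 0 * h i ^ s"
      by (intro mult_right_mono) auto
    finally show "norm (f i) \<le> max C 0 * h i ^ s" .
  qed
  then show ?thesis using that[of "max C 0"] by simp
qed

lemma ordI: "\<forall>\<^sub>F i in sequentially. norm (f i) \<le> C * h i ^ s \<Longrightarrow> ord s f"
  unfolding ord_def by blast

lemma ubI: "\<forall>\<^sub>F i in sequentially. f i \<le> C * h i ^ s \<Longrightarrow> ub s f"
  unfolding ub_def by blast

lemma ord_weaken:
  assumes "ord t f" "s \<le> t"
  shows "ord s f"
proof -
  obtain C where C: "C \<ge> 0" "\<forall>\<^sub>F i in sequentially. norm (f i) \<le> C * h i ^ t"
    using assms(1) by (rule ordE)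
  show ?thesis
  proof (rule ordI[of _ C])
    show "\<forall>\<^sub>F i in sequentially. norm (f i) \<le> C * h i ^ s"
      using C(2) h_le_1
    proof eventually_elim
      case (elim i)
      have "h i ^ t \<le> h i ^ s"
        using assms(2) elim(2) by (intro power_decreasing) auto
      then have "C * h i ^ t \<le> C * h i ^ s" using C(1) by (rule mult_left_mono)
      then show ?case using elim(1) by linarith
    qed
  qed
qed

lemma ord_cong_ev:
  assumes "\<forall>\<^sub>F i in sequentially. f i = g i" "ord s f"
  shows "ord s g"
proof -
  obtain C where C: "\<forall>\<^sub>F i in sequentially. norm (f i) \<le> C * h i ^ s"
    using assms(2) unfolding ord_def by blast
  have "\<forall>\<^sub>F i in sequentially. norm (g i) \<le> C * h i ^ s"
    using C assms(1) by eventually_elim simp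
  then show ?thesis by (rule ordI)
qed

lemma ord_dominated:
  assumes "\<forall>\<^sub>F i in sequentially. norm (f i) \<le> K * norm (g i)" "ord s g"
  shows "ord s f"
proof -
  obtain C where C: "C \<ge> 0" "\<forall>\<^sub>F i in sequentially. norm (g i) \<le> C * h i ^ s"
    using assms(2) by (rule ordE)
  have "\<forall>\<^sub>F i in sequentially. norm (f i) \<le> (\<bar>K\<bar> * C) * h i ^ s"
    using C(2) assms(1)
  proof eventually_elim
    case (elim i)
    have "K * norm (g i) \<le> \<bar>K\<bar> * norm (g i)" by (intro mult_right_mono) auto
    also have "\<dots> \<le> \<bar>K\<bar> * (C * h i ^ s)" using elim(1) by (intro mult_left_mono) auto
    finally show ?case using elim(2) by (simp add: mult.assoc)
  qed
  then show ?thesis by (rule ordI)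
qed

lemma ord_add:
  assumes "ord s f" "ord s g"
  shows "ord s (\<lambda>i. f i + g i)"
proof -
  obtain C where C: "\<forall>\<^sub>F i in sequentially. norm (f i) \<le> C * h i ^ s"
    using assms(1) unfolding ord_def by blast
  obtain D where D: "\<forall>\<^sub>F i in sequentially. norm (g i) \<le> D * h i ^ s"
    using assms(2) unfolding ord_def by blast
  have "\<forall>\<^sub>F i in sequentially. norm (f i + g i) \<le> (C + D) * h i ^ s"
    using C D
  proof eventually_elim
    case (elim i)
    then show ?case using norm_triangle_ineq[of "f i" "g i"] by (simp add: distrib_right)
  qed
  then show ?thesis by (rule ordI)
qed

lemma ord_minus: "ord s f \<Longrightarrow> ord s (\<lambda>i. - f i)"
  unfolding ord_def by simp

lemma ord_diff: "ord s f \<Longrightarrow> ord s g \<Longrightarrow> ord s (\<lambda>i. f i - g i)"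
  using ord_add[OF _ ord_minus, of s f g] by simp

lemma ord_mult:
  assumes "ord s f" "ord t g"
  shows "ord (s + t) (\<lambda>i. f i * g i)"
proof -
  obtain C where C: "C \<ge> 0" "\<forall>\<^sub>F i in sequentially. norm (f i) \<le> C * h i ^ s"
    using assms(1) by (rule ordE)
  obtain D where D: "D \<ge> 0" "\<forall>\<^sub>F i in sequentially. norm (g i) \<le> D * h i ^ t"
    using assms(2) by (rule ordE)
  have "\<forall>\<^sub>F i in sequentially. norm (f i * g i) \<le> (C * D) * h i ^ (s + t)"
    using C(2) D(2)
  proof eventually_elim
    case (elim i)
    have "norm (f i * g i) \<le> (C * h i ^ s) * (D * h i ^ t)"
      unfolding norm_mult using elim C(1) by (intro mult_mono) auto
    then show ?case by (simp add: power_add algebra_simps)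
  qed
  then show ?thesis by (rule ordI)
qed

lemma ord_const: "ord 0 (\<lambda>i. c)"
  by (rule ordI[of _ "norm c"]) simp

lemma ord_zero: "ord s (\<lambda>i. 0)"
  by (rule ordI[of _ 0]) simp

lemma ord_h: "ord 1 h"
  by (rule ordI[of _ 1]) simp

lemma ord_h_power: "ord s (\<lambda>i. h i ^ s)"
  by (rule ordI[of _ 1]) simp

lemma ord_power: "ord s f \<Longrightarrow> ord (s * k) (\<lambda>i. f i ^ k)"
proof (induction k)
  case 0
  then show ?case using ord_const[of 1] by simp
next
  case (Suc k)
  then show ?case using ord_mult[of s f "s * k" "\<lambda>i. f i ^ k"] by simp
qed

lemma ord_cmult: "ord s f \<Longrightarrow> ord s (\<lambda>i. c * f i)"
  using ord_mult[OF ord_const, of s f c] by simp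

lemma ord_multc: "ord s f \<Longrightarrow> ord s (\<lambda>i. f i * c)"
  using ord_mult[OF _ ord_const, of s f c] by simp

lemma ord_divc: "ord s f \<Longrightarrow> ord s (\<lambda>i. f i / c)"
  using ord_multc[of s f "inverse c"] by (simp add: divide_inverse)

lemma ord_cmult_iff: "c \<noteq> 0 \<Longrightarrow> ord s (\<lambda>i. c * f i) \<longleftrightarrow> ord s f"
  using ord_cmult[of s "\<lambda>i. c * f i" "inverse c"] ord_cmult[of s f c] by (auto simp: field_simps)

lemma ord_sum: "(\<And>j. j \<in> J \<Longrightarrow> ord s (f j)) \<Longrightarrow> ord s (\<lambda>i. \<Sum>j\<in>J. f j i)"
  by (induction J rule: infinite_finite_induct) (auto intro: ord_zero ord_add)

lemma ord_Re: "ord s f \<Longrightarrow> ord s (\<lambda>i. Re (f i))"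
  by (rule ord_dominated[of _ 1 f]) (auto simp: abs_Re_le_cmod)

lemma ord_Im: "ord s f \<Longrightarrow> ord s (\<lambda>i. Im (f i))"
  by (rule ord_dominated[of _ 1 f]) (auto simp: abs_Im_le_cmod)

lemma ord_of_real: "ord s f \<Longrightarrow> ord s (\<lambda>i. of_real (f i) :: 'b :: real_normed_field)"
  unfolding ord_def by simp

lemma ord_complexI:
  assumes "ord s (\<lambda>i. Re (f i))" "ord s (\<lambda>i. Im (f i))"
  shows "ord s f"
proof -
  have "ord s (\<lambda>i. of_real (Re (f i)) + \<i> * of_real (Im (f i)))"
    by (intro ord_add ord_cmult ord_of_real assms)
  then show ?thesis by (simp add: complex_eq[symmetric])
qed

lemma ord_tendsto:
  assumes "ord s f" "1 \<le> s"
  shows "f \<longlonglongrightarrow> 0"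
proof -
  have "ord 1 f" using ord_weaken[OF assms] .
  then obtain C where C: "\<forall>\<^sub>F i in sequentially. norm (f i) \<le> C * h i ^ 1"
    unfolding ord_def by blast
  have "(\<lambda>i. C * h i ^ 1) \<longlonglongrightarrow> 0"
    using tendsto_mult_left[OF h_lim, of C] by simp
  then show ?thesis by (rule Lim_null_comparison[OF C])
qed

lemma ord_bounded:
  assumes "f \<longlonglongrightarrow> l"
  shows "ord 0 f"
proof -
  have "\<forall>\<^sub>F i in sequentially. norm (f i) < norm l + 1"
    using tendsto_norm[OF assms] by (intro order_tendstoD(2)) auto
  then have "\<forall>\<^sub>F i in sequentially. norm (f i) \<le> (norm l + 1) * h i ^ 0"
    by eventually_elim simp
  then show ?thesis by (rule ordI)
qed

lemma ord_small_ev: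
  assumes "ord s f" "1 \<le> s" "0 < e"
  shows "\<forall>\<^sub>F i in sequentially. norm (f i) < e"
  using tendsto_norm_zero[OF ord_tendsto[OF assms(1,2)]] assms(3) by (intro order_tendstoD(2)) auto

lemma ub_ord:
  assumes "ord s f"
  shows "ub s f"
proof -
  obtain C where "\<forall>\<^sub>F i in sequentially. norm (f i) \<le> C * h i ^ s"
    using assms unfolding ord_def by blast
  then have "\<forall>\<^sub>F i in sequentially. f i \<le> C * h i ^ s"
    by eventually_elim simp
  then show ?thesis by (rule ubI)
qed

lemma ub_weaken:
  assumes "ub t f" "s \<le> t"
  shows "ub s f"
proof -
  obtain C where C: "\<forall>\<^sub>F i in sequentially. f i \<le> C * h i ^ t"
    using assms(1) unfolding ub_def by blast
  have "\<forall>\<^sub>F i in sequentially. f i \<le> \<bar>C\<bar> * h i ^ s"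
    using C h_le_1
  proof eventually_elim
    case (elim i)
    have "h i ^ t \<le> h i ^ s"
      using assms(2) elim(2) by (intro power_decreasing) auto
    then have "\<bar>C\<bar> * h i ^ t \<le> \<bar>C\<bar> * h i ^ s" by (intro mult_left_mono) auto
    moreover have "C * h i ^ t \<le> \<bar>C\<bar> * h i ^ t" by (intro mult_right_mono) auto
    ultimately show ?case using elim(1) by linarith
  qed
  then show ?thesis by (rule ubI)
qed

lemma ub_add:
  assumes "ub s f" "ub s g"
  shows "ub s (\<lambda>i. f i + g i)"
proof -
  obtain C where C: "\<forall>\<^sub>F i in sequentially. f i \<le> C * h i ^ s"
    using assms(1) unfolding ub_def by blast
  obtain D where D: "\<forall>\<^sub>F i in sequentially. g i \<le> D * h i ^ s"
    using assms(2) unfolding ub_def by blast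
  have "\<forall>\<^sub>F i in sequentially. f i + g i \<le> (C + D) * h i ^ s"
    using C D by eventually_elim (simp add: distrib_right)
  then show ?thesis by (rule ubI)
qed

lemma ub_cmult:
  assumes "ub s f" "0 \<le> c"
  shows "ub s (\<lambda>i. c * f i)"
proof -
  obtain C where C: "\<forall>\<^sub>F i in sequentially. f i \<le> C * h i ^ s"
    using assms(1) unfolding ub_def by blast
  have "\<forall>\<^sub>F i in sequentially. c * f i \<le> (c * C) * h i ^ s"
    using C
  proof eventually_elim
    case (elim i)
    then show ?case using mult_left_mono[OF elim assms(2)] by (simp add: mult.assoc)
  qed
  then show ?thesis by (rule ubI)
qed

lemma ub_mono_ev:
  assumes "\<forall>\<^sub>F i in sequentially. f i \<le> g i" "ub s g"
  shows "ub s f"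
proof -
  obtain C where C: "\<forall>\<^sub>F i in sequentially. g i \<le> C * h i ^ s"
    using assms(2) unfolding ub_def by blast
  have "\<forall>\<^sub>F i in sequentially. f i \<le> C * h i ^ s"
    using C assms(1) by eventually_elim linarith
  then show ?thesis by (rule ubI)
qed

lemma ub_replace:
  assumes "ub s f" "ord s (\<lambda>i. g i - f i)"
  shows "ub s g"
  using ub_add[OF assms(1) ub_ord[OF assms(2)]] by simp

lemma ord_of_ub:
  assumes "ub s f" "ub s (\<lambda>i. - f i)"
  shows "ord s f"
proof -
  obtain C where C: "\<forall>\<^sub>F i in sequentially. f i \<le> C * h i ^ s"
    using assms(1) unfolding ub_def by blast
  obtain D where D: "\<forall>\<^sub>F i in sequentially. - f i \<le> D * h i ^ s"
    using assms(2) unfolding ub_def by blast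
  have "\<forall>\<^sub>F i in sequentially. norm (f i) \<le> (\<bar>C\<bar> + \<bar>D\<bar>) * h i ^ s"
    using C D
  proof eventually_elim
    case (elim i)
    have "C * h i ^ s \<le> (\<bar>C\<bar> + \<bar>D\<bar>) * h i ^ s" "D * h i ^ s \<le> (\<bar>C\<bar> + \<bar>D\<bar>) * h i ^ s"
      by (intro mult_right_mono; simp)+
    then show ?case using elim by (simp add: abs_le_iff)
  qed
  then show ?thesis by (rule ordI)
qed

text \<open>This passes from the total slack of a family of inequalities to the slack of each of them.\<close>

lemma ord_of_nonneg_sum:
  fixes f :: "'j \<Rightarrow> nat \<Rightarrow> real"
  assumes "finite J" "\<And>j i. j \<in> J \<Longrightarrow> 0 \<le> f j i" "ord s (\<lambda>i. \<Sum>j\<in>J. f j i)" "j \<in> J"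
  shows "ord s (f j)"
proof (rule ord_dominated[OF _ assms(3), of _ 1])
  show "\<forall>\<^sub>F i in sequentially. norm (f j i) \<le> 1 * norm (\<Sum>j\<in>J. f j i)"
  proof (rule always_eventually, rule allI)
    fix i
    have "f j i \<le> (\<Sum>j\<in>J. f j i)"
      using assms(1,2,4) by (intro member_le_sum[where f = "\<lambda>j. f j i"]) auto
    then show "norm (f j i) \<le> 1 * norm (\<Sum>j\<in>J. f j i)" using assms(2)[OF assms(4), of i] by simp
  qed
qed

lemma ord_ln_real:
  fixes f :: "nat \<Rightarrow> real"
  assumes "ord s f" "1 \<le> s"
  shows "ord (2 * s) (\<lambda>i. ln (1 + f i) - f i)"
proof -
  have "\<forall>\<^sub>F i in sequentially. norm (ln (1 + f i) - f i) \<le> 2 * norm ((f i)^2)"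
    using ord_small_ev[OF assms half_gt_zero[OF zero_less_one]]
  proof eventually_elim
    case (elim i)
    then show ?case using abs_ln_one_plus_x_minus_x_bound[of "f i"] by (simp add: power_abs)
  qed
  then show ?thesis
    by (rule ord_dominated) (use ord_power[OF assms(1), of 2] in \<open>simp add: mult.commute\<close>)
qed

text \<open>The tail of the logarithm series is dominated by a geometric series of ratio \<open>1 / 2\<close>.\<close>

lemma norm_Ln_quadratic_bound:
  fixes z :: complex
  assumes "norm z \<le> 1/2"
  shows "norm (Ln (1 + z) - z + z^2 / 2) \<le> 2 * norm z ^ 3"
proof -
  define f where "f m = - ((-z) ^ m) / of_nat m" for m
  have "f sums Ln (1 + z)" unfolding f_def by (rule Ln_series') (use assms in auto)
  then have "(\<lambda>m. f (m + 3)) sums (Ln (1 + z) - (\<Sum>m<3. f m))"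
    by (rule sums_split_initial_segment)
  moreover have "(\<Sum>m<3. f m) = z - z^2 / 2"
    by (simp add: f_def eval_nat_numeral)
  ultimately have S: "(\<lambda>m. f (m + 3)) sums (Ln (1 + z) - z + z^2 / 2)"
    by (simp add: algebra_simps)
  have "(\<lambda>m. norm z ^ 3 * (1/2) ^ m) sums (norm z ^ 3 * (1 / (1 - 1/2)))"
    by (intro sums_mult geometric_sums) auto
  then have G: "(\<lambda>m. norm z ^ 3 * (1/2) ^ m) sums (2 * norm z ^ 3)" by (simp add: mult.commute)
  show ?thesis
  proof (rule norm_sums_le[OF S G])
    fix m
    have "norm (f (m + 3)) = norm z ^ 3 * norm z ^ m / of_nat (m + 3)"
      unfolding f_def norm_divide norm_minus_cancel norm_power norm_of_nat
      by (simp add: power_add mult.commute)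
    also have "\<dots> \<le> norm z ^ 3 * norm z ^ m / 1"
      by (intro divide_left_mono) auto
    also have "\<dots> \<le> norm z ^ 3 * (1/2) ^ m"
      using assms by (simp add: mult_left_mono power_mono)
    finally show "norm (f (m + 3)) \<le> norm z ^ 3 * (1/2) ^ m" .
  qed
qed

lemma ord_ln_norm2:
  fixes f :: "nat \<Rightarrow> complex"
  assumes "ord s f" "1 \<le> s"
  shows "ord (3 * s) (\<lambda>i. ln (norm (1 + f i)) - Re (f i) + Re ((f i)^2) / 2)"
proof -
  have "\<forall>\<^sub>F i in sequentially. norm (ln (norm (1 + f i)) - Re (f i) + Re ((f i)^2) / 2)
      \<le> 2 * norm (f i ^ 3)"
    using ord_small_ev[OF assms half_gt_zero[OF zero_less_one]]
  proof eventually_elim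
    case (elim i)
    have ne: "1 + f i \<noteq> 0"
    proof
      assume "1 + f i = 0"
      then have "f i = -1" by (simp add: add_eq_0_iff)
      then show False using elim by simp
    qed
    have "ln (norm (1 + f i)) - Re (f i) + Re ((f i)^2) / 2 = Re (Ln (1 + f i) - f i + (f i)^2 / 2)"
      using ne by simp
    then show ?case
      using abs_Re_le_cmod[of "Ln (1 + f i) - f i + (f i)^2 / 2"] norm_Ln_quadratic_bound[of "f i"] elim
      by (simp add: norm_power)
  qed
  then show ?thesis
    by (rule ord_dominated) (use ord_power[OF assms(1), of 3] in \<open>simp add: mult.commute\<close>)
qed

lemma ord_ln_norm1:
  fixes f :: "nat \<Rightarrow> complex"
  assumes "ord s f" "1 \<le> s"
  shows "ord (2 * s) (\<lambda>i. ln (norm (1 + f i)) - Re (f i))"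
proof -
  have "ord (2 * s) (\<lambda>i. Re ((f i)^2) / 2)"
    using ord_divc[OF ord_Re[OF ord_power[OF assms(1), of 2]], of 2] by (simp add: mult.commute)
  moreover have "ord (2 * s) (\<lambda>i. ln (norm (1 + f i)) - Re (f i) + Re ((f i)^2) / 2)"
    by (rule ord_weaken[OF ord_ln_norm2[OF assms]]) simp
  ultimately show ?thesis using ord_diff by fastforce
qed

end

section \<open>Elementary symmetric functions and power sums\<close>

text \<open>This is \<open>(-1) ^ k\<close> times the \<open>k\<close>-th elementary symmetric function of \<open>d 0, \<dots>, d (m - 1)\<close>.  Reading it as a
  coefficient of \<open>\<Prod>j<m. (1 - d j * t)\<close> absorbs the signs, and it vanishes for \<open>k > m\<close>.\<close>

definition signed_esym :: "nat \<Rightarrow> (nat \<Rightarrow> complex) \<Rightarrow> nat \<Rightarrow> complex" where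
  "signed_esym m d k = coeff (\<Prod>j<m. [:1, - d j:]) k"

lemma signed_esym_Suc:
  "signed_esym (Suc m) d k = signed_esym m d k - d m * (if k = 0 then 0 else signed_esym m d (k - 1))"
  unfolding signed_esym_def by (cases k) (simp_all add: mult.commute[of _ "[:1, - d m:]"])

lemma signed_esym_zero_left: "signed_esym 0 d k = (if k = 0 then 1 else 0)"
  unfolding signed_esym_def by simp

lemma signed_esym_0 [simp]: "signed_esym m d 0 = 1"
  by (induction m) (simp_all add: signed_esym_zero_left signed_esym_Suc)

lemma signed_esym_eq_0: "m < k \<Longrightarrow> signed_esym m d k = 0"
  by (induction m arbitrary: k) (simp_all add: signed_esym_zero_left signed_esym_Suc)

lemma sum_signed_esym: "(\<Sum>k\<le>m. signed_esym m d k * t ^ k) = (\<Prod>j<m. (1 - d j * t))"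
proof -
  have deg: "degree (\<Prod>j<m. [:1, - d j:]) \<le> m"
    using signed_esym_eq_0[of m _ d] unfolding signed_esym_def by (intro degree_le) auto
  have "(\<Prod>j<m. (1 - d j * t)) = poly (\<Prod>j<m. [:1, - d j:]) t"
    by (simp add: poly_prod mult.commute)
  also have "\<dots> = (\<Sum>k\<le>m. signed_esym m d k * t ^ k)"
    unfolding signed_esym_def poly_altdef using deg
    by (intro sum.mono_neutral_left) (auto simp: coeff_eq_0)
  finally show ?thesis by simp
qed

text \<open>Newton's identities, by induction on the number of variables: a further variable \<open>x\<close> adds \<open>x ^ k\<close> to the
  power sums and subtracts \<open>x\<close> times the preceding symmetric function.\<close>

lemma newton_signed_esym:
  fixes d :: "nat \<Rightarrow> complex"
  defines "p \<equiv> \<lambda>m k. \<Sum>j<m. d j ^ k"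
  shows "signed_esym m d 1 = - p m 1"
    and "2 * signed_esym m d 2 = - (p m 1 * signed_esym m d 1 + p m 2)"
    and "3 * signed_esym m d 3 = - (p m 1 * signed_esym m d 2 + p m 2 * signed_esym m d 1 + p m 3)"
    and "4 * signed_esym m d 4 = - (p m 1 * signed_esym m d 3 + p m 2 * signed_esym m d 2 + p m 3 * signed_esym m d 1 + p m 4)"
    and "5 * signed_esym m d 5 = - (p m 1 * signed_esym m d 4 + p m 2 * signed_esym m d 3 + p m 3 * signed_esym m d 2
                            + p m 4 * signed_esym m d 1 + p m 5)"
proof -
  have S: "signed_esym (Suc m) d 1 = signed_esym m d 1 - d m" "signed_esym (Suc m) d 2 = signed_esym m d 2 - d m * signed_esym m d 1"
    "signed_esym (Suc m) d 3 = signed_esym m d 3 - d m * signed_esym m d 2" "signed_esym (Suc m) d 4 = signed_esym m d 4 - d m * signed_esym m d 3"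
    "signed_esym (Suc m) d 5 = signed_esym m d 5 - d m * signed_esym m d 4" for m
    by (simp_all add: signed_esym_Suc)
  have P: "p (Suc m) k = p m k + d m ^ k" for m k by (simp add: p_def)
  have Z: "p 0 k = 0" for k by (simp add: p_def)
  have "signed_esym m d 1 = - p m 1
    \<and> 2 * signed_esym m d 2 = - (p m 1 * signed_esym m d 1 + p m 2)
    \<and> 3 * signed_esym m d 3 = - (p m 1 * signed_esym m d 2 + p m 2 * signed_esym m d 1 + p m 3)
    \<and> 4 * signed_esym m d 4 = - (p m 1 * signed_esym m d 3 + p m 2 * signed_esym m d 2 + p m 3 * signed_esym m d 1 + p m 4)
    \<and> 5 * signed_esym m d 5 = - (p m 1 * signed_esym m d 4 + p m 2 * signed_esym m d 3 + p m 3 * signed_esym m d 2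
                            + p m 4 * signed_esym m d 1 + p m 5)"
  proof (induction m)
    case 0
    show ?case by (simp add: Z signed_esym_zero_left)
  next
    case (Suc m)
    define x where "x = d m"
    define q1 q2 q3 q4 q5 where q: "q1 = p m 1" "q2 = p m 2" "q3 = p m 3" "q4 = p m 4" "q5 = p m 5"
    define e1 e2 e3 e4 e5 where e: "e1 = signed_esym m d 1" "e2 = signed_esym m d 2" "e3 = signed_esym m d 3" "e4 = signed_esym m d 4"
      "e5 = signed_esym m d 5"
    have IH: "e1 = - q1" "2 * e2 = - (q1 * e1 + q2)" "3 * e3 = - (q1 * e2 + q2 * e1 + q3)"
      "4 * e4 = - (q1 * e3 + q2 * e2 + q3 * e1 + q4)"
      "5 * e5 = - (q1 * e4 + q2 * e3 + q3 * e2 + q4 * e1 + q5)"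
      using Suc.IH unfolding q e by auto
    show ?case
      unfolding S P q[symmetric] e[symmetric] x_def[symmetric] 
      apply (intro conjI)
      subgoal using IH(1) by algebra
      subgoal using IH(1,2) by algebra
      subgoal using IH(1,2,3) by algebra
      subgoal using IH(1-4) by algebra
      subgoal using IH(1-5) by algebra
      done
  qed
  then show "signed_esym m d 1 = - p m 1"
    and "2 * signed_esym m d 2 = - (p m 1 * signed_esym m d 1 + p m 2)"
    and "3 * signed_esym m d 3 = - (p m 1 * signed_esym m d 2 + p m 2 * signed_esym m d 1 + p m 3)"
    and "4 * signed_esym m d 4 = - (p m 1 * signed_esym m d 3 + p m 2 * signed_esym m d 2 + p m 3 * signed_esym m d 1 + p m 4)"
    and "5 * signed_esym m d 5 = - (p m 1 * signed_esym m d 4 + p m 2 * signed_esym m d 3 + p m 3 * signed_esym m d 2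
                            + p m 4 * signed_esym m d 1 + p m 5)"
    by blast+
qed

lemma signed_esym_centered:
  fixes d :: "nat \<Rightarrow> complex"
  assumes "(\<Sum>j<m. d j) = 0"
  defines "p \<equiv> \<lambda>k. \<Sum>j<m. d j ^ k"
  shows "signed_esym m d 1 = 0" "signed_esym m d 2 = - p 2 / 2" "signed_esym m d 3 = - p 3 / 3"
    "signed_esym m d 4 = (p 2)^2 / 8 - p 4 / 4"
    "signed_esym m d 5 = - (p 2 * signed_esym m d 3 + p 3 * signed_esym m d 2 + p 5) / 5"
proof -
  note N = newton_signed_esym[of m d]
  have p1: "(\<Sum>j<m. d j ^ 1) = 0" using assms(1) by simp
  show s1: "signed_esym m d 1 = 0" unfolding N(1) p1 by simp
  have "2 * signed_esym m d 2 = - p 2" unfolding N(2) p1 p_def by simp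
  then show s2: "signed_esym m d 2 = - p 2 / 2" by (simp add: field_simps)
  have "3 * signed_esym m d 3 = - p 3" unfolding N(3) s1 p1 p_def by simp
  then show "signed_esym m d 3 = - p 3 / 3" by (simp add: field_simps)
  have "4 * signed_esym m d 4 = - (p 2 * signed_esym m d 2 + p 4)" unfolding N(4) s1 p1 p_def by simp
  then show "signed_esym m d 4 = (p 2)^2 / 8 - p 4 / 4"
    unfolding s2 by (simp add: field_simps power2_eq_square)
  have "5 * signed_esym m d 5 = - (p 2 * signed_esym m d 3 + p 3 * signed_esym m d 2 + p 5)"
    unfolding N(5) s1 p1 p_def by simp
  then show "signed_esym m d 5 = - (p 2 * signed_esym m d 3 + p 3 * signed_esym m d 2 + p 5) / 5"
    by (simp add: field_simps)
qed

section \<open>Fourth powers of real numbers with sum zero\<close>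

text \<open>Let \<open>a = y k\<close> be the largest absolute value, \<open>p3\<close> the sum of cubes, and \<open>T\<close> the bracket on the right.  Over the
  remaining indices put \<open>R = (\<Sum>y^2)\<close>, \<open>W = (\<Sum>y^2 * (a + y))\<close> and \<open>V = (\<Sum>y^2 * (a^2 - y^2))\<close>, which are
  nonnegative and satisfy \<open>2 * a * T = (W - p3) * (R + a^2) + 2 * a * V\<close>.  So \<open>T < 0\<close> forces \<open>W < p3\<close>.
  Let \<open>- b\<close> be the least remaining element.  Then \<open>W < p3\<close> shows that either \<open>a - b\<close> is at most
  \<open>4 * p3 / a^2\<close> or \<open>a ^ 3\<close> is at most \<open>3 * p3\<close>.  Both cases follow from the bound
  \<open>T \<ge> - (a^2 - b^2)^2 / 2\<close>, which holds because the elements other than \<open>a\<close> and \<open>- b\<close> contribute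
  nonnegatively to \<open>T\<close>.\<close>

lemma quartic_le_cubic:
  fixes y :: "'j \<Rightarrow> real"
  assumes fin: "finite J" and sum0: "(\<Sum>j\<in>J. y j) = 0"
    and k: "k \<in> J" and max: "\<And>j. j \<in> J \<Longrightarrow> \<bar>y j\<bar> \<le> y k" and pos: "0 < y k"
  shows "- 32 * (\<Sum>j\<in>J. y j ^ 3)^2 \<le> (y k)^2 * ((\<Sum>j\<in>J. (y j)^2)^2 / 2 - (\<Sum>j\<in>J. y j ^ 4))"
proof -
  define a where "a = y k"
  define K where "K = J - {k}"
  have finK: "finite K" using fin by (simp add: K_def)
  have split: "(\<Sum>j\<in>J. f (y j)) = f a + (\<Sum>j\<in>K. f (y j))" for f :: "real \<Rightarrow> real"
    unfolding K_def a_def using fin k by (rule sum.remove)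
  have b: "- a \<le> y j" "y j \<le> a" if "j \<in> K" for j
    using max[of j] that by (auto simp: K_def a_def abs_le_iff)
  have a: "a > 0" using pos by (simp add: a_def)
  define R where "R = (\<Sum>j\<in>K. (y j)^2)"
  define p3 where "p3 = (\<Sum>j\<in>J. y j ^ 3)"
  define T where "T = (\<Sum>j\<in>J. (y j)^2)^2 / 2 - (\<Sum>j\<in>J. y j ^ 4)"
  define W where "W = (\<Sum>j\<in>K. (y j)^2 * (a + y j))"
  define V where "V = (\<Sum>j\<in>K. (y j)^2 * (a^2 - (y j)^2))"
  have s0: "(\<Sum>j\<in>K. y j) = - a" using sum0 split[of "\<lambda>x. x"] by simp
  have V0: "V \<ge> 0" unfolding V_def
  proof (intro sum_nonneg mult_nonneg_nonneg)
    fix j assume "j \<in> K"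
    then show "0 \<le> a^2 - (y j)^2" using abs_le_square_iff[of "y j" a] b[of j] a by auto
  qed auto
  have W0: "(y j)^2 * (a + y j) \<le> W" "0 \<le> (y j)^2 * (a + y j)" if "j \<in> K" for j
  proof -
    have nn: "0 \<le> (y j)^2 * (a + y j)" if "j \<in> K" for j
      using b(1)[OF that] by (intro mult_nonneg_nonneg) auto
    show "(y j)^2 * (a + y j) \<le> W" unfolding W_def
      using that nn finK by (intro member_le_sum[where f = "\<lambda>j. (y j)^2 * (a + y j)"]) auto
    show "0 \<le> (y j)^2 * (a + y j)" using nn[OF that] .
  qed
  have p3: "p3 = a ^ 3 + (\<Sum>j\<in>K. y j ^ 3)" unfolding p3_def by (rule split)
  have WR: "W = p3 - a ^ 3 + a * R"
    unfolding W_def p3 R_def sum_distrib_left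
    by (simp add: sum.distrib[symmetric] algebra_simps power3_eq_cube power2_eq_square)
  have T: "T = (a^2 + R)^2 / 2 - a ^ 4 - (\<Sum>j\<in>K. y j ^ 4)"
    unfolding T_def R_def split[of "\<lambda>x. x^2"] split[of "\<lambda>x. x ^ 4"] by simp
  have VR: "V = a^2 * R - (\<Sum>j\<in>K. y j ^ 4)"
    unfolding V_def R_def sum_distrib_left
    by (simp add: sum_subtractf[symmetric] algebra_simps eval_nat_numeral)
  have R0: "R \<ge> 0" unfolding R_def by (intro sum_nonneg) auto
  have T1: "2 * a * T = (W - p3) * (R + a^2) + 2 * a * V"
    unfolding T VR WR by (simp add: field_simps eval_nat_numeral)
  have T2: "T \<ge> - ((a^2 - (y l)^2)^2 / 2)" if l: "l \<in> K" for l
  proof -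
    define r where "r = (\<Sum>j\<in>K - {l}. (y j)^2)"
    define r4 where "r4 = (\<Sum>j\<in>K - {l}. y j ^ 4)"
    have RK: "R = (y l)^2 + r" "(\<Sum>j\<in>K. y j ^ 4) = y l ^ 4 + r4"
      unfolding R_def r_def r4_def using finK l by (simp_all add: sum.remove)
    have "r4 \<le> a^2 * r" unfolding r4_def r_def sum_distrib_left
    proof (rule sum_mono)
      fix j assume "j \<in> K - {l}"
      then have "(y j)^2 \<le> a^2" using abs_le_square_iff[of "y j" a] b[of j] a by auto
      then have "(y j)^2 * (y j)^2 \<le> a^2 * (y j)^2" by (intro mult_right_mono) auto
      then show "y j ^ 4 \<le> a^2 * (y j)^2" by (simp add: eval_nat_numeral)
    qed
    moreover have "r \<ge> 0" unfolding r_def by (intro sum_nonneg) auto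
    moreover have "0 \<le> (y l)^2 * r" using \<open>r \<ge> 0\<close> by simp
    moreover have "(a^2 + ((y l)^2 + r))^2 / 2 - a ^ 4 - (y l ^ 4 + r4)
       = - ((a^2 - (y l)^2)^2 / 2) + (a^2 * r - r4) + (y l)^2 * r + r^2 / 2"
      by (simp add: field_simps eval_nat_numeral)
    moreover have "0 \<le> r^2 / 2" by simp
    ultimately show ?thesis unfolding T RK by linarith
  qed
  have goal: "a^2 * T \<ge> - 32 * p3^2"
  proof (cases "T \<ge> 0")
    case True
    then show ?thesis by (smt (verit) mult_nonneg_nonneg zero_le_power2)
  next
    case False
    then have "(W - p3) * (R + a^2) < 0"
      using T1 a V0 by (smt (verit) mult_nonneg_nonneg mult_pos_neg)
    then have Wp: "W < p3" using R0 by (smt (verit) mult_nonneg_nonneg zero_le_power2)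
    have "K \<noteq> {}" using s0 a by auto
    then obtain l where l: "l \<in> K" and lmin: "\<And>j. j \<in> K \<Longrightarrow> y l \<le> y j"
      using finK by (metis arg_min_if_finite(1) arg_min_least)
    define b' where "b' = - y l"
    have ba: "b' \<le> a" using b(1)[OF l] by (simp add: b'_def)
    have p3pos: "p3 > 0" using W0[OF l] Wp by linarith
    show ?thesis
    proof (cases "b' \<ge> a / 2")
      case True
      have "(a/2)^2 * (a - b') \<le> b'^2 * (a - b')"
        using True a ba by (intro mult_right_mono power_mono) auto
      also have "\<dots> \<le> p3" using W0(1)[OF l] Wp by (simp add: b'_def)
      finally have 1: "a^2 * (a - b') \<le> 4 * p3" by (simp add: power2_eq_square)
      have "0 \<le> a^2 * (a - b')" using ba by simp
      then have 2: "(a^2 * (a - b'))^2 \<le> (4 * p3)^2" using 1 by (intro power_mono) auto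
      have "(a^2 - b'^2)^2 = (a - b')^2 * (a + b')^2" by (simp add: power2_eq_square algebra_simps)
      also have "\<dots> \<le> (a - b')^2 * (2 * a)^2"
        using True a ba by (intro mult_left_mono power_mono) auto
      finally have "a^2 * (a^2 - b'^2)^2 \<le> a^2 * ((a - b')^2 * (2 * a)^2)" by (intro mult_left_mono) auto
      also have "\<dots> = 4 * (a^2 * (a - b'))^2" by (simp add: power2_eq_square algebra_simps)
      also have "\<dots> \<le> 64 * p3^2" using 2 by (simp add: power_mult_distrib)
      finally have 3: "a^2 * (a^2 - b'^2)^2 \<le> 64 * p3^2" .
      have "a^2 * T \<ge> a^2 * - ((a^2 - b'^2)^2 / 2)"
        using T2[OF l] by (intro mult_left_mono) (auto simp: b'_def)
      then show ?thesis using 3 by simp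
    next
      case False
      have "(\<Sum>j\<in>K. (y j)^2 * (a / 2)) \<le> W" unfolding W_def
      proof (intro sum_mono mult_left_mono)
        fix j assume "j \<in> K"
        then show "a / 2 \<le> a + y j" using False lmin[of j] by (simp add: b'_def)
      qed auto
      then have "R * (a / 2) \<le> W" unfolding R_def sum_distrib_right .
      then have "a * R / 2 \<le> W" by (simp add: mult.commute)
      moreover have "0 \<le> a * R" using a R0 by simp
      ultimately have 1: "a ^ 3 \<le> 3 * p3" using WR Wp by linarith
      have "(a ^ 3)^2 \<le> (3 * p3)^2" using 1 a by (intro power_mono) auto
      then have 2: "a ^ 6 \<le> 9 * p3^2" by (simp add: power_mult_distrib flip: power_mult)
      have "(y l)^2 \<le> a^2" using abs_le_square_iff[of "y l" a] b[OF l] a by auto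
      then have "\<bar>a^2 - (y l)^2\<bar> \<le> \<bar>a^2\<bar>" by simp
      then have "(a^2 - (y l)^2)^2 \<le> (a^2)^2" by (simp only: abs_le_square_iff)
      then have "T \<ge> - ((a^2)^2 / 2)" using T2[OF l] by linarith
      then have "a^2 * T \<ge> a^2 * - ((a^2)^2 / 2)" by (intro mult_left_mono) auto
      also have "a^2 * - ((a^2)^2 / 2) = - (a ^ 6 / 2)" by (simp add: eval_nat_numeral)
      finally show ?thesis using 2 p3pos by (smt (verit) zero_le_power2 field_sum_of_halves)
    qed
  qed
  then show ?thesis unfolding T_def p3_def a_def .
qed

text \<open>Without the cubic term the inequality \<open>(\<Sum>y^4) \<le> (\<Sum>y^2)^2 / 2\<close> would fail for numbers with sum zero; it is sharp for
  \<open>t, - t, 0, \<dots>, 0\<close>.  The correction is quadratic in the sum of cubes, which makes it negligible in the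
  application.\<close>

lemma quartic_deficit:
  fixes y :: "'j \<Rightarrow> real"
  assumes fin: "finite J" and sum0: "(\<Sum>j\<in>J. y j) = 0"
  defines "S2 \<equiv> \<Sum>j\<in>J. (y j)^2"
  shows "- 32 * card J * (\<Sum>j\<in>J. y j ^ 3)^2 \<le> S2 * (S2^2 / 2 - (\<Sum>j\<in>J. y j ^ 4))"
proof (cases "\<forall>j\<in>J. y j = 0")
  case True
  then have "S2 = 0" by (simp add: S2_def)
  moreover have "(\<Sum>j\<in>J. y j ^ 3) = 0" using True by simp
  ultimately show ?thesis by simp
next
  case False
  then have ne: "J \<noteq> {}" by auto
  define T where "T = S2^2 / 2 - (\<Sum>j\<in>J. y j ^ 4)"
  define p3 where "p3 = (\<Sum>j\<in>J. y j ^ 3)"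
  obtain k where k: "k \<in> J" and max: "\<And>j. j \<in> J \<Longrightarrow> \<bar>y j\<bar> \<le> \<bar>y k\<bar>"
  proof -
    have "finite ((\<lambda>j. \<bar>y j\<bar>) ` J)" "(\<lambda>j. \<bar>y j\<bar>) ` J \<noteq> {}" using fin ne by auto
    from Max_in[OF this] obtain k where "k \<in> J" "Max ((\<lambda>j. \<bar>y j\<bar>) ` J) = \<bar>y k\<bar>" by auto
    then show ?thesis using that[of k] Max_ge[OF \<open>finite ((\<lambda>j. \<bar>y j\<bar>) ` J)\<close>] by auto
  qed
  have yk: "y k \<noteq> 0" using False max by fastforce
  have Q: "- 32 * p3^2 \<le> (y k)^2 * T"
  proof (cases "y k > 0")
    case True
    then show ?thesis
      unfolding p3_def T_def S2_def using max by (intro quartic_le_cubic[OF fin sum0 k]) auto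
  next
    case neg: False
    have "(\<Sum>j\<in>J. - y j) = 0" using sum0 by (simp add: sum_negf)
    from quartic_le_cubic[OF fin this k] max yk neg
    have "- 32 * (\<Sum>j\<in>J. (- y j) ^ 3)^2 \<le> (y k)^2 * T"
      unfolding T_def S2_def by auto
    then show ?thesis unfolding p3_def by (simp add: sum_negf)
  qed
  have Sk: "S2 \<le> card J * (y k)^2"
  proof -
    have "S2 \<le> (\<Sum>j\<in>J. (y k)^2)" unfolding S2_def
      using max by (intro sum_mono) (simp add: abs_le_square_iff)
    then show ?thesis by simp
  qed
  have S0: "S2 \<ge> 0" unfolding S2_def by (intro sum_nonneg) auto
  have "- 32 * card J * p3^2 \<le> S2 * T"
  proof (cases "T \<ge> 0")
    case True
    then have "0 \<le> S2 * T" using S0 by simp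
    moreover have "0 \<le> real (card J) * p3^2" by simp
    ultimately show ?thesis by linarith
  next
    case neg: False
    have "real (card J) * (- 32 * p3^2) \<le> card J * ((y k)^2 * T)" using Q by (intro mult_left_mono) auto
    also have "\<dots> = (card J * (y k)^2) * T" by simp
    also have "\<dots> \<le> S2 * T" using Sk neg by (intro mult_right_mono_neg) auto
    finally show ?thesis by (simp add: mult.assoc mult.left_commute)
  qed
  then show ?thesis unfolding T_def p3_def .
qed

text \<open>The fourth elementary symmetric function of three numbers vanishes; with sum zero this is the
  asserted relation of power sums.\<close>

lemma quartic_three:
  fixes y :: "nat \<Rightarrow> real"
  assumes "(\<Sum>j<3. y j) = 0"
  shows "(\<Sum>j<3. y j ^ 4) = (\<Sum>j<3. (y j)^2)^2 / 2"
proof -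
  have "y 2 = - y 0 - y 1" using assms by (simp add: eval_nat_numeral)
  then show ?thesis by (simp add: eval_nat_numeral) (simp add: algebra_simps)
qed

text \<open>Equality holds at \<open>4, -1, -1, -1, -1\<close>.  The difference of the two sides is a multiple of the sum, over the five
  choices of four of the numbers, of the quadratic invariant of the quartic with these four roots.  That
  invariant is a sum of squares in the roots and vanishes at a triple root.\<close>

lemma quartic_five:
  fixes y :: "nat \<Rightarrow> real"
  assumes "(\<Sum>j<5. y j) = 0"
  shows "(\<Sum>j<5. y j ^ 4) \<le> 13 / 20 * (\<Sum>j<5. (y j)^2)^2"
proof -
  define I where "I a b c d = ((a-b)*(c-d))^2 + ((a-c)*(b-d))^2 + ((a-d)*(b-c))^2" for a b c d :: real
  have I0: "I a b c d \<ge> 0" for a b c d unfolding I_def by simp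
  have sum5: "(\<Sum>j<5. g j) = g 0 + g 1 + g 2 + g 3 + g 4" for g :: "nat \<Rightarrow> real"
    by (simp add: eval_nat_numeral)
  define a b c d where ab: "a = y 0" "b = y 1" "c = y 2" "d = y 3"
  have e: "y 4 = - (a + b + c + d)" using assms unfolding sum5 ab by simp
  have "13 / 20 * (\<Sum>j<5. (y j)^2)^2 - (\<Sum>j<5. y j ^ 4) =
     (I a b c d + I a b c (y 4) + I a b d (y 4) + I a c d (y 4) + I b c d (y 4)) / 10"
    unfolding I_def sum5 e ab[symmetric] by (simp add: field_simps eval_nat_numeral)
  then show ?thesis using I0 by (smt (verit) divide_nonneg_nonneg)
qed

section \<open>The two angles adjacent to \<open>2 * pi / 3\<close>\<close>

lemma cos_two_thirds_pi: "cos (2 * pi / 3) = - (1 / 2 :: real)"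
  using cos_double_cos[of "pi / 3"] by (simp add: cos_60 power2_eq_square)

text \<open>Cosine is convex on \<open>{2 * pi / 3..pi}\<close>, and the right-hand side is the chord over this interval.\<close>

lemma cos_chord:
  assumes "2 * pi / 3 \<le> t" "t \<le> pi"
  shows "cos t \<le> 1 / 2 - 3 * t / (2 * pi)"
proof -
  have "convex_on {2 * pi / 3..pi} (cos :: real \<Rightarrow> real)"
  proof (rule f''_ge0_imp_convex)
    show "DERIV cos x :> - sin x" for x :: real by (rule DERIV_cos)
    show "DERIV (\<lambda>x. - sin x) x :> - cos x" for x :: real
      by (auto intro!: derivative_eq_intros)
    show "0 \<le> - cos x" if "x \<in> {2 * pi / 3..pi}" for x :: real
      using cos_monotone_0_pi_le[of "2 * pi / 3" x] that cos_two_thirds_pi pi_gt_zero by auto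
  qed auto
  from convex_onD_Icc'[OF this, of t] assms
  have "cos t \<le> (cos pi - cos (2 * pi / 3)) / (pi - 2 * pi / 3) * (t - 2 * pi / 3) + cos (2 * pi / 3)"
    by simp
  also have "\<dots> = 1 / 2 - 3 * t / (2 * pi)"
    unfolding cos_two_thirds_pi by (simp add: field_simps)
  finally show ?thesis .
qed

definition angle_index :: "nat \<Rightarrow> nat" where "angle_index n = (n + 1) div 3"
definition theta1 :: "nat \<Rightarrow> real" where "theta1 n = 2 * pi * real (angle_index n) / (real n + 1)"
definition theta2 :: "nat \<Rightarrow> real" where "theta2 n = 2 * pi * (real (angle_index n) + 1) / (real n + 1)"

lemma u1_theta: "u1 n = cos (theta1 n)" and u2_theta: "u2 n = cos (theta2 n)"
proof -
  have "k_const n = int (angle_index n)"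
    using floor_divide_of_nat_eq[of "n + 1" 3, where 'a = real] unfolding k_const_def angle_index_def
    by (simp add: add.commute)
  then show "u1 n = cos (theta1 n)" "u2 n = cos (theta2 n)"
    unfolding u1_def u2_def theta1_def theta2_def by simp_all
qed

lemma cis_theta: "cis (theta1 n) ^ (n + 1) = 1" "cis (theta2 n) ^ (n + 1) = 1"
proof -
  have c: "cis (2 * pi * real m) = 1" for m
    using cis_multiple_2pi[of "real m"] by simp
  have "cis (theta1 n) ^ (n + 1) = cis (2 * pi * real (angle_index n))"
    unfolding Complex.DeMoivre theta1_def by (rule arg_cong[of _ _ cis]) (simp add: field_simps)
  then show "cis (theta1 n) ^ (n + 1) = 1" using c by simp
  have "cis (theta2 n) ^ (n + 1) = cis (2 * pi * real (angle_index n + 1))"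
    unfolding Complex.DeMoivre theta2_def by (rule arg_cong[of _ _ cis]) (simp add: field_simps)
  then show "cis (theta2 n) ^ (n + 1) = 1" using c[of "angle_index n + 1"] by simp
qed

lemma theta_bounds:
  assumes "n \<ge> 3"
  shows "pi / 3 \<le> theta1 n" "theta1 n \<le> 2 * pi / 3"
    "2 * pi / 3 + 2 * pi / (3 * (real n + 1)) \<le> theta2 n" "theta2 n \<le> pi"
    and "n \<noteq> 3 \<Longrightarrow> n \<noteq> 5 \<Longrightarrow> theta2 n < pi"
proof -
  have k: "3 * angle_index n \<le> n + 1" "n + 1 \<le> 3 * angle_index n + 2" "n + 1 \<le> 6 * angle_index n" "2 * (angle_index n + 1) \<le> n + 1"
    using assms unfolding angle_index_def by presburger+
  have kr: "3 * real (angle_index n) \<le> real n + 1" "real n + 1 \<le> 3 * real (angle_index n) + 2"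
    "real n + 1 \<le> 6 * real (angle_index n)" "2 * (real (angle_index n) + 1) \<le> real n + 1"
    using k[THEN of_nat_mono[where 'a = real]] by simp_all
  have "pi / 3 = 2 * pi * ((real n + 1) / 6) / (real n + 1)" by (simp add: field_simps)
  also have "\<dots> \<le> theta1 n" unfolding theta1_def
    using kr(3) by (intro divide_right_mono mult_left_mono) auto
  finally show "pi / 3 \<le> theta1 n" .
  have "theta1 n \<le> 2 * pi * ((real n + 1) / 3) / (real n + 1)" unfolding theta1_def
    using kr(1) by (intro divide_right_mono mult_left_mono) auto
  also have "\<dots> = 2 * pi / 3" by (simp add: field_simps)
  finally show "theta1 n \<le> 2 * pi / 3" .
  have "2 * pi / 3 + 2 * pi / (3 * (real n + 1)) = 2 * pi * ((real n + 2) / 3) / (real n + 1)"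
    by (simp add: field_simps)
  also have "\<dots> \<le> theta2 n" unfolding theta2_def
    using kr(2) by (intro divide_right_mono mult_left_mono) auto
  finally show "2 * pi / 3 + 2 * pi / (3 * (real n + 1)) \<le> theta2 n" .
  have "theta2 n \<le> 2 * pi * ((real n + 1) / 2) / (real n + 1)" unfolding theta2_def
    using kr(4) by (intro divide_right_mono mult_left_mono) auto
  also have "\<dots> = pi" by (simp add: field_simps)
  finally show "theta2 n \<le> pi" .
  assume "n \<noteq> 3" "n \<noteq> 5"
  then have "2 * (angle_index n + 1) < n + 1" using assms unfolding angle_index_def by presburger
  then have "real (2 * (angle_index n + 1)) < real (n + 1)" by (simp only: of_nat_less_iff)
  then have "2 * (real (angle_index n) + 1) < real n + 1" by simp
  then have "theta2 n < 2 * pi * ((real n + 1) / 2) / (real n + 1)" unfolding theta2_def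
    by (intro divide_strict_right_mono mult_strict_left_mono) auto
  also have "\<dots> = pi" by (simp add: field_simps)
  finally show "theta2 n < pi" .
qed

text \<open>The bound on \<open>u2\<close> by \<open>- (n + 1) / (2 * n)\<close> is what makes both dual weights positive: this number is the
  weighted mean of \<open>u1\<close> and \<open>u2\<close>, and \<open>- 1 / 2\<close> lies above it.\<close>

lemma u_bounds:
  assumes "n \<ge> 3"
  shows "- 1 / 2 \<le> u1 n" "u1 n \<le> 1 / 2" "- 1 \<le> u2 n" "u2 n < - (real n + 1) / (2 * real n)"
    "u2 n < - 1 / 2" "u2 n < u1 n" "sin (theta1 n) > 0"
    and "n \<noteq> 3 \<Longrightarrow> n \<noteq> 5 \<Longrightarrow> sin (theta2 n) > 0"
proof -
  note t = theta_bounds[OF assms]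
  have pos: "theta1 n > 0" using t(1) pi_gt_zero by linarith
  have b: "theta1 n < pi" using t(2) pi_gt_zero by linarith
  show 1: "- 1 / 2 \<le> u1 n" unfolding u1_theta
    using cos_monotone_0_pi_le[OF _ t(2)] pos cos_two_thirds_pi by simp
  show "u1 n \<le> 1 / 2" unfolding u1_theta
    using cos_monotone_0_pi_le[OF _ t(1)] b cos_60 by simp
  show "- 1 \<le> u2 n" unfolding u2_theta by simp
  have "0 \<le> 2 * pi / (3 * (real n + 1))" by simp
  then have t2: "2 * pi / 3 \<le> theta2 n" using t(3) by linarith
  have "u2 n \<le> 1 / 2 - 3 * theta2 n / (2 * pi)"
    unfolding u2_theta by (rule cos_chord[OF t2 t(4)])
  also have "\<dots> \<le> 1 / 2 - 3 * (2 * pi / 3 + 2 * pi / (3 * (real n + 1))) / (2 * pi)"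
    using t(3) by (intro diff_left_mono divide_right_mono mult_left_mono) auto
  also have "\<dots> = - 1 / 2 - 1 / (real n + 1)"
    by (simp add: distrib_left add_divide_distrib) (simp add: field_simps)
  finally have u2: "u2 n \<le> - 1 / 2 - 1 / (real n + 1)" .
  also have "\<dots> < - (real n + 1) / (2 * real n)" using assms by (simp add: field_simps)
  finally show "u2 n < - (real n + 1) / (2 * real n)" .
  show 2: "u2 n < - 1 / 2" using u2 by (smt (verit) divide_pos_pos of_nat_0_le_iff)
  show "u2 n < u1 n" using 1 2 by linarith
  show "sin (theta1 n) > 0" using pos b by (intro sin_gt_zero)
  assume "n \<noteq> 3" "n \<noteq> 5"
  then show "sin (theta2 n) > 0" using t(5) t2 pi_gt_zero by (intro sin_gt_zero) linarith+
qed

text \<open>The dual solution of the first-order linear program.  Its two equations prescribe the total mass \<open>n\<close>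
  and the first moment \<open>- (n + 1) / 2\<close>; they correspond to the two unknowns.\<close>

definition weight2 :: "nat \<Rightarrow> real" where
  "weight2 n = (real n * u1 n + (real n + 1) / 2) / (u1 n - u2 n)"
definition weight1 :: "nat \<Rightarrow> real" where
  "weight1 n = real n - weight2 n"

lemma weights:
  assumes "n \<ge> 3"
  shows "weight1 n > 0" "weight2 n > 0"
    "weight1 n + weight2 n = real n"
    "weight1 n * u1 n + weight2 n * u2 n = - (real n + 1) / 2"
proof -
  note u = u_bounds[OF assms]
  have d: "u1 n - u2 n > 0" using u(6) by simp
  have "real n * (- 1 / 2) \<le> real n * u1 n" using u(1) by (intro mult_left_mono) auto
  then have "real n * u1 n + (real n + 1) / 2 > 0" by (simp add: field_simps)
  then show "weight2 n > 0" unfolding weight2_def using d by simp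
  have "u2 n * (2 * real n) < - (real n + 1)" using u(4) assms by (subst (asm) pos_less_divide_eq) auto
  then have "real n * u1 n + (real n + 1) / 2 < real n * (u1 n - u2 n)" by (simp add: right_diff_distrib) (simp add: field_simps)
  then have "weight2 n < real n" unfolding weight2_def using d by (simp add: field_simps)
  then show "weight1 n > 0" unfolding weight1_def by simp
  show "weight1 n + weight2 n = real n" unfolding weight1_def by simp
  have "weight1 n * u1 n + weight2 n * u2 n = real n * u1 n - weight2 n * (u1 n - u2 n)"
    unfolding weight1_def by (simp add: algebra_simps)
  also have "weight2 n * (u1 n - u2 n) = real n * u1 n + (real n + 1) / 2"
    unfolding weight2_def using d by simp
  finally show "weight1 n * u1 n + weight2 n * u2 n = - (real n + 1) / 2" by (simp add: field_simps)
qed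

text \<open>Four times the coefficient of the quartic gap of the imaginary parts in the second-order bound.\<close>

definition kappa :: "nat \<Rightarrow> real" where
  "kappa n = - 1 + 2 / (real n - 2) * (weight1 n * (1 + 2 * u1 n)^2 + weight2 n * (1 + 2 * u2 n)^2)
     - 8 / (real n - 3) * (weight1 n * ((u1 n)^2 * (1 + u1 n)) + weight2 n * ((u2 n)^2 * (1 + u2 n)))"

text \<open>In the variables \<open>1 + 2 * u1\<close> and \<open>1 + 2 * u2\<close> the weights have first moment \<open>- 1\<close>, so their higher moments
  are polynomials in the sum \<open>x\<close> and the product \<open>y\<close> of these variables; \<open>q\<close> is the second moment.\<close>

lemma kappa_symmetric:
  assumes "n \<ge> 4"
  defines "x \<equiv> (1 + 2 * u1 n) + (1 + 2 * u2 n)" and "y \<equiv> (1 + 2 * u1 n) * (1 + 2 * u2 n)"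
  defines "q \<equiv> - real n * y - x"
  shows "(real n - 2) * (real n - 3) * kappa n
     = q * (3 * real n - 8) - (real n - 2) * (2 * real n - 2 + x * q + y)"
proof -
  define m1 m2 a b where ab: "m1 = weight1 n" "m2 = weight2 n" "a = u1 n" "b = u2 n"
  have w: "m1 + m2 = real n" "m1 * a + m2 * b = - (real n + 1) / 2"
    unfolding ab using weights[of n] assms(1) by auto
  have Q: "m1 * (1 + 2 * a)^2 + m2 * (1 + 2 * b)^2 = q"
  proof -
    have "m1 * (1 + 2 * a)^2 + m2 * (1 + 2 * b)^2
      = ((1 + 2 * a) + (1 + 2 * b)) * ((m1 + m2) + 2 * (m1 * a + m2 * b))
        - (1 + 2 * a) * (1 + 2 * b) * (m1 + m2)" by (simp add: algebra_simps power2_eq_square)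
    also have "\<dots> = q" unfolding w q_def x_def y_def ab[symmetric] by (simp add: field_simps)
    finally show ?thesis .
  qed
  have C: "8 * (m1 * (a^2 * (1 + a)) + m2 * (b^2 * (1 + b))) = x * q + y - q + real n + 1"
  proof -
    have "8 * (m1 * (a^2 * (1 + a)) + m2 * (b^2 * (1 + b)))
      = ((1 + 2 * a) + (1 + 2 * b)) * (m1 * (1 + 2 * a)^2 + m2 * (1 + 2 * b)^2)
        - (1 + 2 * a) * (1 + 2 * b) * ((m1 + m2) + 2 * (m1 * a + m2 * b))
        - (m1 * (1 + 2 * a)^2 + m2 * (1 + 2 * b)^2)
        - 2 * (m1 * a + m2 * b)"
      by (simp add: algebra_simps power2_eq_square power3_eq_cube)
    also have "\<dots> = x * q + y - q + real n + 1"
      unfolding Q w x_def y_def ab[symmetric] by (simp add: field_simps)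
    finally show ?thesis .
  qed
  have n: "real n - 2 \<noteq> 0" "real n - 3 \<noteq> 0" using assms(1) by auto
  have "kappa n = - 1 + 2 / (real n - 2) * q - (x * q + y - q + real n + 1) / (real n - 3)"
    unfolding kappa_def ab[symmetric] Q C[symmetric] by simp
  moreover have "A * B * (- 1 + 2 / A * q - Z / B) = - (A * B) + 2 * B * q - A * Z"
    if "A \<noteq> 0" "B \<noteq> 0" for A B Z :: real
    using that by (simp add: field_simps)
  ultimately have "(real n - 2) * (real n - 3) * kappa n
      = - ((real n - 2) * (real n - 3)) + 2 * (real n - 3) * q
        - (real n - 2) * (x * q + y - q + real n + 1)" using n by metis
  then show ?thesis by (simp add: algebra_simps)
qed

lemma kappa_nonpos_if:
  assumes "n \<ge> 4"
  defines "x \<equiv> (1 + 2 * u1 n) + (1 + 2 * u2 n)" and "y \<equiv> (1 + 2 * u1 n) * (1 + 2 * u2 n)"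
  defines "q \<equiv> - real n * y - x"
  assumes "q * (3 * real n - 8) \<le> (real n - 2) * (2 * real n - 2 + x * q + y)"
  shows "kappa n \<le> 0"
proof -
  have "(real n - 2) * (real n - 3) * kappa n \<le> 0"
    using kappa_symmetric[OF assms(1)] assms(5) unfolding q_def x_def y_def by linarith
  moreover have "(real n - 2) * (real n - 3) > 0" using assms(1) by simp
  ultimately show ?thesis using mult_pos_pos[of _ "kappa n"] by (meson not_le)
qed

text \<open>At \<open>x = pi / 5\<close> the angles \<open>2 * x\<close> and \<open>3 * x\<close> are supplementary, which gives a quadratic equation
  for \<open>cos x\<close>.\<close>

lemma cos_pi_fifth: "cos (pi / 5) \<ge> 4 / 5"
proof -
  define c where "c = cos (pi / 5)"
  have "cos (2 * (pi / 5)) = - cos (3 * (pi / 5))"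
    using cos_pi_minus[of "3 * (pi / 5)"] by (simp add: field_simps)
  then have "2 * c^2 - 1 = - (4 * c ^ 3 - 3 * c)"
    unfolding c_def cos_double_cos cos_treble_cos .
  then have "(c + 1) * (4 * c^2 - 2 * c - 1) = 0" by (simp add: algebra_simps eval_nat_numeral)
  moreover have c: "c > 1 / 2"
    using cos_monotone_0_pi[of "pi / 5" "pi / 3"] unfolding c_def by (simp add: cos_60)
  ultimately have e: "4 * c^2 - 2 * c - 1 = 0" by auto
  show ?thesis
  proof (rule ccontr)
    assume "\<not> ?thesis"
    then have "c < 4 / 5" by (simp add: c_def)
    then have "c * (4 * c - 2) < 4 / 5 * (4 * c - 2)" using c by (intro mult_strict_right_mono) auto
    then show False using e \<open>c < 4 / 5\<close> by (simp add: power2_eq_square algebra_simps)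
  qed
qed

text \<open>The two variables have opposite signs and their distance is at most \<open>4 * sin (pi / (n + 1))\<close>.  For \<open>n \<ge> 9\<close> this
  bounds the second moment \<open>q\<close> well enough.  If \<open>3\<close> divides \<open>n + 1\<close>, the first variable is zero.  The
  remaining cases \<open>n = 4, 6, 7\<close> use algebraic equations for the cosines, with numerical enclosures for \<open>n = 6, 7\<close>.\<close>

lemma kappa_nonpos:
  assumes "n \<ge> 4"
  shows "kappa n \<le> 0"
proof -
  have n3: "n \<ge> 3" using assms by simp
  note ub = u_bounds[OF n3]
  define a b where ab: "a = 1 + 2 * u1 n" "b = 1 + 2 * u2 n"
  define q where "q = - real n * (a * b) - (a + b)"
  have a0: "a \<ge> 0" and b0: "b \<le> 0" "b \<ge> - 1" using ub(1,3,5) by (auto simp: ab)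
  note crit = kappa_nonpos_if[OF assms, folded ab, folded q_def]
  consider "n = 4" | "n = 6" | "n = 7" | "n \<noteq> 4" "3 dvd n + 1" | "n \<ge> 9"
  proof -
    assume h: "n = 4 \<Longrightarrow> thesis" "n = 6 \<Longrightarrow> thesis" "n = 7 \<Longrightarrow> thesis"
      "n \<noteq> 4 \<Longrightarrow> 3 dvd n + 1 \<Longrightarrow> thesis" "9 \<le> n \<Longrightarrow> thesis"
    have "n = 4 \<or> n = 6 \<or> n = 7 \<or> (n \<noteq> 4 \<and> 3 dvd n + 1) \<or> 9 \<le> n"
      using assms by presburger
    then show thesis using h by blast
  qed
  then show ?thesis
  proof cases
    case 1
    have "angle_index n = 1" unfolding angle_index_def 1 by simp
    then have t: "theta1 n = 2 * pi / 5" "theta2 n = 4 * pi / 5"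
      unfolding theta1_def theta2_def 1 by simp_all
    define c where "c = cos (2 * pi / 5)"
    have c2: "cos (4 * pi / 5) = 2 * c^2 - 1" using cos_double_cos[of "2 * pi / 5"] by (simp add: c_def)
    have c3: "cos (6 * pi / 5) = 4 * c ^ 3 - 3 * c" using cos_treble_cos[of "2 * pi / 5"] by (simp add: c_def)
    have "cos (6 * pi / 5) = cos (4 * pi / 5)"
      using cos_2pi_minus[of "4 * pi / 5"] by (simp add: field_simps)
    then have "(c - 1) * (4 * c^2 + 2 * c - 1) = 0"
      unfolding c2 c3 by (simp add: algebra_simps eval_nat_numeral)
    moreover have "c \<noteq> 1" using ub(2) unfolding u1_theta t c_def by auto
    ultimately have e: "4 * c^2 + 2 * c - 1 = 0" by simp
    have ab': "a = 1 + 2 * c" "b = 4 * c^2 - 1"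
      unfolding ab u1_theta u2_theta t c2 c_def by auto
    have b': "b = - 2 * c" using e ab' by simp
    have "a + b = 1" "a * b = - 1" using e unfolding ab'(1) b' by (auto simp: algebra_simps power2_eq_square)
    then show ?thesis using crit by (simp add: q_def 1)
  next
    case 2
    have "angle_index n = 2" unfolding angle_index_def 2 by simp
    then have t: "theta1 n = 4 * pi / 7" "theta2 n = 6 * pi / 7"
      unfolding theta1_def theta2_def 2 by simp_all
    define c where "c = cos (2 * pi / 7)"
    have c2: "cos (4 * pi / 7) = 2 * c^2 - 1" using cos_double_cos[of "2 * pi / 7"] by (simp add: c_def)
    have c3: "cos (6 * pi / 7) = 4 * c ^ 3 - 3 * c" using cos_treble_cos[of "2 * pi / 7"] by (simp add: c_def)
    have c4: "cos (8 * pi / 7) = 2 * (2 * c^2 - 1)^2 - 1"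
      using cos_double_cos[of "4 * pi / 7"] by (simp add: c2)
    have "cos (8 * pi / 7) = cos (6 * pi / 7)"
      using cos_2pi_minus[of "6 * pi / 7"] by (simp add: field_simps)
    then have "(c - 1) * (8 * c ^ 3 + 4 * c^2 - 4 * c - 1) = 0"
      unfolding c4 c3 by (simp add: algebra_simps eval_nat_numeral)
    moreover have ch: "c > 1 / 2" "c < 1"
      using cos_monotone_0_pi[of "2 * pi / 7" "pi / 3"] cos_monotone_0_pi[of 0 "2 * pi / 7"] unfolding c_def
      by (auto simp: cos_60)
    ultimately have e: "8 * c ^ 3 + 4 * c^2 - 4 * c - 1 = 0" by simp
    have e1: "c * (8 * c^2 + 4 * c - 4) = 1" using e by (simp add: algebra_simps eval_nat_numeral)
    have lo: "c > 62/100"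
    proof (rule ccontr)
      assume "\<not> ?thesis"
      then have c: "c \<le> 62/100" by simp
      have "c^2 \<le> (62/100)^2" using c ch by (intro power_mono) auto
      then have "8 * c^2 + 4 * c - 4 \<le> 8 * (62/100)^2 + 4 * (62/100) - 4" using c by linarith
      then have "c * (8 * c^2 + 4 * c - 4) \<le> c * (8 * (62/100)^2 + 4 * (62/100) - 4)"
        using ch by (intro mult_left_mono) auto
      then show False using e1 c by (simp add: power2_eq_square)
    qed
    have hi: "c < 63/100"
    proof (rule ccontr)
      assume "\<not> ?thesis"
      then have c: "c \<ge> 63/100" by simp
      have "c^2 \<ge> (63/100)^2" using c ch by (intro power_mono) auto
      then have "8 * c^2 + 4 * c - 4 \<ge> 8 * (63/100)^2 + 4 * (63/100) - 4" using c by linarith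
      then have "c * (8 * c^2 + 4 * c - 4) \<ge> c * (8 * (63/100)^2 + 4 * (63/100) - 4)"
        using ch by (intro mult_left_mono) auto
      moreover have "c * (8 * (63/100)^2 + 4 * (63/100) - 4) \<ge> 63/100 * (8 * (63/100)^2 + 4 * (63/100) - 4)"
        using c by (intro mult_right_mono) (auto simp: power2_eq_square)
      ultimately show False using e1 by (simp add: power2_eq_square)
    qed
    have c3': "4 * c ^ 3 - 3 * c = 1 / 2 - c - 2 * c^2" using e by simp
    have ab': "a = 4 * c^2 - 1" "b = 2 - 2 * c - 4 * c^2"
      unfolding ab u1_theta u2_theta t c2 c3 c3' by auto
    have sq: "c^2 \<ge> (62/100)^2" "c^2 \<le> (63/100)^2"
      using lo hi by (intro power_mono; simp)+
    have A: "a \<le> 588/1000" "b \<ge> - 848/1000"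
      using sq hi unfolding ab' by (auto simp: power2_eq_square)
    have "- b * a \<le> 848/1000 * (588/1000)" using A a0 b0 by (intro mult_mono) auto
    then have P: "a * b \<ge> - 499/1000" by (simp add: mult.commute)
    have S: "a + b = 1 - 2 * c" unfolding ab' by simp
    have S': "a + b \<le> 0" "a + b \<ge> - 26/100" using S lo hi by auto
    have q: "q \<le> 326/100" unfolding q_def 2 using P S' by simp
    have "q * - (a + b) \<le> 326/100 * (26/100)"
      using q S' by (intro mult_mono) auto
    then have "(a + b) * q \<ge> - 848/1000" by (simp add: algebra_simps)
    then show ?thesis using crit q P by (simp add: 2)
  next
    case 3
    have "angle_index n = 2" unfolding angle_index_def 3 by simp
    then have t: "theta1 n = pi / 2" "theta2 n = 3 * (pi / 4)"
      unfolding theta1_def theta2_def 3 by simp_all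
    have a1: "a = 1" unfolding ab u1_theta t by simp
    have "cos (3 * (pi / 4)) = - (sqrt 2 / 2)"
      unfolding cos_treble_cos cos_45 by (simp add: power3_eq_cube field_simps)
    then have b: "b = 1 - sqrt 2" unfolding ab u2_theta t by simp
    have "sqrt 2 > 141/100" "sqrt 2 < 142/100"
      by (rule real_less_rsqrt real_less_lsqrt; simp add: power2_eq_square)+
    then have bb: "b < - 41/100" "b > - 42/100" using b by auto
    have qq: "q = - 8 * b - 1" unfolding q_def a1 3 by simp
    have "(1 + b) * (- (8 * b) - 1) \<ge> 0" using bb by (intro mult_nonneg_nonneg) auto
    then have "0 \<le> 73 + (109 * b + 5 * ((1 + b) * (- (8 * b) - 1)))" using bb by linarith
    then show ?thesis using crit unfolding qq by (simp add: 3 a1)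
  next
    case 4
    have n5: "n \<ge> 5" using 4 assms by simp
    obtain k where k: "n + 1 = 3 * k" using 4(2) by (auto elim: dvdE)
    then have kr: "real n + 1 = 3 * real k" "k > 0" by (linarith, auto)
    have "angle_index n = k" unfolding angle_index_def k by simp
    then have th: "theta1 n = 2 * pi / 3" unfolding theta1_def kr(1) using kr(2) by simp
    have a: "a = 0" unfolding ab u1_theta th cos_two_thirds_pi by simp
    have qb: "q = - b" unfolding q_def a by simp
    have "b^2 \<le> 1" using b0 by (simp add: abs_square_le_1)
    then have "(real n - 2) * (2 * real n - 3) \<le> (real n - 2) * (2 * real n - 2 + b * q)"
      unfolding qb using n5 by (intro mult_left_mono) (auto simp: power2_eq_square)
    moreover have "q * (3 * real n - 8) \<le> 1 * (3 * real n - 8)"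
      unfolding qb using b0 n5 by (intro mult_right_mono) auto
    moreover have "3 * real n - 8 \<le> (real n - 2) * (2 * real n - 3)"
    proof -
      have "0 \<le> 2 * (real n - 5) * real n" using n5 by simp
      then show ?thesis by (simp add: algebra_simps)
    qed
    ultimately show ?thesis using crit by (simp add: a)
  next
    case 5
    define N where "N = real n + 1"
    have N: "N \<ge> 10" using 5 by (simp add: N_def)
    define s where "s = sin (pi / N)"
    have d: "a - b = 4 * sin ((theta1 n + theta2 n) / 2) * s"
    proof -
      have "theta2 n - theta1 n = 2 * (pi / N)"
        unfolding theta1_def theta2_def N_def diff_divide_distrib[symmetric] by (simp add: algebra_simps)
      then have "u1 n - u2 n = 2 * sin ((theta1 n + theta2 n) / 2) * s"
        unfolding u1_theta u2_theta cos_diff_cos s_def by simp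
      then show ?thesis by (simp add: ab)
    qed
    have s2: "s^2 \<le> 1 / 10"
    proof -
      have "cos (pi / 5) \<le> cos (2 * (pi / N))"
        using N by (intro cos_monotone_0_pi_le) (auto simp: field_simps)
      then show ?thesis using cos_pi_fifth unfolding cos_double_sin s_def[symmetric] by simp
    qed
    have "(a - b)^2 = 16 * (sin ((theta1 n + theta2 n) / 2))^2 * s^2"
      unfolding d by (simp add: power_mult_distrib)
    also have "\<dots> \<le> 16 * 1 * (1 / 10)"
      using s2 by (intro mult_mono) (auto simp: abs_square_le_1)
    finally have w: "(a - b)^2 \<le> 16 / 10" by simp
    \<comment> \<open>completing the square in b for fixed a - b\<close>
    have n0: "real n > 0" using 5 by simp
    have "q = real n * ((a - b)^2 / 4) + 1 / real n - real n * ((a + b) / 2 + 1 / real n)^2"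
      unfolding q_def using n0 by (simp add: field_simps power2_eq_square)
    moreover have "0 \<le> real n * ((a + b) / 2 + 1 / real n)^2" by simp
    moreover have "real n * ((a - b)^2 / 4) \<le> real n * (4 / 10)" using w by (intro mult_left_mono) auto
    moreover have "1 / real n \<le> 1 / 9" using 5 by (simp add: field_simps)
    ultimately have q: "q \<le> 4 / 10 * real n + 1 / 9" by linarith
    define m1 m2 where m: "m1 = weight1 n" "m2 = weight2 n"
    have m0: "m1 \<ge> 0" "m2 \<ge> 0" using weights(1,2)[OF n3] by (auto simp: m)
    have M: "m1 * a + m2 * b = - 1" "m1 + m2 = real n"
      using weights(3,4)[OF n3] unfolding ab m by (simp_all add: algebra_simps)
    have Q: "m1 * a^2 + m2 * b^2 = q"
    proof -
      have "m1 * a^2 + m2 * b^2 = (a + b) * (m1 * a + m2 * b) - a * b * (m1 + m2)"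
        by (simp add: algebra_simps power2_eq_square)
      then show ?thesis unfolding M q_def by (simp add: algebra_simps)
    qed
    \<comment> \<open>the cubic moment is at least minus the quadratic one because both points are at least -1\<close>
    have "(a + b) * q + a * b \<ge> - q"
    proof -
      have "(a + b) * (m1 * a^2 + m2 * b^2) - a * b * (m1 * a + m2 * b) = m1 * a ^ 3 + m2 * b ^ 3"
        by (simp add: algebra_simps eval_nat_numeral)
      then have "(a + b) * q + a * b = m1 * a ^ 3 + m2 * b ^ 3" unfolding M Q by simp
      moreover have "(m1 * a^2) * (a + 1) \<ge> 0" "(m2 * b^2) * (b + 1) \<ge> 0"
        using a0 b0 m0 by (intro mult_nonneg_nonneg; simp)+
      moreover have "(m1 * a^2) * (a + 1) + (m2 * b^2) * (b + 1)
          = (m1 * a ^ 3 + m2 * b ^ 3) + (m1 * a^2 + m2 * b^2)"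
        by (simp add: algebra_simps eval_nat_numeral)
      ultimately show ?thesis unfolding Q by linarith
    qed
    then have "(real n - 2) * (2 * real n - 2 - q) \<le> (real n - 2) * (2 * real n - 2 + (a + b) * q + a * b)"
      using 5 by (intro mult_left_mono) auto
    moreover have "q * (4 * real n - 10) \<le> (4 / 10 * real n + 1 / 9) * (4 * real n - 10)"
      using q 5 by (intro mult_right_mono) auto
    moreover have "(4 / 10 * real n + 1 / 9) * (4 * real n - 10) \<le> (real n - 2) * (2 * real n - 2)"
    proof -
      have "0 \<le> (real n - 9) * (4 / 10 * real n + 1)" using 5 by simp
      moreover have "(real n - 2) * (2 * real n - 2) - (4 / 10 * real n + 1 / 9) * (4 * real n - 10)
          = (real n - 9) * (4 / 10 * real n + 1) + (7 / 45 * real n) + 9 + 46 / 9"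
        by (simp add: field_simps)
      moreover have "0 \<le> 7 / 45 * real n" by simp
      ultimately show ?thesis by linarith
    qed
    moreover have "(real n - 2) * (2 * real n - 2 - q) = (real n - 2) * (2 * real n - 2) - q * (4 * real n - 10) + q * (3 * real n - 8)"
      by (simp add: algebra_simps)
    ultimately show ?thesis by (intro crit) linarith
  qed
qed

section \<open>Zeros near the roots of unity\<close>

text \<open>If all zeros were farther from \<open>x\<close>, the product of the distances would exceed \<open>cmod (poly p x)\<close>.\<close>

lemma nearest_root:
  fixes p :: "complex poly"
  assumes "lead_coeff p = 1" "degree p > 0"
  shows "\<exists>v. poly p v = 0 \<and> cmod (x - v) ^ degree p \<le> cmod (poly p x)"
proof -
  have p0: "p \<noteq> 0" using assms by auto
  obtain A where A: "size A = degree p" "p = smult (lead_coeff p) (\<Prod>a\<in>#A. [:- a, 1:])"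
    using alg_closed_imp_factorization[OF p0] by blast
  have ev: "poly p y = (\<Prod>a\<in>#A. y - a)" for y
    by (subst A(2)) (simp add: assms(1) poly_prod_mset image_mset.compositionality o_def)
  have ne: "set_mset A \<noteq> {}" using A(1) assms(2) by auto
  obtain v where v: "v \<in># A" "\<And>a. a \<in># A \<Longrightarrow> cmod (x - v) \<le> cmod (x - a)"
    using arg_min_if_finite[of "set_mset A" "\<lambda>a. cmod (x - a)"] ne
    by (metis finite_set_mset linorder_le_less_linear)
  have "cmod (x - v) ^ size B \<le> cmod (\<Prod>a\<in>#B. x - a)" if "B \<subseteq># A" for B
    using that
  proof (induction B)
    case empty
    then show ?case by simp
  next
    case (add b B)
    have "b \<in># A" using add.prems by (meson insert_subset_eq_iff mset_subset_eqD union_single_eq_member)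
    moreover have "B \<subseteq># A" using add.prems by (meson mset_subset_eq_insertD subset_mset.less_imp_le)
    ultimately show ?case using add.IH v(2)[of b]
      by (simp add: norm_mult) (intro mult_mono; simp)
  qed
  from this[of A] have "cmod (x - v) ^ degree p \<le> cmod (poly p x)" using A(1) ev by simp
  moreover have "poly p v = 0" unfolding ev using v(1) by (auto simp: prod_mset_zero_iff)
  ultimately show ?thesis by blast
qed

context small_scale
begin

lemma ord_mono_mult: "ord s f \<Longrightarrow> ord t g \<Longrightarrow> m \<le> s + t \<Longrightarrow> ord m (\<lambda>i. f i * g i)"
  using ord_weaken[OF ord_mult] by blast

lemma ord_one_plus_power:
  assumes "ord s y"
  shows "ord (2 * s) (\<lambda>i. (1 + y i) ^ m - 1 - of_nat m * y i)"
proof (induction m)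
  case 0
  then show ?case by (simp add: ord_zero)
next
  case (Suc m)
  have yb: "ord 0 (\<lambda>i. 1 + y i)" by (intro ord_add ord_const ord_weaken[OF assms]) simp
  have "ord (2 * s) (\<lambda>i. ((1 + y i) ^ m - 1 - of_nat m * y i) * (1 + y i) + of_nat m * (y i * y i))"
    using ord_mult[OF Suc.IH yb] ord_mult[OF assms assms]
    by (intro ord_add ord_cmult) (simp_all add: mult_2)
  then show ?case by (simp add: algebra_simps)
qed

lemma ord_power_diff:
  assumes "ord s (\<lambda>i. w i - c)"
  shows "ord s (\<lambda>i. w i ^ k - c ^ k)"
proof -
  have "ord 0 (\<lambda>i. (w i - c) + c)" by (intro ord_add ord_const ord_weaken[OF assms]) simp
  then have w: "ord 0 w" by simp
  have "ord 0 (\<lambda>i. \<Sum>j<k. c ^ (k - Suc j) * w i ^ j)"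
    by (intro ord_sum ord_cmult) (use ord_power[OF w] in simp)
  from ord_mult[OF assms this] show ?thesis by (simp add: power_diff_sumr2)
qed

end

text \<open>A sequence of polynomials \<open>P\<close> with \<open>\<beta> = 1 - h^2\<close>, in normalised coordinates.  Let \<open>c\<close> be the centroid of the
  critical points, \<open>b = \<beta> - c\<close>, and \<open>z = c + b * v\<close>.  In the coordinate \<open>v\<close> the critical points are \<open>d i j\<close>, with
  sum zero, and the zero \<open>\<beta>\<close> is \<open>1\<close>; \<open>g = c / \<beta>\<close>.  The number \<open>r\<close> is a lower bound for the distance from
  \<open>\<beta>\<close> to the critical points and is assumed to reach the first-order value.  The sum in the last assumption is,
  up to a constant factor, the value \<open>P (c + b * v)\<close>, and its conclusion is \<open>|z| \<le> 1\<close>.\<close>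

locale sendov_family = small_scale h for h :: "nat \<Rightarrow> real" +
  fixes n :: nat and d :: "nat \<Rightarrow> nat \<Rightarrow> complex" and g :: "nat \<Rightarrow> complex" and r :: "nat \<Rightarrow> real"
  assumes n3: "3 \<le> n"
    and d_sum: "(\<Sum>j<n. d i j) = 0"
    and d_Re: "j < n \<Longrightarrow> ord 2 (\<lambda>i. Re (d i j))"
    and d_Im: "j < n \<Longrightarrow> ord 1 (\<lambda>i. Im (d i j))"
    and g_Re: "ord 2 (\<lambda>i. Re (g i))"
    and g_Im: "ord 1 (\<lambda>i. Im (g i))"
    and r_pos: "0 < r i"
    and r_lower: "ub 4 (\<lambda>i. 1 + (D1 n + D2 n / real n) * h i ^ 2 - r i)"
    and far: "j < n \<Longrightarrow> r i \<le> (1 - h i ^ 2) * cmod (1 - g i) * cmod (1 - d i j)"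
    and roots_in_disc: "(\<Sum>k\<le>n. of_real ((real n + 1) / (real n + 1 - real k)) * signed_esym n (d i) k
          * (v ^ (n + 1 - k) - 1)) = 0 \<Longrightarrow> cmod (v + g i * (1 - v)) * (1 - h i ^ 2) \<le> 1"
begin

abbreviation sg :: "nat \<Rightarrow> nat \<Rightarrow> complex" where "sg i k \<equiv> signed_esym n (d i) k"

text \<open>In the variable \<open>w = 1 / v\<close> the zeros satisfy \<open>w ^ (n + 1) * root_series i 1 = root_series i w\<close>.\<close>

definition root_coeff :: "nat \<Rightarrow> nat \<Rightarrow> complex" where
  "root_coeff k i = of_real ((real n + 1) / (real n + 1 - real k)) * sg i k"

definition root_series :: "nat \<Rightarrow> complex \<Rightarrow> complex" where
  "root_series i w = (\<Sum>k\<le>n. root_coeff k i * w ^ k)"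

lemma d_ord: "j < n \<Longrightarrow> ord 1 (\<lambda>i. d i j)"
  by (intro ord_complexI d_Im ord_weaken[OF d_Re]) auto

lemma signed_esym_ord: "ord k (\<lambda>i. sg i k)"
proof -
  have "ord k (\<lambda>i. signed_esym m (d i) k)" if "m \<le> n" for m k
    using that
  proof (induction m arbitrary: k)
    case 0
    show ?case by (cases k) (simp_all add: signed_esym_zero_left ord_const ord_zero)
  next
    case (Suc m)
    show ?case
    proof (cases k)
      case 0
      then show ?thesis using ord_const[of 1] by simp
    next
      case (Suc k')
      have "ord k (\<lambda>i. signed_esym m (d i) k - d i m * signed_esym m (d i) k')"
        using Suc.IH[of k] ord_mult[OF d_ord[of m] Suc.IH[of k']] Suc.prems Suc
        by (intro ord_diff) auto
      then show ?thesis unfolding signed_esym_Suc Suc by simp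
    qed
  qed
  then show ?thesis by simp
qed

lemma root_coeff_ord: "ord k (root_coeff k)"
  unfolding root_coeff_def by (intro ord_cmult signed_esym_ord)

lemma root_coeff_0: "root_coeff 0 i = 1"
  unfolding root_coeff_def by simp

lemma root_coeff_1: "root_coeff 1 i = 0"
  unfolding root_coeff_def using signed_esym_centered(1)[OF d_sum] by simp

lemma root_coeff_gt: "n < k \<Longrightarrow> root_coeff k i = 0"
  unfolding root_coeff_def by (simp add: signed_esym_eq_0)

lemma root_series_expand:
  assumes "ord 0 w"
  shows "ord 6 (\<lambda>i. root_series i (w i) - 1 - (root_coeff 2 i * w i ^ 2 + root_coeff 3 i * w i ^ 3 + root_coeff 4 i * w i ^ 4 + root_coeff 5 i * w i ^ 5))"
proof -
  have e: "root_series i x - 1 - (root_coeff 2 i * x ^ 2 + root_coeff 3 i * x ^ 3 + root_coeff 4 i * x ^ 4 + root_coeff 5 i * x ^ 5)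
      = (\<Sum>k\<in>{6..n + 5}. root_coeff k i * x ^ k)" for i x
  proof -
    \<comment> \<open>The longer range contains the indices up to 5 also for small \<open>n\<close>; the added coefficients vanish.\<close>
    have "root_series i x = (\<Sum>k\<le>n + 5. root_coeff k i * x ^ k)"
      unfolding root_series_def by (intro sum.mono_neutral_left) (auto simp: root_coeff_gt)
    also have "\<dots> = (\<Sum>k\<le>5. root_coeff k i * x ^ k) + (\<Sum>k\<in>{6..n + 5}. root_coeff k i * x ^ k)"
      by (subst sum.union_disjoint[symmetric]) (auto intro!: sum.cong)
    also have "(\<Sum>k\<le>5. root_coeff k i * x ^ k)
        = 1 + (root_coeff 2 i * x ^ 2 + root_coeff 3 i * x ^ 3 + root_coeff 4 i * x ^ 4 + root_coeff 5 i * x ^ 5)"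
      using root_coeff_1[of i] root_coeff_0[of i] by (simp add: eval_nat_numeral)
    finally show ?thesis by simp
  qed
  show ?thesis unfolding e
  proof (intro ord_sum)
    fix k assume "k \<in> {6..n + 5}"
    then show "ord 6 (\<lambda>i. root_coeff k i * w i ^ k)"
      using ord_power[OF assms, of k] by (intro ord_mono_mult[OF root_coeff_ord]) auto
  qed
qed

lemma root_series_expand4:
  assumes "ord 0 w"
  shows "ord 4 (\<lambda>i. root_series i (w i) - 1 - (root_coeff 2 i * w i ^ 2 + root_coeff 3 i * w i ^ 3))"
proof -
  have p: "ord 0 (\<lambda>i. w i ^ k)" for k using ord_power[OF assms, of k] by simp
  have "ord 4 (\<lambda>i. (root_series i (w i) - 1 - (root_coeff 2 i * w i ^ 2 + root_coeff 3 i * w i ^ 3 + root_coeff 4 i * w i ^ 4 + root_coeff 5 i * w i ^ 5))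
      + root_coeff 4 i * w i ^ 4 + root_coeff 5 i * w i ^ 5)"
    by (intro ord_add ord_weaken[OF root_series_expand[OF assms]] ord_mono_mult[OF root_coeff_ord p]) auto
  then show ?thesis by (simp add: algebra_simps)
qed

lemma root_series_ord2:
  assumes "ord 0 w"
  shows "ord 2 (\<lambda>i. root_series i (w i) - 1)"
proof -
  have p: "ord 0 (\<lambda>i. w i ^ k)" for k using ord_power[OF assms, of k] by simp
  have "ord 2 (\<lambda>i. (root_series i (w i) - 1 - (root_coeff 2 i * w i ^ 2 + root_coeff 3 i * w i ^ 3))
      + root_coeff 2 i * w i ^ 2 + root_coeff 3 i * w i ^ 3)"
    by (intro ord_add ord_weaken[OF root_series_expand4[OF assms]] ord_mono_mult[OF root_coeff_ord p]) auto
  then show ?thesis by simp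
qed

lemma g_ord1: "ord 1 g"
  by (intro ord_complexI g_Im ord_weaken[OF g_Re]) auto

text \<open>The normalised polynomial is \<open>O(h^2)\<close> at the root of unity \<open>1 / s\<close>, so it has a zero \<open>v\<close> converging to it.
  Factoring \<open>v ^ (n + 1) - 1\<close> improves convergence to the rate \<open>h^2\<close>.  The last conclusion is the
  logarithm of \<open>|z| \<le> 1\<close>, in which \<open>|v|\<close> is replaced by means of the equation for \<open>w = 1 / v\<close>.\<close>

lemma root_near:
  assumes s: "s ^ (n + 1) = 1"
  obtains w where "ord 2 (\<lambda>i. w i - s)"
    "\<forall>\<^sub>F i in sequentially. w i ^ (n + 1) * root_series i 1 = root_series i (w i)"
    "\<forall>\<^sub>F i in sequentially. ln (cmod (root_series i 1)) - ln (cmod (root_series i (w i)))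
        + (real n + 1) * ln (cmod (1 + g i * (w i - 1))) \<le> - (real n + 1) * ln (1 - h i ^ 2)"
proof -
  have s0: "s \<noteq> 0" using s by auto
  define t where "t = inverse s"
  have t: "t ^ (n + 1) = 1" using s unfolding t_def power_inverse by simp
  have t0: "t \<noteq> 0" using s0 by (simp add: t_def)
  have Gval: "(\<Sum>k\<le>n. root_coeff k i * v ^ (n + 1 - k)) = v ^ (n + 1) * root_series i (inverse v)" if "v \<noteq> 0" for v i
    unfolding root_series_def sum_distrib_left
  proof (intro sum.cong refl)
    fix k assume "k \<in> {..n}"
    then have "v ^ (n + 1) = v ^ (n + 1 - k) * v ^ k" by (simp flip: power_add)
    then show "root_coeff k i * v ^ (n + 1 - k) = v ^ (n + 1) * (root_coeff k i * inverse v ^ k)"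
      using that by (simp add: power_inverse)
  qed
  define q where "q i = (\<Sum>k\<le>n. monom (root_coeff k i) (n + 1 - k)) - [:root_series i 1:]" for i
  have qv: "poly (q i) v = (\<Sum>k\<le>n. root_coeff k i * (v ^ (n + 1 - k) - 1))" for i v
    unfolding q_def root_series_def by (simp add: poly_sum poly_monom right_diff_distrib sum_subtractf)
  have qmonic: "degree (q i) = n + 1 \<and> lead_coeff (q i) = 1" for i
  proof -
    have c: "coeff (q i) (n + 1) = 1"
    proof -
      have "coeff (q i) (n + 1) = (\<Sum>k\<le>n. if n + 1 - k = n + 1 then root_coeff k i else 0)"
        unfolding q_def by (simp add: coeff_sum)
      also have "\<dots> = (\<Sum>k\<le>n. if k = 0 then root_coeff k i else 0)" by (intro sum.cong) auto
      also have "\<dots> = 1" by (simp add: root_coeff_0)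
      finally show ?thesis .
    qed
    have "degree (q i) \<le> n + 1" unfolding q_def
      by (intro degree_diff_le degree_sum_le) (auto intro: order_trans[OF degree_monom_le])
    then have "degree (q i) = n + 1" using c by (intro antisym le_degree) auto
    then show ?thesis using c by simp
  qed
  have "\<forall>i. \<exists>v. poly (q i) v = 0 \<and> cmod (t - v) ^ (n + 1) \<le> cmod (poly (q i) t)"
    using nearest_root[of "q _" t] qmonic by (metis Suc_eq_plus1 zero_less_Suc)
  then obtain v where v0: "\<And>i. poly (q i) (v i) = 0"
    and vt: "\<And>i. cmod (t - v i) ^ (n + 1) \<le> cmod (poly (q i) t)" by metis
  have tail: "(\<Sum>k\<le>n. root_coeff k i * (x ^ (n + 1 - k) - 1)) = (x ^ (n + 1) - 1) + (\<Sum>k\<in>{2..n}. root_coeff k i * (x ^ (n + 1 - k) - 1))"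
    for i x
  proof -
    have "{..n} = {0, 1} \<union> {2..n}" using n3 by auto
    then show ?thesis using root_coeff_0[of i] root_coeff_1[of i] by (simp add: sum.union_disjoint)
  qed
  have tail_ord: "ord 2 (\<lambda>i. \<Sum>k\<in>{2..n}. root_coeff k i * (x i ^ (n + 1 - k) - 1))" if "ord 0 x" for x
  proof (intro ord_sum)
    fix k assume "k \<in> {2..n}"
    moreover have "ord 0 (\<lambda>i. x i ^ (n + 1 - k) - 1)"
      using ord_power[OF that, of "n + 1 - k"] by (intro ord_diff ord_const) simp
    ultimately show "ord 2 (\<lambda>i. root_coeff k i * (x i ^ (n + 1 - k) - 1))"
      by (intro ord_mono_mult[OF root_coeff_ord]) auto
  qed
  have "ord 2 (\<lambda>i. poly (q i) t)"
    unfolding qv tail using tail_ord[OF ord_const[of t]] t by simp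
  then have "(\<lambda>i. cmod (poly (q i) t)) \<longlonglongrightarrow> 0"
    by (intro tendsto_norm_zero ord_tendsto) auto
  then have "(\<lambda>i. cmod (t - v i) ^ (n + 1)) \<longlonglongrightarrow> 0"
    by (rule tendsto_sandwich[OF _ _ tendsto_const, rotated -1]) (use vt in auto)
  then have "(\<lambda>i. root (n + 1) (cmod (t - v i) ^ (n + 1))) \<longlonglongrightarrow> root (n + 1) 0"
    by (rule tendsto_real_root)
  then have "(\<lambda>i. cmod (t - v i)) \<longlonglongrightarrow> 0" by (simp add: real_root_power_cancel del: power_Suc)
  then have "(\<lambda>i. t - v i) \<longlonglongrightarrow> 0" by (rule tendsto_norm_zero_cancel)
  from tendsto_diff[OF tendsto_const[of t] this] have vlim: "v \<longlonglongrightarrow> t" by simp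
  then have vb: "ord 0 v" by (rule ord_bounded)
  have "v i ^ (n + 1) - 1 = - (\<Sum>k\<in>{2..n}. root_coeff k i * (v i ^ (n + 1 - k) - 1))" for i
    using v0[of i] unfolding qv tail by (simp add: eq_neg_iff_add_eq_0)
  then have vpow: "ord 2 (\<lambda>i. v i ^ (n + 1) - 1)" using ord_minus[OF tail_ord[OF vb]] by simp
  define Q where "Q i = (\<Sum>j<n + 1. t ^ (n + 1 - Suc j) * v i ^ j)" for i
  have fac: "v i ^ (n + 1) - 1 = (v i - t) * Q i" for i
    using power_diff_sumr2[of "v i" "n + 1" t] t unfolding Q_def by simp
  have "Q \<longlonglongrightarrow> (\<Sum>j<n + 1. t ^ (n + 1 - Suc j) * t ^ j)"
    unfolding Q_def by (intro tendsto_intros vlim)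
  also have "(\<Sum>j<n + 1. t ^ (n + 1 - Suc j) * t ^ j) = of_nat (n + 1) * t ^ n"
  proof -
    have "t ^ (n + 1 - Suc j) * t ^ j = t ^ n" if "j \<in> {..<n + 1}" for j
      using that by (simp flip: power_add)
    then show ?thesis by simp
  qed
  finally have Qlim: "Q \<longlonglongrightarrow> of_nat (n + 1) * t ^ n" .
  have Q0: "of_nat (n + 1) * t ^ n \<noteq> 0" using t0 by (simp del: of_nat_Suc)
  have "ord 0 (\<lambda>i. inverse (Q i))" by (rule ord_bounded[OF tendsto_inverse[OF Qlim Q0]])
  from ord_mult[OF vpow this] have "ord 2 (\<lambda>i. (v i - t) * Q i * inverse (Q i))" unfolding fac by simp
  moreover have "\<forall>\<^sub>F i in sequentially. Q i \<noteq> 0" using tendsto_imp_eventually_ne[OF Qlim Q0] .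
  then have "\<forall>\<^sub>F i in sequentially. (v i - t) * Q i * inverse (Q i) = v i - t"
    by eventually_elim simp
  ultimately have vt2: "ord 2 (\<lambda>i. v i - t)" by (rule ord_cong_ev[rotated])
  have vne: "\<forall>\<^sub>F i in sequentially. v i \<noteq> 0" using tendsto_imp_eventually_ne[OF vlim t0] .
  define w where "w i = inverse (v i)" for i
  have wlim: "w \<longlonglongrightarrow> s" unfolding w_def using tendsto_inverse[OF vlim t0] by (simp add: t_def)
  have w2: "ord 2 (\<lambda>i. w i - s)"
  proof -
    have "ord 2 (\<lambda>i. - s * ((v i - t) * w i))"
      using ord_mult[OF vt2 ord_bounded[OF wlim]] by (intro ord_cmult) simp
    moreover have "\<forall>\<^sub>F i in sequentially. - s * ((v i - t) * w i) = w i - s"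
      using vne by eventually_elim (use s0 in \<open>simp add: w_def t_def field_simps\<close>)
    ultimately show ?thesis by (rule ord_cong_ev[rotated])
  qed
  have rel: "\<forall>\<^sub>F i in sequentially. w i ^ (n + 1) * root_series i 1 = root_series i (w i)"
    using vne
  proof eventually_elim
    case (elim i)
    have "v i ^ (n + 1) * root_series i (w i) = (\<Sum>k\<le>n. root_coeff k i * v i ^ (n + 1 - k))"
      using Gval[OF elim] by (simp add: w_def)
    also have "\<dots> = root_series i 1" using v0[of i] unfolding qv root_series_def by (simp add: right_diff_distrib sum_subtractf)
    finally have "w i ^ (n + 1) * (v i ^ (n + 1) * root_series i (w i)) = w i ^ (n + 1) * root_series i 1" by simp
    moreover have "w i ^ (n + 1) * v i ^ (n + 1) = 1"
      unfolding power_mult_distrib[symmetric] using elim by (simp add: w_def)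
    ultimately show ?case by (metis mult.assoc mult_1)
  qed
  have wb: "ord 0 w" by (rule ord_bounded[OF wlim])
  have Gne: "\<forall>\<^sub>F i in sequentially. root_series i (x i) \<noteq> 0" if "ord 0 x" for x
    using ord_small_ev[OF root_series_ord2[OF that], of 1]
    by simp (erule eventually_mono, force)
  have gw: "ord 1 (\<lambda>i. g i * (w i - 1))"
    by (intro ord_mono_mult[OF g_ord1 ord_diff[OF wb ord_const]]) simp
  have star: "\<forall>\<^sub>F i in sequentially. ln (cmod (root_series i 1)) - ln (cmod (root_series i (w i)))
        + (real n + 1) * ln (cmod (1 + g i * (w i - 1))) \<le> - (real n + 1) * ln (1 - h i ^ 2)"
    using rel vne Gne[OF wb] Gne[OF ord_const[of 1]] ord_small_ev[OF gw order_refl zero_less_one]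
      ord_small_ev[OF ord_h order_refl zero_less_one]
  proof eventually_elim
    case (elim i)
    have w0: "w i \<noteq> 0" using elim(2) by (simp add: w_def)
    have a0: "1 + g i * (w i - 1) \<noteq> 0"
      using elim(5) by (metis add_eq_0_iff norm_minus_cancel norm_one order_less_irrefl)
    have hp: "1 - h i ^ 2 > 0" using elim(6) by (simp add: abs_square_less_1)
    have "v i + g i * (1 - v i) = v i * (1 + g i * (w i - 1))"
      using elim(2) by (simp add: w_def field_simps)
    moreover have "cmod (v i + g i * (1 - v i)) * (1 - h i ^ 2) \<le> 1"
      by (rule roots_in_disc) (use v0[of i] in \<open>simp add: qv root_coeff_def\<close>)
    ultimately have "cmod (v i) * cmod (1 + g i * (w i - 1)) * (1 - h i ^ 2) \<le> 1"
      by (simp add: norm_mult)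
    then have "ln (cmod (v i) * cmod (1 + g i * (w i - 1)) * (1 - h i ^ 2)) \<le> ln 1"
      using elim(2) a0 hp by (subst ln_le_cancel_iff) auto
    then have 1: "ln (cmod (v i)) + ln (cmod (1 + g i * (w i - 1))) + ln (1 - h i ^ 2) \<le> 0"
      using elim(2) a0 hp by (simp add: ln_mult)
    have "cmod (w i) ^ (n + 1) * cmod (root_series i 1) = cmod (root_series i (w i))"
      using elim(1) by (metis norm_mult norm_power)
    then have "ln (cmod (w i) ^ (n + 1) * cmod (root_series i 1)) = ln (cmod (root_series i (w i)))" by simp
    then have "(real n + 1) * ln (cmod (w i)) + ln (cmod (root_series i 1)) = ln (cmod (root_series i (w i)))"
      using w0 elim(4) by (simp add: ln_mult ln_realpow del: power_Suc) (simp add: algebra_simps)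
    moreover have "ln (cmod (w i)) = - ln (cmod (v i))"
      unfolding w_def norm_inverse using elim(2) by (simp add: ln_inverse)
    ultimately have 2: "ln (cmod (root_series i 1)) - ln (cmod (root_series i (w i))) = (real n + 1) * ln (cmod (v i))"
      by simp
    have "(real n + 1) * (ln (cmod (v i)) + ln (cmod (1 + g i * (w i - 1))) + ln (1 - h i ^ 2)) \<le> 0"
      using 1 by (simp add: mult_le_0_iff)
    then show ?case unfolding 2 by (simp add: algebra_simps)
  qed
  show thesis by (rule that[OF w2 rel star])
qed

text \<open>Linearisation of \<open>w ^ (n + 1) = root_series w / root_series 1\<close> at \<open>w = s\<close>.\<close>

lemma root_expand:
  assumes s: "s ^ (n + 1) = 1" and w2: "ord 2 (\<lambda>i. w i - s)"
    and rel: "\<forall>\<^sub>F i in sequentially. w i ^ (n + 1) * root_series i 1 = root_series i (w i)"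
  shows "ord 4 (\<lambda>i. w i - s - s * (root_coeff 2 i * (s^2 - 1) + root_coeff 3 i * (s ^ 3 - 1)) / of_nat (n + 1))"
proof -
  have s0: "s \<noteq> 0" using s by auto
  have "ord 0 (\<lambda>i. (w i - s) + s)" by (intro ord_add ord_const ord_weaken[OF w2]) simp
  then have wb: "ord 0 w" by simp
  define y where "y i = (w i - s) / s" for i
  have y2: "ord 2 y" unfolding y_def by (rule ord_divc[OF w2])
  have P: "ord 4 (\<lambda>i. (1 + y i) ^ (n + 1) - 1 - of_nat (n + 1) * y i)"
    using ord_one_plus_power[OF y2, of "n + 1"] by simp
  have yw: "(1 + y i) ^ (n + 1) = w i ^ (n + 1)" for i
  proof -
    have "1 + y i = w i / s" using s0 by (simp add: y_def field_simps)
    then show ?thesis using s by (simp add: power_divide)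
  qed
  have G1: "ord 2 (\<lambda>i. root_series i 1 - 1)" by (rule root_series_ord2[OF ord_const])
  have "(\<lambda>i. (root_series i 1 - 1) + 1) \<longlonglongrightarrow> 0 + 1" by (intro tendsto_intros ord_tendsto[OF G1]) simp
  then have G1lim: "(\<lambda>i. root_series i 1) \<longlonglongrightarrow> 1" by simp
  have G1inv: "ord 0 (\<lambda>i. inverse (root_series i 1))"
    by (rule ord_bounded[OF tendsto_inverse[OF G1lim]]) simp
  have Gd: "ord 2 (\<lambda>i. root_series i (w i) - root_series i 1)" using ord_diff[OF root_series_ord2[OF wb] G1] by simp
  have A: "ord 4 (\<lambda>i. (root_series i (w i) - root_series i 1) * ((root_series i 1 - 1) * inverse (root_series i 1)))"
    by (intro ord_mono_mult[OF Gd ord_mult[OF G1 G1inv]]) simp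
  have "\<forall>\<^sub>F i in sequentially. (root_series i (w i) - root_series i 1) * ((root_series i 1 - 1) * inverse (root_series i 1))
      = (root_series i (w i) - root_series i 1) - (w i ^ (n + 1) - 1)"
    using rel tendsto_imp_eventually_ne[OF G1lim one_neq_zero]
  proof eventually_elim
    case (elim i)
    have "w i ^ (n + 1) = root_series i (w i) * inverse (root_series i 1)" using elim by (simp add: field_simps)
    then show ?case using elim(2) by (simp add: field_simps)
  qed
  from ord_cong_ev[OF this A] have B: "ord 4 (\<lambda>i. (root_series i (w i) - root_series i 1) - (w i ^ (n + 1) - 1))" .
  have wp: "ord 2 (\<lambda>i. w i ^ k - s ^ k)" for k by (rule ord_power_diff[OF w2])
  have C: "ord 4 (\<lambda>i. (root_series i (w i) - root_series i 1) - (root_coeff 2 i * (s^2 - 1) + root_coeff 3 i * (s ^ 3 - 1)))"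
  proof -
    have "ord 4 (\<lambda>i. (root_series i (w i) - 1 - (root_coeff 2 i * w i ^ 2 + root_coeff 3 i * w i ^ 3))
        - (root_series i 1 - 1 - (root_coeff 2 i * 1 ^ 2 + root_coeff 3 i * 1 ^ 3))
        + root_coeff 2 i * (w i ^ 2 - s ^ 2) + root_coeff 3 i * (w i ^ 3 - s ^ 3))"
      by (intro ord_add ord_diff root_series_expand4[OF wb] root_series_expand4[OF ord_const]
          ord_mono_mult[OF root_coeff_ord wp]) auto
    then show ?thesis by (simp add: algebra_simps)
  qed
  have "ord 4 (\<lambda>i. (s / of_nat (n + 1)) * (((root_series i (w i) - root_series i 1) - (root_coeff 2 i * (s^2 - 1) + root_coeff 3 i * (s ^ 3 - 1)))
      - ((root_series i (w i) - root_series i 1) - (w i ^ (n + 1) - 1)) - ((1 + y i) ^ (n + 1) - 1 - of_nat (n + 1) * y i)))"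
    by (intro ord_cmult ord_diff B C P)
  moreover have "(s / of_nat (n + 1)) * (((root_series i (w i) - root_series i 1) - (root_coeff 2 i * (s^2 - 1) + root_coeff 3 i * (s ^ 3 - 1)))
      - ((root_series i (w i) - root_series i 1) - (w i ^ (n + 1) - 1)) - ((1 + y i) ^ (n + 1) - 1 - of_nat (n + 1) * y i))
      = w i - s - s * (root_coeff 2 i * (s^2 - 1) + root_coeff 3 i * (s ^ 3 - 1)) / of_nat (n + 1)" for i
  proof -
    define M :: complex where "M = of_nat (n + 1)"
    have M0: "M \<noteq> 0" unfolding M_def by (simp del: of_nat_add of_nat_Suc)
    define Z where "Z = root_coeff 2 i * (s^2 - 1) + root_coeff 3 i * (s ^ 3 - 1)"
    have "s * y i = w i - s" unfolding y_def using s0 by simp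
    moreover have "s / M * (M * y i - Z) = s * y i - s * Z / M"
      using M0 by (simp add: right_diff_distrib)
    moreover have "((root_series i (w i) - root_series i 1) - Z) - ((root_series i (w i) - root_series i 1) - (w i ^ (n + 1) - 1))
        - (w i ^ (n + 1) - 1 - M * y i) = M * y i - Z" by simp
    ultimately show ?thesis unfolding yw M_def[symmetric] Z_def[symmetric] by simp
  qed
  ultimately show ?thesis by simp
qed

end

section \<open>The first-order linear program\<close>

lemma Re_of_real_mult: "Re (of_real c * z) = c * Re z" and Im_of_real_mult: "Im (of_real c * z) = c * Im z"
  by simp_all

text \<open>The first equation is the dual value of the linear program.  The second and third are the solution of
  the system of its two active constraints: both unknowns are multiples of \<open>h^2\<close>, with factors \<open>- (n + 1) * D2\<close> and
  \<open>- (1 + D1 + D2)\<close>.\<close>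

lemma weights_first_order:
  assumes "n \<ge> 3"
  shows "weight1 n / (1 - u1 n) + weight2 n / (1 - u2 n) = real n * (1 + (D1 n + D2 n / real n))"
    and "2 * D2 n * (1 + u1 n) + 1 / (1 - u1 n) = 1 + D1 n + D2 n"
    and "1 / (1 - u1 n) - 1 / (1 - u2 n) = - 2 * D2 n * (u1 n - u2 n)"
    and "D2 n < 0"
proof -
  note u = u_bounds[OF assms]
  define a b m1 m2 where ab: "a = u1 n" "b = u2 n" "m1 = weight1 n" "m2 = weight2 n"
  have a: "1 - a > 0" and b: "1 - b > 0" using u by (auto simp: ab)
  have n0: "real n \<noteq> 0" using assms by simp
  have w: "m1 + m2 = real n" "m1 * a + m2 * b = - (real n + 1) / 2"
    using weights(3,4)[OF assms] by (auto simp: ab)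
  have E: "D1 n = (- 2 * a * b - 1) / (2 * (1 - a) * (1 - b))" "D2 n = - 1 / (2 * (1 - a) * (1 - b))"
    by (simp_all add: D1_def D2_def ab)
  have "(m1 / (1 - a) + m2 / (1 - b)) = (m1 * (1 - b) + m2 * (1 - a)) / ((1 - a) * (1 - b))"
    using a b by (simp add: add_frac_eq)
  also have "m1 * (1 - b) + m2 * (1 - a) = (m1 + m2) * (1 - a - b) + (m1 * a + m2 * b)"
    by (simp add: algebra_simps)
  also have "\<dots> = real n * (1 - a - b) - (real n + 1) / 2" unfolding w by (simp add: field_simps)
  also have "(real n * (1 - a - b) - (real n + 1) / 2) / ((1 - a) * (1 - b)) = real n * (1 + (D1 n + D2 n / real n))"
  proof -
    have "(1 - a) * (1 - b) \<noteq> 0" using a b by simp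
    moreover have "real n * (1 + (D1 n + D2 n / real n)) = real n * (1 + D1 n) + D2 n"
      using n0 by (simp add: field_simps)
    moreover have "D1 n = (- 2 * a * b - 1) / 2 / ((1 - a) * (1 - b))" "D2 n = - 1 / 2 / ((1 - a) * (1 - b))"
      unfolding E by (simp_all add: mult.assoc)
    moreover have "(real n * (1 - a - b) - (real n + 1) / 2) / W = real n * (1 + (- 2 * a * b - 1) / 2 / W) + - 1 / 2 / W"
      if "W \<noteq> 0" "W = (1 - a) * (1 - b)" for W
    proof -
      have "real n * (1 - a - b) - (real n + 1) / 2 = real n * (W + (- 2 * a * b - 1) / 2) - 1 / 2"
        unfolding that(2) by (simp add: field_simps)
      moreover have "(real n * (W + c) - e) / W = real n * (1 + c / W) + - e / W" for c e
        using that(1) by (simp add: field_simps)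
      ultimately show ?thesis by simp
    qed
    ultimately show ?thesis by metis
  qed
  finally show "weight1 n / (1 - u1 n) + weight2 n / (1 - u2 n) = real n * (1 + (D1 n + D2 n / real n))"
    by (simp add: ab)
  show "2 * D2 n * (1 + u1 n) + 1 / (1 - u1 n) = 1 + D1 n + D2 n"
    unfolding E ab[symmetric] using a b by (simp add: divide_simps) (simp add: algebra_simps)
  show "1 / (1 - u1 n) - 1 / (1 - u2 n) = - 2 * D2 n * (u1 n - u2 n)"
    unfolding E ab[symmetric] using a b by (simp add: divide_simps) (simp add: algebra_simps)
  have "0 < 2 * (1 - a) * (1 - b)" using a b by simp
  then show "D2 n < 0" unfolding E by (simp add: divide_neg_pos)
qed

context small_scale
begin

lemma ord_ln_h4: "ord 4 (\<lambda>i. ln (1 - h i ^ 2) + h i ^ 2)"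
  using ord_ln_real[OF ord_minus[OF ord_h_power[of 2]]] by simp

lemma ord_ln_h6: "ord 6 (\<lambda>i. ln (1 - h i ^ 2) + h i ^ 2 + h i ^ 4 / 2)"
proof -
  have o: "ord 2 (\<lambda>i. complex_of_real (- (h i ^ 2)))" by (intro ord_of_real ord_minus ord_h_power)
  have "ord 6 (\<lambda>i. ln (cmod (1 + complex_of_real (- (h i ^ 2)))) - Re (complex_of_real (- (h i ^ 2)))
     + Re ((complex_of_real (- (h i ^ 2)))^2) / 2)"
    using ord_ln_norm2[OF o] by simp
  moreover have "\<forall>\<^sub>F i in sequentially. ln (cmod (1 + complex_of_real (- (h i ^ 2)))) - Re (complex_of_real (- (h i ^ 2)))
     + Re ((complex_of_real (- (h i ^ 2)))^2) / 2 = ln (1 - h i ^ 2) + h i ^ 2 + h i ^ 4 / 2"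
    using ord_small_ev[OF ord_h order_refl zero_less_one]
  proof eventually_elim
    case (elim i)
    then have "h i ^ 2 < 1" by (simp add: abs_square_less_1)
    moreover have "1 + complex_of_real (- (h i ^ 2)) = complex_of_real (1 - h i ^ 2)" by simp
    ultimately have "cmod (1 + complex_of_real (- (h i ^ 2))) = 1 - h i ^ 2"
      by (metis abs_of_pos diff_gt_0_iff_gt norm_of_real)
    moreover have "Re ((complex_of_real (- (h i ^ 2)))^2) = h i ^ 4"
      by (simp flip: of_real_power power_mult)
    ultimately show ?case by simp
  qed
  ultimately show ?thesis by (rule ord_cong_ev[rotated])
qed

lemma ord_cmult_cancel: "ord s (\<lambda>i. c * f i) \<Longrightarrow> c \<noteq> 0 \<Longrightarrow> ord s f"
  by (simp add: ord_cmult_iff)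

lemma ub_cmult_cancel: "ub s (\<lambda>i. c * f i) \<Longrightarrow> 0 < c \<Longrightarrow> ub s f"
  using ub_cmult[of s "\<lambda>i. c * f i" "inverse c"] by (simp add: mult.assoc[symmetric])

lemma ub_of_nonpos: "(\<forall>\<^sub>F i in sequentially. f i \<le> 0) \<Longrightarrow> ub s f"
  by (rule ubI[of _ 0]) simp

end

context sendov_family
begin

definition N :: real where "N = real n + 1"

lemma N_pos: "N > 0" by (simp add: N_def)

lemma cnj_root: "s ^ (n + 1) = 1 \<Longrightarrow> cnj s ^ (n + 1) = 1"
  by (metis complex_cnj_one complex_cnj_power)

lemma root_near_bounded:
  assumes "ord 2 (\<lambda>i. w i - s)"
  shows "ord 0 w"
proof -
  have "ord 0 (\<lambda>i. (w i - s) + s)" by (intro ord_add ord_const ord_weaken[OF assms]) simp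
  then show ?thesis by simp
qed

lemma ln_root_series:
  assumes "ord 0 w"
  shows "ord 4 (\<lambda>i. ln (cmod (root_series i (w i))) - Re (root_series i (w i) - 1))"
  using ord_ln_norm1[OF root_series_ord2[OF assms]] by simp

lemma constraint2:
  assumes s: "s ^ (n + 1) = 1"
  shows "ub 2 (\<lambda>i. Re (g i * (s - 1)))"
proof -
  obtain w where w: "ord 2 (\<lambda>i. w i - s)"
    and star: "\<forall>\<^sub>F i in sequentially. ln (cmod (root_series i 1)) - ln (cmod (root_series i (w i)))
        + (real n + 1) * ln (cmod (1 + g i * (w i - 1))) \<le> - (real n + 1) * ln (1 - h i ^ 2)"
    using root_near[OF s] by blast
  note wb = root_near_bounded[OF w]
  define X where "X i = ln (cmod (root_series i 1)) - ln (cmod (root_series i (w i)))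
        + N * ln (cmod (1 + g i * (w i - 1))) + N * ln (1 - h i ^ 2)" for i
  have "ub 2 X"
    by (rule ub_of_nonpos) (use star in eventually_elim, simp add: X_def N_def algebra_simps)
  have lG: "ord 2 (\<lambda>i. ln (cmod (root_series i (x i))))" if "ord 0 x" for x
  proof -
    have "ord 2 (\<lambda>i. (ln (cmod (root_series i (x i))) - Re (root_series i (x i) - 1)) + Re (root_series i (x i) - 1))"
      by (intro ord_add ord_Re root_series_ord2[OF that] ord_weaken[OF ln_root_series[OF that]]) simp
    then show ?thesis by simp
  qed
  have gw: "ord 1 (\<lambda>i. g i * (w i - 1))"
    by (intro ord_mono_mult[OF g_ord1 ord_diff[OF wb ord_const]]) simp
  have lg: "ord 2 (\<lambda>i. ln (cmod (1 + g i * (w i - 1))) - Re (g i * (w i - 1)))"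
    using ord_ln_norm1[OF gw] by simp
  have "ord 2 (\<lambda>i. (ln (1 - h i ^ 2) + h i ^ 2) - h i ^ 2)"
    by (intro ord_diff ord_h_power ord_weaken[OF ord_ln_h4]) simp
  then have lh: "ord 2 (\<lambda>i. ln (1 - h i ^ 2))" by simp
  have gws: "ord 2 (\<lambda>i. Re (g i * (w i - s)))"
    by (intro ord_Re ord_mono_mult[OF g_ord1 w]) simp
  have "ord 2 (\<lambda>i. N * Re (g i * (s - 1)) - X i)"
  proof -
    have "ord 2 (\<lambda>i. - ln (cmod (root_series i 1)) + ln (cmod (root_series i (w i)))
        - N * (ln (cmod (1 + g i * (w i - 1))) - Re (g i * (w i - 1))) - N * ln (1 - h i ^ 2)
        - N * Re (g i * (w i - s)))"
      by (intro ord_add ord_diff ord_minus ord_cmult lG lg lh gws ord_const wb)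
    moreover have "- ln (cmod (root_series i 1)) + ln (cmod (root_series i (w i)))
        - N * (ln (cmod (1 + g i * (w i - 1))) - Re (g i * (w i - 1))) - N * ln (1 - h i ^ 2)
        - N * Re (g i * (w i - s)) = N * Re (g i * (s - 1)) - X i" for i
    proof -
      have "g i * (w i - 1) - g i * (w i - s) = g i * (s - 1)" by (simp add: algebra_simps)
      then have "Re (g i * (s - 1)) = Re (g i * (w i - 1)) - Re (g i * (w i - s))"
        by (metis minus_complex.sel(1))
      then show ?thesis unfolding X_def by (simp add: algebra_simps)
    qed
    ultimately show ?thesis by simp
  qed
  from ub_replace[OF \<open>ub 2 X\<close> this] have "ub 2 (\<lambda>i. N * Re (g i * (s - 1)))" .
  from ub_cmult_cancel[OF this N_pos] show ?thesis .
qed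

text \<open>At order \<open>h\<close> the constraints at conjugate roots of unity bound \<open>Im (g i)\<close> from above and from below.\<close>

lemma g_ord2: "ord 2 g"
proof -
  define s where "s = cis (theta1 n)"
  have s: "s ^ (n + 1) = 1" unfolding s_def by (rule cis_theta)
  have Re2: "ord 2 (\<lambda>i. Re (g i) * Re (s - 1))" by (intro ord_multc g_Re)
  have 1: "ub 2 (\<lambda>i. - (Im (g i) * Im s))"
    by (rule ub_replace[OF constraint2[OF s]]) (use ord_minus[OF Re2] in simp)
  have 2: "ub 2 (\<lambda>i. Im (g i) * Im s)"
    by (rule ub_replace[OF constraint2[OF cnj_root[OF s]]]) (use ord_minus[OF Re2] in simp)
  have "ord 2 (\<lambda>i. Im s * Im (g i))" using ord_of_ub[OF 2 1] by (simp add: mult.commute)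
  moreover have "Im s \<noteq> 0" using u_bounds(7)[OF n3] by (simp add: s_def)
  ultimately have "ord 2 (\<lambda>i. Im (g i))" by (simp add: ord_cmult_iff)
  then show ?thesis by (intro ord_complexI g_Re)
qed

text \<open>The inequality \<open>|z| \<le> 1\<close> at the zero near \<open>1 / s\<close>, with all terms of order \<open>h^4\<close> dropped, says that this quantity is
  not positive.\<close>

definition constraint_form4 :: "complex \<Rightarrow> nat \<Rightarrow> real" where
  "constraint_form4 s i = Re (root_coeff 2 i * (1 - s^2) + root_coeff 3 i * (1 - s ^ 3) + of_real N * (g i * (s - 1))) - N * h i ^ 2"

lemma constraint4:
  assumes s: "s ^ (n + 1) = 1"
  shows "ub 4 (constraint_form4 s)"
proof -
  obtain w where w: "ord 2 (\<lambda>i. w i - s)"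
    and star: "\<forall>\<^sub>F i in sequentially. ln (cmod (root_series i 1)) - ln (cmod (root_series i (w i)))
        + (real n + 1) * ln (cmod (1 + g i * (w i - 1))) \<le> - (real n + 1) * ln (1 - h i ^ 2)"
    using root_near[OF s] by blast
  note wb = root_near_bounded[OF w]
  define X where "X i = ln (cmod (root_series i 1)) - ln (cmod (root_series i (w i)))
        + N * ln (cmod (1 + g i * (w i - 1))) + N * ln (1 - h i ^ 2)" for i
  have X: "ub 4 X"
    by (rule ub_of_nonpos) (use star in eventually_elim, simp add: X_def N_def algebra_simps)
  have gw: "ord 2 (\<lambda>i. g i * (w i - 1))"
    by (intro ord_mono_mult[OF g_ord2 ord_diff[OF wb ord_const]]) simp
  have lg: "ord 4 (\<lambda>i. ln (cmod (1 + g i * (w i - 1))) - Re (g i * (w i - 1)))"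
    using ord_ln_norm1[OF gw] by simp
  define Z where "Z i = - (root_series i 1 - 1 - (root_coeff 2 i * 1 ^ 2 + root_coeff 3 i * 1 ^ 3))
     + (root_series i (w i) - 1 - (root_coeff 2 i * w i ^ 2 + root_coeff 3 i * w i ^ 3))
     + root_coeff 2 i * (w i ^ 2 - s ^ 2) + root_coeff 3 i * (w i ^ 3 - s ^ 3) - of_real N * (g i * (w i - s))" for i
  have Z: "ord 4 Z"
    unfolding Z_def by (intro ord_add ord_diff ord_minus ord_cmult root_series_expand4[OF wb] root_series_expand4[OF ord_const]
        ord_mono_mult[OF root_coeff_ord ord_power_diff[OF w]] ord_mono_mult[OF g_ord2 w]) auto
  have eq: "root_coeff 2 i * (1 - s^2) + root_coeff 3 i * (1 - s ^ 3) + of_real N * (g i * (s - 1))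
      = (root_series i 1 - 1) - (root_series i (w i) - 1) + of_real N * (g i * (w i - 1)) + Z i" for i
    unfolding Z_def by (simp add: algebra_simps)
  have "ord 4 (\<lambda>i. constraint_form4 s i - X i)"
  proof -
    have "ord 4 (\<lambda>i. - (ln (cmod (root_series i 1)) - Re (root_series i 1 - 1)) + (ln (cmod (root_series i (w i))) - Re (root_series i (w i) - 1))
        - N * (ln (cmod (1 + g i * (w i - 1))) - Re (g i * (w i - 1))) - N * (ln (1 - h i ^ 2) + h i ^ 2)
        + Re (Z i))"
      by (intro ord_add ord_diff ord_minus ord_cmult ln_root_series lg ord_ln_h4 ord_const wb ord_Re Z)
    moreover have "- (ln (cmod (root_series i 1)) - Re (root_series i 1 - 1)) + (ln (cmod (root_series i (w i))) - Re (root_series i (w i) - 1))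
        - N * (ln (cmod (1 + g i * (w i - 1))) - Re (g i * (w i - 1))) - N * (ln (1 - h i ^ 2) + h i ^ 2)
        + Re (Z i) = constraint_form4 s i - X i" for i
    proof -
      have "constraint_form4 s i = Re (root_series i 1 - 1) - Re (root_series i (w i) - 1) + N * Re (g i * (w i - 1)) + Re (Z i) - N * h i ^ 2"
        unfolding constraint_form4_def eq by (simp only: plus_complex.sel minus_complex.sel Re_complex_of_real Re_of_real_mult)
      then show ?thesis unfolding X_def by (simp add: algebra_simps)
    qed
    ultimately show ?thesis by simp
  qed
  from ub_replace[OF X this] show ?thesis .
qed

abbreviation xx where "xx i j \<equiv> Re (d i j)"
abbreviation yy where "yy i j \<equiv> Im (d i j)"
definition Ssq where "Ssq i = (\<Sum>j<n. (yy i j)^2)"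
definition Y3 where "Y3 i = (\<Sum>j<n. (yy i j) ^ 3)"
definition Y4 where "Y4 i = (\<Sum>j<n. (yy i j) ^ 4)"

lemma sum_xx: "(\<Sum>j<n. xx i j) = 0" and sum_yy: "(\<Sum>j<n. yy i j) = 0"
  using d_sum[of i] by (metis Re_sum zero_complex.sel(1), metis Im_sum zero_complex.sel(2))

lemma Re_sig3: "ord 4 (\<lambda>i. Re (sg i 3))"
proof -
  have "ord 4 (\<lambda>i. Re (d i j ^ 3))" if "j < n" for j
  proof -
    have "ord 4 (\<lambda>i. xx i j ^ 3 - 3 * (xx i j * (yy i j) ^ 2))"
      using ord_power[OF d_Re[OF that], of 3] ord_mult[OF d_Re[OF that] ord_power[OF d_Im[OF that], of 2]]
      by (intro ord_diff ord_cmult) (auto elim: ord_weaken)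
    moreover have "Re (z ^ 3) = Re z ^ 3 - 3 * (Re z * (Im z) ^ 2)" for z
      by (simp add: eval_nat_numeral algebra_simps)
    ultimately show ?thesis by simp
  qed
  then have "ord 4 (\<lambda>i. - (\<Sum>j<n. Re (d i j ^ 3)) / 3)"
    by (intro ord_divc ord_minus ord_sum) auto
  then show ?thesis unfolding signed_esym_centered(3)[OF d_sum] by simp
qed

lemma Re_root_coeff: "Re (root_coeff k i) = N / (N - real k) * Re (sg i k)"
  and Im_root_coeff: "Im (root_coeff k i) = N / (N - real k) * Im (sg i k)"
  unfolding root_coeff_def N_def by (simp_all only: Re_of_real_mult Im_of_real_mult)

text \<open>The mean of the constraints at \<open>cis t\<close> and its conjugate, for \<open>u = cos t\<close>, divided by \<open>1 - u\<close>.  Only real parts of the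
  coefficients survive in the mean, and the term with \<open>root_coeff 3\<close>, whose real part is \<open>O(h^4)\<close>, is left out.\<close>

definition avg_constraint :: "real \<Rightarrow> nat \<Rightarrow> real" where
  "avg_constraint u i = 2 * Re (root_coeff 2 i) * (1 + u) - N * Re (g i) - N * h i ^ 2 / (1 - u)"

lemma cis_powers:
  "Re ((cis t)^2) = 2 * (cos t)^2 - 1" "Re (cis t ^ 3) = 4 * cos t ^ 3 - 3 * cos t"
  "Im ((cis t)^2) = 2 * cos t * sin t" "Im (cis t ^ 3) = (4 * (cos t)^2 - 1) * sin t"
proof -
  show "Re ((cis t)^2) = 2 * (cos t)^2 - 1" by (simp add: Complex.DeMoivre cos_double_cos)
  show "Re (cis t ^ 3) = 4 * cos t ^ 3 - 3 * cos t" by (simp add: Complex.DeMoivre cos_treble_cos)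
  show "Im ((cis t)^2) = 2 * cos t * sin t" by (simp add: Complex.DeMoivre sin_double)
  have "Im (cis t ^ 3) = 3 * (cos t)^2 * sin t - sin t ^ 3"
    by (simp add: eval_nat_numeral algebra_simps)
  also have "sin t ^ 3 = sin t * (1 - (cos t)^2)"
    unfolding sin_squared_eq[symmetric] by (simp add: eval_nat_numeral)
  finally show "Im (cis t ^ 3) = (4 * (cos t)^2 - 1) * sin t" by (simp add: algebra_simps)
qed

lemma constraint_form4_sum:
  assumes "cos t \<noteq> 1"
  shows "constraint_form4 (cis t) i + constraint_form4 (cnj (cis t)) i
    = 2 * (1 - cos t) * avg_constraint (cos t) i + 2 * Re (root_coeff 3 i) * (1 - (4 * cos t ^ 3 - 3 * cos t))"
proof -
  have R: "Re (z * (1 - q)) + Re (z * (1 - cnj q)) = 2 * Re z * (1 - Re q)" for z q by (simp add: algebra_simps)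
  have R': "Re (z * (q - 1)) + Re (z * (cnj q - 1)) = - 2 * Re z * (1 - Re q)" for z q by (simp add: algebra_simps)
  have "constraint_form4 (cis t) i + constraint_form4 (cnj (cis t)) i
    = (Re (root_coeff 2 i * (1 - (cis t)^2)) + Re (root_coeff 2 i * (1 - cnj ((cis t)^2))))
      + (Re (root_coeff 3 i * (1 - cis t ^ 3)) + Re (root_coeff 3 i * (1 - cnj (cis t ^ 3))))
      + N * (Re (g i * (cis t - 1)) + Re (g i * (cnj (cis t) - 1))) - 2 * N * h i ^ 2"
    unfolding constraint_form4_def complex_cnj_power
    by (simp only: plus_complex.sel Re_of_real_mult) (simp add: algebra_simps)
  also have "\<dots> = 2 * Re (root_coeff 2 i) * (1 - (2 * (cos t)^2 - 1))
     + 2 * Re (root_coeff 3 i) * (1 - (4 * cos t ^ 3 - 3 * cos t))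
     + N * (- 2 * Re (g i) * (1 - cos t)) - 2 * N * h i ^ 2"
    unfolding R R' cis_powers by simp
  also have "\<dots> = 2 * (1 - cos t) * avg_constraint (cos t) i + 2 * Re (root_coeff 3 i) * (1 - (4 * cos t ^ 3 - 3 * cos t))"
  proof -
    define q where "q = N * h i ^ 2 / (1 - cos t)"
    have q: "N * h i ^ 2 = (1 - cos t) * q" using assms by (simp add: q_def)
    have c: "avg_constraint (cos t) i = 2 * Re (root_coeff 2 i) * (1 + cos t) - N * Re (g i) - q"
      by (simp add: avg_constraint_def q_def)
    have "2 * N * h i ^ 2 = 2 * ((1 - cos t) * q)" using q by simp
    then show ?thesis unfolding c by (simp add: algebra_simps power2_eq_square)
  qed
  finally show ?thesis .
qed

lemma Re_root_coeff3: "ord 4 (\<lambda>i. Re (root_coeff 3 i))"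
  unfolding Re_root_coeff by (intro ord_cmult Re_sig3)

lemma avg_constraint_ub:
  assumes "cis t ^ (n + 1) = 1" "cos t < 1"
  shows "ub 4 (avg_constraint (cos t))"
proof -
  have "ub 4 (\<lambda>i. constraint_form4 (cis t) i + constraint_form4 (cnj (cis t)) i)"
    by (intro ub_add constraint4 assms(1) cnj_root)
  then have "ub 4 (\<lambda>i. 2 * (1 - cos t) * avg_constraint (cos t) i)"
  proof (rule ub_replace)
    have "cos t \<noteq> 1" using assms(2) by simp
    from ord_minus[OF ord_multc[OF ord_cmult[OF Re_root_coeff3, of 2], of "1 - (4 * cos t ^ 3 - 3 * cos t)"]]
    show "ord 4 (\<lambda>i. 2 * (1 - cos t) * avg_constraint (cos t) i - (constraint_form4 (cis t) i + constraint_form4 (cnj (cis t)) i))"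
      unfolding constraint_form4_sum[OF \<open>cos t \<noteq> 1\<close>] by simp
  qed
  from ub_cmult_cancel[OF this] assms(2) show ?thesis by simp
qed

definition crit_prod :: "nat \<Rightarrow> complex" where "crit_prod i = (\<Prod>j<n. 1 - d i j)"

lemma crit_prod_expand: "ord 6 (\<lambda>i. crit_prod i - 1 - (sg i 2 + sg i 3 + sg i 4 + sg i 5))"
proof -
  have e: "crit_prod i - 1 - (sg i 2 + sg i 3 + sg i 4 + sg i 5)
      = (\<Sum>k\<in>{6..n + 5}. sg i k)" for i
  proof -
    have "crit_prod i = (\<Sum>k\<le>n. sg i k)" unfolding crit_prod_def using sum_signed_esym[of n "d i" 1] by simp
    also have "\<dots> = (\<Sum>k\<le>n + 5. sg i k)"
      by (intro sum.mono_neutral_left) (auto simp: signed_esym_eq_0)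
    also have "\<dots> = (\<Sum>k\<le>5. sg i k) + (\<Sum>k\<in>{6..n + 5}. sg i k)"
      by (subst sum.union_disjoint[symmetric]) (auto intro!: sum.cong)
    also have "(\<Sum>k\<le>5. sg i k) = 1 + (sg i 2 + sg i 3 + sg i 4 + sg i 5)"
      using signed_esym_centered(1)[OF d_sum[of i]] by (simp add: eval_nat_numeral)
    finally show ?thesis by simp
  qed
  show ?thesis unfolding e
    by (intro ord_sum) (auto intro: ord_weaken[OF signed_esym_ord])
qed

lemma crit_prod_expand4: "ord 4 (\<lambda>i. crit_prod i - 1 - (sg i 2 + sg i 3))"
proof -
  have "ord 4 (\<lambda>i. (crit_prod i - 1 - (sg i 2 + sg i 3 + sg i 4 + sg i 5))
     + sg i 4 + sg i 5)"
    by (intro ord_add ord_weaken[OF crit_prod_expand] signed_esym_ord) (auto intro: ord_weaken[OF signed_esym_ord])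
  then show ?thesis by (simp add: algebra_simps)
qed

lemma crit_prod_ord2: "ord 2 (\<lambda>i. crit_prod i - 1)"
proof -
  have "ord 2 (\<lambda>i. (crit_prod i - 1 - (sg i 2 + sg i 3)) + sg i 2 + sg i 3)"
    by (intro ord_add ord_weaken[OF crit_prod_expand4] signed_esym_ord) (auto intro: ord_weaken[OF signed_esym_ord])
  then show ?thesis by simp
qed

text \<open>Adding \<open>ln (cmod (1 - d i j))\<close> gives the logarithm of the quotient of the distance to the \<open>j\<close>-th critical point by
  \<open>r\<close>.\<close>

definition log_gap :: "nat \<Rightarrow> real" where "log_gap i = ln (1 - h i ^ 2) + ln (cmod (1 - g i)) - ln (r i)"

lemma factors_pos:
  assumes "j < n"
  shows "1 - h i ^ 2 > 0" "cmod (1 - g i) > 0" "cmod (1 - d i j) > 0"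
proof -
  have "0 < (1 - h i ^ 2) * cmod (1 - g i) * cmod (1 - d i j)"
    using far[OF assms, of i] r_pos[of i] by linarith
  then have "0 < (1 - h i ^ 2) * (cmod (1 - g i) * cmod (1 - d i j))" by (simp add: mult.assoc)
  moreover have "0 \<le> cmod (1 - g i) * cmod (1 - d i j)" by simp
  ultimately have "0 < 1 - h i ^ 2" "0 < cmod (1 - g i) * cmod (1 - d i j)"
    by (auto simp: zero_less_mult_iff)
  then show "1 - h i ^ 2 > 0" "cmod (1 - g i) > 0" "cmod (1 - d i j) > 0"
    by (auto simp: zero_less_mult_iff)
qed

lemma slack_nonneg:
  assumes "j < n"
  shows "0 \<le> log_gap i + ln (cmod (1 - d i j))"
proof -
  have "ln (r i) \<le> ln ((1 - h i ^ 2) * cmod (1 - g i) * cmod (1 - d i j))"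
    using far[OF assms, of i] r_pos[of i] by (subst ln_le_cancel_iff) auto
  also have "\<dots> = ln (1 - h i ^ 2) + ln (cmod (1 - g i)) + ln (cmod (1 - d i j))"
    using factors_pos[OF assms, of i] by (simp add: ln_mult)
  finally show ?thesis unfolding log_gap_def by simp
qed

lemma slack_sum: "(\<Sum>j<n. log_gap i + ln (cmod (1 - d i j))) = real n * log_gap i + ln (cmod (crit_prod i))"
proof -
  have "ln (cmod (crit_prod i)) = (\<Sum>j<n. ln (cmod (1 - d i j)))"
    unfolding crit_prod_def prod_norm[symmetric] using factors_pos(3)[of _ i] by (subst ln_prod) auto
  then show ?thesis by (simp add: sum.distrib)
qed

text \<open>Up to \<open>O(h^4)\<close> this is minus the sum of these logarithmic slacks.\<close>

definition objective :: "nat \<Rightarrow> real" where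
  "objective i = real n * ln (r i) + real n * h i ^ 2 + real n * Re (g i) - Re (sg i 2)"

lemma slack_objective: "ord 4 (\<lambda>i. (real n * log_gap i + ln (cmod (crit_prod i))) + objective i)"
proof -
  have mg: "ord 2 (\<lambda>i. - g i)" by (intro ord_minus g_ord2)
  have "ord 4 (\<lambda>i. real n * (ln (1 - h i ^ 2) + h i ^ 2) + real n * (ln (cmod (1 + - g i)) - Re (- g i))
     + (ln (cmod (1 + (crit_prod i - 1))) - Re (crit_prod i - 1))
     + Re (crit_prod i - 1 - (sg i 2 + sg i 3)) + Re (sg i 3))"
    using ord_ln_norm1[OF mg] ord_ln_norm1[OF crit_prod_ord2]
    by (intro ord_add ord_cmult ord_ln_h4 ord_Re crit_prod_expand4 Re_sig3) simp_all
  then show ?thesis unfolding log_gap_def objective_def by (simp add: algebra_simps)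
qed

lemma r_lower_ln: "ub 4 (\<lambda>i. (D1 n + D2 n / real n) * h i ^ 2 - ln (r i))"
proof -
  define c where "c = D1 n + D2 n / real n"
  obtain C where C: "\<forall>\<^sub>F i in sequentially. 1 + c * h i ^ 2 - r i \<le> C * h i ^ 4"
    using r_lower unfolding ub_def c_def by blast
  define f where "f i = c * h i ^ 2 - C * h i ^ 4" for i
  have f2: "ord 2 f" unfolding f_def
    by (intro ord_diff ord_cmult ord_h_power ord_weaken[OF ord_h_power[of 4]]) simp
  have ev: "\<forall>\<^sub>F i in sequentially. c * h i ^ 2 - ln (r i) \<le> c * h i ^ 2 - ln (1 + f i)"
    using C ord_small_ev[OF f2 _ zero_less_one, simplified]
  proof eventually_elim
    case (elim i)
    then have "1 + f i > 0" "1 + f i \<le> r i" unfolding f_def by auto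
    then have "ln (1 + f i) \<le> ln (r i)" by simp
    then show ?case by simp
  qed
  have "ord 4 (\<lambda>i. - (ln (1 + f i) - f i) + C * h i ^ 4)"
    using ord_ln_real[OF f2] by (intro ord_add ord_minus ord_cmult ord_h_power) simp
  then have "ord 4 (\<lambda>i. c * h i ^ 2 - ln (1 + f i))" unfolding f_def by (simp add: algebra_simps)
  from ub_mono_ev[OF ev ub_ord[OF this]] show ?thesis unfolding c_def .
qed

lemma objective_ub: "ub 4 objective"
proof -
  have "ub 4 (\<lambda>i. - (real n * log_gap i + ln (cmod (crit_prod i))))"
    by (rule ub_of_nonpos, rule always_eventually) (auto simp: slack_sum[symmetric] intro!: sum_nonneg slack_nonneg)
  then show ?thesis by (rule ub_replace) (use slack_objective in \<open>simp add: algebra_simps\<close>)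
qed

text \<open>Linear programming duality: the dual weights combine the two averaged constraints into the negative of the
  objective, up to the assumed lower bound on \<open>r\<close>.\<close>

lemma lp_identity:
  "(real n * ((D1 n + D2 n / real n) * h i ^ 2 - ln (r i))) + objective i
     + weight1 n / N * avg_constraint (u1 n) i + weight2 n / N * avg_constraint (u2 n) i = 0"
proof -
  note w = weights[OF n3]
  note wf = weights_first_order(1)[OF n3]
  define a where "a = Re (root_coeff 2 i)"
  have N2: "N - 2 \<noteq> 0" using n3 by (simp add: N_def)
  have e: "Re (sg i 2) = (N - 2) / N * a"
    unfolding a_def Re_root_coeff using N2 N_pos by simp
  have "weight1 n / N * avg_constraint (u1 n) i + weight2 n / N * avg_constraint (u2 n) i
    = (2 * a / N) * ((weight1 n + weight2 n) + (weight1 n * u1 n + weight2 n * u2 n))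
      - (weight1 n + weight2 n) * Re (g i) - h i ^ 2 * (weight1 n / (1 - u1 n) + weight2 n / (1 - u2 n))"
  proof -
    have *: "w / N * avg_constraint u i = (2 * a / N) * (w + w * u) - w * Re (g i) - h i ^ 2 * (w / (1 - u))" for w u
    proof -
      define q where "q = 1 / (1 - u)"
      have c: "avg_constraint u i = 2 * a * (1 + u) - N * Re (g i) - N * h i ^ 2 * q"
        unfolding avg_constraint_def a_def q_def by simp
      have q: "w / (1 - u) = w * q" by (simp add: q_def)
      show ?thesis unfolding c q using N_pos by (simp add: field_simps)
    qed
    define c where "c = 2 * a / N"
    show ?thesis unfolding * c_def[symmetric] by (simp add: algebra_simps)
  qed
  also have "\<dots> = (2 * a / N) * (real n + - (real n + 1) / 2) - real n * Re (g i)
      - h i ^ 2 * (real n * (1 + (D1 n + D2 n / real n)))"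
    unfolding w wf by simp
  also have "(2 * a / N) * (real n + - (real n + 1) / 2) = (N - 2) / N * a"
    unfolding N_def by (simp add: field_simps)
  finally have fin: "weight1 n / N * avg_constraint (u1 n) i + weight2 n / N * avg_constraint (u2 n) i
    = (N - 2) / N * a - real n * Re (g i) - h i ^ 2 * (real n * (1 + (D1 n + D2 n / real n)))" .
  have gen: "m * (q * H - l) + (m * l + m * H + m * c - E) + X + Y = 0"
    if "X + Y = E - m * c - H * (m * (1 + q))" for m q H l c E X Y :: real
    using that by (simp add: algebra_simps)
  show ?thesis unfolding objective_def e by (rule gen[OF fin])
qed

text \<open>Four quantities that are bounded above by \<open>O(h^4)\<close> have sum zero, so each is also bounded below.\<close>

lemma lp_tight: "ord 4 objective" "ord 4 (avg_constraint (u1 n))" "ord 4 (avg_constraint (u2 n))"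
proof -
  define A where "A i = real n * ((D1 n + D2 n / real n) * h i ^ 2 - ln (r i))" for i
  define B where "B i = weight1 n / N * avg_constraint (u1 n) i" for i
  define C where "C i = weight2 n / N * avg_constraint (u2 n) i" for i
  have s: "A i + objective i + B i + C i = 0" for i unfolding A_def B_def C_def by (rule lp_identity)
  note w = weights[OF n3] and u = u_bounds[OF n3]
  have A: "ub 4 A" unfolding A_def by (intro ub_cmult r_lower_ln) simp
  have "ub 4 (avg_constraint (u1 n))" "ub 4 (avg_constraint (u2 n))"
    unfolding u1_theta u2_theta
    by (intro avg_constraint_ub cis_theta; use u in \<open>simp add: u1_theta u2_theta\<close>)+
  moreover have "0 \<le> weight1 n / N" "0 \<le> weight2 n / N" using w(1,2) N_pos by simp_all
  ultimately have B: "ub 4 B" and C: "ub 4 C"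
    unfolding B_def C_def using ub_cmult by blast+
  have "ub 4 (\<lambda>i. A i + B i + C i)" by (intro ub_add A B C)
  moreover have "A i + B i + C i = - objective i" for i using s[of i] by simp
  ultimately show "ord 4 objective" using ord_of_ub[OF objective_ub] by simp
  have "ub 4 (\<lambda>i. A i + objective i + C i)" by (intro ub_add A objective_ub C)
  moreover have "A i + objective i + C i = - B i" for i using s[of i] by simp
  ultimately have "ord 4 B" using ord_of_ub[OF B] by simp
  then show "ord 4 (avg_constraint (u1 n))" unfolding B_def by (rule ord_cmult_cancel) (use w(1) N_pos in simp)
  have "ub 4 (\<lambda>i. A i + objective i + B i)" by (intro ub_add A objective_ub B)
  moreover have "A i + objective i + B i = - C i" for i using s[of i] by simp
  ultimately have "ord 4 C" using ord_of_ub[OF C] by simp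
  then show "ord 4 (avg_constraint (u2 n))" unfolding C_def by (rule ord_cmult_cancel) (use w(2) N_pos in simp)
qed

lemma root_coeff2_first: "ord 4 (\<lambda>i. Re (root_coeff 2 i) + N * D2 n * h i ^ 2)"
proof -
  have u: "u1 n - u2 n \<noteq> 0" using u_bounds(6)[OF n3] by simp
  have "ord 4 (\<lambda>i. avg_constraint (u1 n) i - avg_constraint (u2 n) i)" by (intro ord_diff lp_tight)
  moreover have "avg_constraint (u1 n) i - avg_constraint (u2 n) i = 2 * (u1 n - u2 n) * (Re (root_coeff 2 i) + N * D2 n * h i ^ 2)" for i
  proof -
    have "avg_constraint (u1 n) i - avg_constraint (u2 n) i = 2 * Re (root_coeff 2 i) * (u1 n - u2 n)
        - N * h i ^ 2 * (1 / (1 - u1 n) - 1 / (1 - u2 n))"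
      unfolding avg_constraint_def by (simp add: algebra_simps)
    then show ?thesis unfolding weights_first_order(3)[OF n3] by (simp add: algebra_simps)
  qed
  ultimately show ?thesis using u by (simp add: ord_cmult_iff)
qed

lemma g_first: "ord 4 (\<lambda>i. Re (g i) + (1 + D1 n + D2 n) * h i ^ 2)"
proof -
  have "ord 4 (\<lambda>i. (- 1 / N) * (avg_constraint (u1 n) i - 2 * (1 + u1 n) * (Re (root_coeff 2 i) + N * D2 n * h i ^ 2)))"
    by (intro ord_cmult ord_diff lp_tight root_coeff2_first)
  moreover have "(- 1 / N) * (avg_constraint (u1 n) i - 2 * (1 + u1 n) * (Re (root_coeff 2 i) + N * D2 n * h i ^ 2))
     = Re (g i) + (1 + D1 n + D2 n) * h i ^ 2" for i
  proof -
    define q where "q = 1 / (1 - u1 n)"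
    have "avg_constraint (u1 n) i = 2 * Re (root_coeff 2 i) * (1 + u1 n) - N * Re (g i) - N * h i ^ 2 * q"
      unfolding avg_constraint_def q_def by simp
    then show ?thesis
      unfolding weights_first_order(2)[OF n3, folded q_def, symmetric] using N_pos
      by (simp add: field_simps)
  qed
  ultimately show ?thesis by simp
qed

lemma slack_ord: "j < n \<Longrightarrow> ord 4 (\<lambda>i. log_gap i + ln (cmod (1 - d i j)))"
proof -
  assume j: "j < n"
  have "ord 4 (\<lambda>i. ((real n * log_gap i + ln (cmod (crit_prod i))) + objective i) - objective i)"
    by (intro ord_diff slack_objective lp_tight)
  then have "ord 4 (\<lambda>i. \<Sum>j<n. log_gap i + ln (cmod (1 - d i j)))" unfolding slack_sum by simp
  from ord_of_nonneg_sum[OF _ _ this] j show ?thesis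
    by (auto intro: slack_nonneg)
qed

text \<open>By tightness all critical points lie, up to \<open>O(h^4)\<close>, on one circle about \<open>1\<close>.  Near the origin this circle is
  the parabola \<open>x = y^2 / 2 + const\<close>, and the sum zero condition determines the constant.\<close>

lemma x_expand: "j < n \<Longrightarrow> ord 4 (\<lambda>i. xx i j - (yy i j)^2 / 2 + Ssq i / (2 * real n))"
proof -
  assume j: "j < n"
  have X: "ord 4 (\<lambda>i. xx i j - (yy i j)^2 / 2 - log_gap i)" if j: "j < n" for j
  proof -
    define f where "f i = - 2 * xx i j + (xx i j)^2 + (yy i j)^2" for i
    have f2: "ord 2 f" unfolding f_def
      using ord_power[OF d_Im[OF j], of 2] ord_power[OF d_Re[OF j], of 2]
      by (intro ord_add ord_cmult d_Re j) (auto elim: ord_weaken)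
    have lnf: "ln (1 + f i) = 2 * ln (cmod (1 - d i j))" for i
    proof -
      have "1 + f i = (cmod (1 - d i j))^2"
        unfolding f_def cmod_power2 by (simp add: power2_eq_square algebra_simps)
      then show ?thesis using factors_pos(3)[OF j, of i] by (simp add: ln_realpow)
    qed
    have "ord 4 (\<lambda>i. (1 / 2) * (ln (1 + f i) - f i) - (log_gap i + ln (cmod (1 - d i j))) + (1 / 2) * (xx i j)^2)"
    proof -
      have 1: "ord 4 (\<lambda>i. ln (1 + f i) - f i)" using ord_ln_real[OF f2] by simp
      have 2: "ord 4 (\<lambda>i. (xx i j)^2)" using ord_power[OF d_Re[OF j], of 2] by simp
      show ?thesis by (intro ord_add ord_diff ord_cmult slack_ord j 1 2)
    qed
    then show ?thesis unfolding lnf unfolding f_def by (simp add: algebra_simps)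
  qed
  have "ord 4 (\<lambda>i. \<Sum>j<n. xx i j - (yy i j)^2 / 2 - log_gap i)" by (intro ord_sum X) auto
  moreover have "(\<Sum>j<n. xx i j - (yy i j)^2 / 2 - log_gap i) = - Ssq i / 2 - real n * log_gap i" for i
    unfolding Ssq_def by (simp add: sum_subtractf sum_xx sum_divide_distrib)
  ultimately have S: "ord 4 (\<lambda>i. - Ssq i / 2 - real n * log_gap i)" by simp
  have "ord 4 (\<lambda>i. (xx i j - (yy i j)^2 / 2 - log_gap i) - (1 / real n) * (- Ssq i / 2 - real n * log_gap i))"
    by (intro ord_diff ord_cmult X S j)
  moreover have "(1 / real n) * (- Ssq i / 2 - real n * log_gap i) = - Ssq i / (2 * real n) - log_gap i" for i
    using n3 by (simp add: field_simps)
  ultimately show ?thesis by (simp add: algebra_simps)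
qed

end

section \<open>Odd moments and the quartic gap\<close>

lemma cis_powers45:
  "Re (cis t ^ 4) = 8 * cos t ^ 4 - 8 * (cos t)^2 + 1"
proof -
  have "cos (4 * t) = 2 * (2 * (cos t)^2 - 1)^2 - 1"
    using cos_double_cos[of "2 * t"] by (simp add: cos_double_cos)
  also have "\<dots> = 8 * cos t ^ 4 - 8 * (cos t)^2 + 1" by (simp add: power2_eq_square algebra_simps eval_nat_numeral)
  finally show ?thesis by (simp add: Complex.DeMoivre)
qed

context small_scale
begin

lemma ord_eqI:
  assumes "ord s f" "\<And>i. f i = g i"
  shows "ord s g"
proof -
  have "f = g" using assms(2) by (rule ext)
  then show ?thesis using assms(1) by simp
qed

end

context sendov_family
begin

lemma Ssq_ord: "ord 2 Ssq" and Y3_ord3: "ord 3 Y3"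
  unfolding Ssq_def Y3_def
  using ord_power[OF d_Im, of _ 2] ord_power[OF d_Im, of _ 3]
  by (auto intro!: ord_sum)

lemma Re_Im_sig2:
  "Re (sg i 2) = Ssq i / 2 - (\<Sum>j<n. (xx i j)^2) / 2"
  "Im (sg i 2) = - (\<Sum>j<n. xx i j * yy i j)"
  unfolding signed_esym_centered(2)[OF d_sum] Ssq_def
  by (simp_all add: power2_eq_square sum_subtractf sum.distrib diff_divide_distrib mult.commute sum_distrib_left[symmetric])

lemma Ssq_sig2: "ord 4 (\<lambda>i. Ssq i - 2 * Re (sg i 2))"
proof -
  have "ord 4 (\<lambda>i. \<Sum>j<n. (xx i j)^2)"
    using ord_power[OF d_Re, of _ 2] by (auto intro!: ord_sum)
  then show ?thesis unfolding Re_Im_sig2 by simp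
qed

text \<open>Substituting the parabola for the real parts leaves polynomials in the imaginary parts \<open>y\<close>.  The imaginary parts of
  the symmetric functions are odd in \<open>y\<close>, so to leading order they are multiples of the sum of cubes, and the real
  parts are even in \<open>y\<close>.\<close>

lemma Im_sig2: "ord 5 (\<lambda>i. Im (sg i 2) + Y3 i / 2)"
proof -
  have "ord 5 (\<lambda>i. - (\<Sum>j<n. yy i j * (xx i j - (yy i j)^2 / 2 + Ssq i / (2 * real n))))"
    by (intro ord_minus ord_sum) (use ord_mult[OF d_Im x_expand] in auto)
  moreover have "- (\<Sum>j<n. yy i j * (xx i j - (yy i j)^2 / 2 + Ssq i / (2 * real n)))
     = Im (sg i 2) + Y3 i / 2" for i
  proof -
    have "(\<Sum>j<n. yy i j * (xx i j - (yy i j)^2 / 2 + Ssq i / (2 * real n)))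
       = (\<Sum>j<n. xx i j * yy i j - yy i j ^ 3 / 2 + yy i j * (Ssq i / (2 * real n)))"
      by (intro sum.cong) (simp_all add: algebra_simps eval_nat_numeral)
    also have "\<dots> = (\<Sum>j<n. xx i j * yy i j) - Y3 i / 2 + (\<Sum>j<n. yy i j) * (Ssq i / (2 * real n))"
      by (simp add: sum.distrib sum_subtractf Y3_def sum_divide_distrib[symmetric] sum_distrib_right[symmetric])
    finally show ?thesis unfolding Re_Im_sig2 sum_yy by simp
  qed
  ultimately show ?thesis by (rule ord_eqI)
qed

lemma Re_cube: "Re (z ^ 3) = Re z ^ 3 - 3 * (Re z * (Im z)^2)" and Im_cube: "Im (z ^ 3) = 3 * ((Re z)^2 * Im z) - Im z ^ 3"
  by (simp_all add: eval_nat_numeral algebra_simps)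

lemma Im_sig3: "ord 5 (\<lambda>i. Im (sg i 3) - Y3 i / 3)"
proof -
  have "ord 5 (\<lambda>i. - (\<Sum>j<n. (xx i j)^2 * yy i j))"
    by (intro ord_minus ord_sum) (use ord_mult[OF ord_power[OF d_Re, of _ 2] d_Im] in auto)
  moreover have "- (\<Sum>j<n. (xx i j)^2 * yy i j) = Im (sg i 3) - Y3 i / 3" for i
    unfolding signed_esym_centered(3)[OF d_sum] Y3_def
    by (simp add: Im_cube sum_subtractf sum_distrib_left[symmetric] diff_divide_distrib)
  ultimately show ?thesis by (rule ord_eqI)
qed

lemma Re_sig3_expand: "ord 6 (\<lambda>i. Re (sg i 3) - Y4 i / 2 + (Ssq i)^2 / (2 * real n))"
proof -
  have "ord 6 (\<lambda>i. (\<Sum>j<n. (yy i j)^2 * (xx i j - (yy i j)^2 / 2 + Ssq i / (2 * real n)))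
      - (\<Sum>j<n. xx i j ^ 3) / 3)"
    by (intro ord_diff ord_divc ord_sum)
      (use ord_mult[OF ord_power[OF d_Im, of _ 2] x_expand] ord_power[OF d_Re, of _ 3] in auto)
  moreover have "(\<Sum>j<n. (yy i j)^2 * (xx i j - (yy i j)^2 / 2 + Ssq i / (2 * real n)))
      - (\<Sum>j<n. xx i j ^ 3) / 3 = Re (sg i 3) - Y4 i / 2 + (Ssq i)^2 / (2 * real n)" for i
  proof -
    have "(\<Sum>j<n. (yy i j)^2 * (xx i j - (yy i j)^2 / 2 + Ssq i / (2 * real n)))
       = (\<Sum>j<n. xx i j * (yy i j)^2 - yy i j ^ 4 / 2 + (yy i j)^2 * (Ssq i / (2 * real n)))"
      by (intro sum.cong) (simp_all add: algebra_simps eval_nat_numeral)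
    also have "\<dots> = (\<Sum>j<n. xx i j * (yy i j)^2) - Y4 i / 2 + Ssq i * (Ssq i / (2 * real n))"
      by (simp add: sum.distrib sum_subtractf Y4_def Ssq_def sum_divide_distrib[symmetric] sum_distrib_right[symmetric])
    finally show ?thesis unfolding signed_esym_centered(3)[OF d_sum]
      by (simp add: Re_cube sum_subtractf sum_distrib_left[symmetric] diff_divide_distrib power2_eq_square)
  qed
  ultimately show ?thesis by (rule ord_eqI)
qed

lemma Im_sig2_ord: "ord 3 (\<lambda>i. Im (sg i 2))"
proof -
  have "ord 3 (\<lambda>i. (Im (sg i 2) + Y3 i / 2) - Y3 i / 2)"
    by (intro ord_diff ord_divc Y3_ord3 ord_weaken[OF Im_sig2]) simp
  then show ?thesis by simp
qed

lemma Re_sig4_expand: "ord 6 (\<lambda>i. Re (sg i 4) - (Ssq i)^2 / 8 + Y4 i / 4)"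
proof -
  define X2 where "X2 i = (\<Sum>j<n. (xx i j)^2)" for i
  have X2: "ord 4 X2" unfolding X2_def
    using ord_power[OF d_Re, of _ 2] by (auto intro!: ord_sum)
  define Q where "Q i = (\<Sum>j<n. xx i j ^ 4 - 6 * ((xx i j)^2 * (yy i j)^2))" for i
  have "ord 6 (\<lambda>i. xx i j ^ 4 - 6 * ((xx i j)^2 * (yy i j)^2))" if "j < n" for j
    using ord_power[OF d_Re[OF that], of 4] ord_mult[OF ord_power[OF d_Re[OF that], of 2] ord_power[OF d_Im[OF that], of 2]]
    by (intro ord_diff ord_cmult) (auto elim: ord_weaken)
  then have Q: "ord 6 Q" unfolding Q_def by (intro ord_sum) auto
  have s4: "sg i 4 = (sg i 2)^2 / 2 - (\<Sum>j<n. d i j ^ 4) / 4" for i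
    unfolding signed_esym_centered(4)[OF d_sum] signed_esym_centered(2)[OF d_sum] by (simp add: power2_eq_square)
  have "Re (z ^ 4) = (Re z ^ 4 - 6 * ((Re z)^2 * (Im z)^2)) + Im z ^ 4" for z
    by (simp add: eval_nat_numeral algebra_simps)
  then have p4: "Re (\<Sum>j<n. d i j ^ 4) = Q i + Y4 i" for i
    unfolding Q_def Y4_def Re_sum by (simp add: sum.distrib)
  have "ord 6 (\<lambda>i. X2 i * (X2 i - 2 * Ssq i) / 8 - (Im (sg i 2))^2 / 2 - Q i / 4)"
  proof -
    have "ord 2 (\<lambda>i. X2 i - 2 * Ssq i)" by (intro ord_diff ord_cmult Ssq_ord ord_weaken[OF X2]) simp
    from ord_mult[OF X2 this] have 1: "ord 6 (\<lambda>i. X2 i * (X2 i - 2 * Ssq i))" by simp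
    have 2: "ord 6 (\<lambda>i. (Im (sg i 2))^2)" using ord_power[OF Im_sig2_ord, of 2] by simp
    show ?thesis by (intro ord_diff ord_divc 1 2 Q)
  qed
  moreover have "X2 i * (X2 i - 2 * Ssq i) / 8 - (Im (sg i 2))^2 / 2 - Q i / 4
     = Re (sg i 4) - (Ssq i)^2 / 8 + Y4 i / 4" for i
  proof -
    have "Re (sg i 4) = ((Re (sg i 2))^2 - (Im (sg i 2))^2) / 2 - (Q i + Y4 i) / 4"
      unfolding s4 p4[symmetric] by (simp add: power2_eq_square)
    moreover have "Re (sg i 2) = Ssq i / 2 - X2 i / 2" unfolding Re_Im_sig2 X2_def ..
    ultimately show ?thesis by (simp add: field_simps power2_eq_square)
  qed
  ultimately show ?thesis by (rule ord_eqI)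
qed

lemma Re_sig2_ord: "ord 2 (\<lambda>i. Re (sg i 2))"
  by (intro ord_Re signed_esym_ord)

lemma Im_sig3_ord: "ord 3 (\<lambda>i. Im (sg i 3))"
  by (intro ord_Im signed_esym_ord)

lemma Re_sig5: "ord 6 (\<lambda>i. Re (sg i 5))"
proof -
  have "ord 6 (\<lambda>i. xx i j ^ 5 - 10 * (xx i j ^ 3 * (yy i j)^2) + 5 * (xx i j * yy i j ^ 4))" if "j < n" for j
    using ord_power[OF d_Re[OF that], of 5] ord_mult[OF ord_power[OF d_Re[OF that], of 3] ord_power[OF d_Im[OF that], of 2]]
      ord_mult[OF d_Re[OF that] ord_power[OF d_Im[OF that], of 4]]
    by (intro ord_add ord_diff ord_cmult) (auto elim: ord_weaken)
  moreover have "Re (z ^ 5) = Re z ^ 5 - 10 * (Re z ^ 3 * (Im z)^2) + 5 * (Re z * Im z ^ 4)" for z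
    by (simp add: eval_nat_numeral algebra_simps)
  ultimately have p5: "ord 6 (\<lambda>i. \<Sum>j<n. Re (d i j ^ 5))" by (intro ord_sum) auto
  have s5: "sg i 5 = sg i 2 * sg i 3 - (\<Sum>j<n. d i j ^ 5) / 5" for i
    unfolding signed_esym_centered(5)[OF d_sum] signed_esym_centered(3)[OF d_sum] signed_esym_centered(2)[OF d_sum]
    by (simp add: field_simps)
  have "ord 6 (\<lambda>i. Re (sg i 2) * Re (sg i 3) - Im (sg i 2) * Im (sg i 3)
      - (\<Sum>j<n. Re (d i j ^ 5)) / 5)"
    using ord_mult[OF Re_sig2_ord Re_sig3] ord_mult[OF Im_sig2_ord Im_sig3_ord]
    by (intro ord_diff ord_divc p5) auto
  then show ?thesis unfolding s5 by simp
qed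

text \<open>The order to which odd moments vanish.  For \<open>n = 3\<close> and \<open>n = 5\<close> the second angle is \<open>pi\<close>, where the imaginary
  part of the constraint is void, and only the trivial order remains.\<close>

definition mu :: nat where "mu = (if n = 3 \<or> n = 5 then 3 else 4)"

lemma mu_bounds: "3 \<le> mu" "mu \<le> 4" by (auto simp: mu_def)

text \<open>The constraints at conjugate points have a mean that is \<open>O(h^4)\<close> and are both bounded above by \<open>O(h^4)\<close>, so their
  difference is \<open>O(h^4)\<close>; it contains the imaginary parts.\<close>

lemma imag_eq:
  assumes t: "cis t ^ (n + 1) = 1" "cos t < 1" "sin t \<noteq> 0" and avg_constraint: "ord 4 (avg_constraint (cos t))"
  shows "ord 4 (\<lambda>i. 2 * cos t * Im (root_coeff 2 i) + (4 * (cos t)^2 - 1) * Im (root_coeff 3 i) - N * Im (g i))"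
proof -
  have S: "ord 4 (\<lambda>i. constraint_form4 (cis t) i + constraint_form4 (cnj (cis t)) i)"
  proof -
    have "cos t \<noteq> 1" using t(2) by simp
    then show ?thesis
      unfolding constraint_form4_sum[OF \<open>cos t \<noteq> 1\<close>] by (intro ord_add ord_cmult ord_multc avg_constraint Re_root_coeff3)
  qed
  have a: "ub 4 (constraint_form4 (cis t))" by (rule constraint4[OF t(1)])
  have b: "ub 4 (constraint_form4 (cnj (cis t)))" by (rule constraint4[OF cnj_root[OF t(1)]])
  have "ub 4 (\<lambda>i. - constraint_form4 (cis t) i)"
    by (rule ub_replace[OF b]) (use ord_minus[OF S] in \<open>simp add: algebra_simps\<close>)
  from ord_of_ub[OF a this] have A: "ord 4 (constraint_form4 (cis t))" .
  have "ord 4 (\<lambda>i. (1 / (2 * sin t)) * (2 * constraint_form4 (cis t) i - (constraint_form4 (cis t) i + constraint_form4 (cnj (cis t)) i)))"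
    by (intro ord_cmult ord_diff A S)
  moreover have "(1 / (2 * sin t)) * (2 * constraint_form4 (cis t) i - (constraint_form4 (cis t) i + constraint_form4 (cnj (cis t)) i))
     = 2 * cos t * Im (root_coeff 2 i) + (4 * (cos t)^2 - 1) * Im (root_coeff 3 i) - N * Im (g i)" for i
  proof -
    have R: "Re (z * (1 - q)) - Re (z * (1 - cnj q)) = 2 * Im z * Im q" for z q by (simp add: algebra_simps)
    have R': "Re (z * (q - 1)) - Re (z * (cnj q - 1)) = - 2 * Im z * Im q" for z q by (simp add: algebra_simps)
    have "2 * constraint_form4 (cis t) i - (constraint_form4 (cis t) i + constraint_form4 (cnj (cis t)) i)
      = (Re (root_coeff 2 i * (1 - (cis t)^2)) - Re (root_coeff 2 i * (1 - cnj ((cis t)^2))))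
      + (Re (root_coeff 3 i * (1 - cis t ^ 3)) - Re (root_coeff 3 i * (1 - cnj (cis t ^ 3))))
      + N * (Re (g i * (cis t - 1)) - Re (g i * (cnj (cis t) - 1)))"
      unfolding constraint_form4_def complex_cnj_power
      by (simp only: plus_complex.sel Re_of_real_mult) (simp add: algebra_simps)
    also have "\<dots> = (2 * sin t) * (2 * cos t * Im (root_coeff 2 i) + (4 * (cos t)^2 - 1) * Im (root_coeff 3 i) - N * Im (g i))"
      unfolding R R' cis_powers by (simp add: algebra_simps)
    finally show ?thesis using t(3) by simp
  qed
  ultimately show ?thesis by (rule ord_eqI)
qed

lemma imag_eq_Y3:
  assumes t: "cis t ^ (n + 1) = 1" "cos t < 1" "sin t \<noteq> 0" and avg_constraint: "ord 4 (avg_constraint (cos t))"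
  shows "ord 4 (\<lambda>i. (- (N / (N - 2)) * cos t + N / (3 * (N - 3)) * (4 * (cos t)^2 - 1)) * Y3 i - N * Im (g i))"
proof -
  have "ord 4 (\<lambda>i. (2 * cos t * Im (root_coeff 2 i) + (4 * (cos t)^2 - 1) * Im (root_coeff 3 i) - N * Im (g i))
      - (2 * cos t * (N / (N - 2))) * (Im (sg i 2) + Y3 i / 2)
      - ((4 * (cos t)^2 - 1) * (N / (N - 3))) * (Im (sg i 3) - Y3 i / 3))"
    by (intro ord_diff ord_cmult imag_eq assms ord_weaken[OF Im_sig2] ord_weaken[OF Im_sig3]) auto
  moreover have "(2 * cos t * Im (root_coeff 2 i) + (4 * (cos t)^2 - 1) * Im (root_coeff 3 i) - N * Im (g i))
      - (2 * cos t * (N / (N - 2))) * (Im (sg i 2) + Y3 i / 2)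
      - ((4 * (cos t)^2 - 1) * (N / (N - 3))) * (Im (sg i 3) - Y3 i / 3)
     = (- (N / (N - 2)) * cos t + N / (3 * (N - 3)) * (4 * (cos t)^2 - 1)) * Y3 i - N * Im (g i)" for i
  proof -
    define a b where "a = N / (N - 2)" and "b = N / (N - 3)"
    have b3: "N / (3 * (N - 3)) = b / 3" by (simp add: b_def)
    have i: "Im (root_coeff 2 i) = a * Im (sg i 2)" "Im (root_coeff 3 i) = b * Im (sg i 3)"
      unfolding Im_root_coeff a_def b_def by simp_all
    show ?thesis unfolding b3 i a_def[symmetric] b_def[symmetric] by (simp add: algebra_simps)
  qed
  ultimately show ?thesis by (rule ord_eqI)
qed

lemma theta1_eq: "ord 4 (\<lambda>i. (- (N / (N - 2)) * u1 n + N / (3 * (N - 3)) * (4 * (u1 n)^2 - 1)) * Y3 i - N * Im (g i))"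
  unfolding u1_theta
  by (rule imag_eq_Y3[OF cis_theta(1)])
    (use u_bounds[OF n3] lp_tight(2) in \<open>simp_all add: u1_theta[symmetric]\<close>)

text \<open>Two equations for the unknowns \<open>Im (g i)\<close> and \<open>Y3 i\<close>.  Their determinant does not vanish because
  \<open>u2 < u1\<close> and \<open>u1 + u2 < 0\<close>.\<close>

lemma Y3_mu: "ord mu Y3"
proof (cases "n = 3 \<or> n = 5")
  case True
  then show ?thesis using Y3_ord3 by (simp add: mu_def)
next
  case False
  have "ord 4 (\<lambda>i. (- (N / (N - 2)) * u2 n + N / (3 * (N - 3)) * (4 * (u2 n)^2 - 1)) * Y3 i - N * Im (g i))"
    unfolding u2_theta
    by (rule imag_eq_Y3[OF cis_theta(2)])
      (use u_bounds[OF n3] False lp_tight(3) in \<open>simp_all add: u2_theta[symmetric]\<close>)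
  note d = ord_diff[OF theta1_eq this]
  define p q where pq: "p = N / (N - 2)" "q = N / (3 * (N - 3))"
  have "ord 4 (\<lambda>i. ((u1 n - u2 n) * (- (N / (N - 2)) + 4 * (N / (3 * (N - 3))) * (u1 n + u2 n))) * Y3 i)"
    by (rule ord_eqI[OF d], unfold pq[symmetric]) (simp add: algebra_simps power2_eq_square)
  moreover have "(u1 n - u2 n) * (- (N / (N - 2)) + 4 * (N / (3 * (N - 3))) * (u1 n + u2 n)) \<noteq> 0"
  proof -
    have N: "N - 2 > 0" "N - 3 > 0" using n3 by (auto simp: N_def)
    have "u1 n + u2 n < 0" using u_bounds(2,5)[OF n3] by linarith
    moreover have "0 < 4 * (N / (3 * (N - 3)))" using N N_pos by simp
    ultimately have "4 * (N / (3 * (N - 3))) * (u1 n + u2 n) < 0" by (rule mult_pos_neg[rotated])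
    moreover have "N / (N - 2) > 0" using N N_pos by simp
    ultimately have "- (N / (N - 2)) + 4 * (N / (3 * (N - 3))) * (u1 n + u2 n) < 0" by linarith
    then show ?thesis using u_bounds(6)[OF n3] by simp
  qed
  ultimately have "ord 4 Y3" by (rule ord_cmult_cancel)
  then show ?thesis using False by (simp add: mu_def)
qed

lemma Im_g_mu: "ord mu (\<lambda>i. Im (g i))"
proof -
  define c where "c = - (N / (N - 2)) * u1 n + N / (3 * (N - 3)) * (4 * (u1 n)^2 - 1)"
  have "ord mu (\<lambda>i. c * Y3 i - N * Im (g i))"
    by (rule ord_weaken[OF theta1_eq[folded c_def] mu_bounds(2)])
  from ord_diff[OF ord_cmult[OF Y3_mu, of c] this]
  have "ord mu (\<lambda>i. N * Im (g i))" by simp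
  then show ?thesis using ord_cmult_cancel[of mu N "\<lambda>i. Im (g i)"] N_pos by simp
qed

lemma root_coeff3_mu: "ord mu (root_coeff 3)"
proof (cases "n = 3 \<or> n = 5")
  case True
  then show ?thesis using root_coeff_ord[of 3] by (simp add: mu_def)
next
  case False
  then have Y: "ord 4 Y3" using Y3_mu by (simp add: mu_def)
  have "ord 4 (\<lambda>i. (Im (sg i 3) - Y3 i / 3) + Y3 i / 3)"
    by (intro ord_add ord_divc Y ord_weaken[OF Im_sig3]) simp
  then have "ord 4 (\<lambda>i. Im (root_coeff 3 i))" unfolding Im_root_coeff by (intro ord_cmult) simp
  then have "ord 4 (root_coeff 3)" by (intro ord_complexI Re_root_coeff3)
  then show ?thesis using False by (simp add: mu_def)
qed

definition quartic_gap where "quartic_gap i = (Ssq i)^2 / 2 - Y4 i"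

lemma Ssq_first: "ord 4 (\<lambda>i. Ssq i + 2 * (real n - 1) * D2 n * h i ^ 2)"
proof -
  have N2: "N - 2 \<noteq> 0" using n3 by (simp add: N_def)
  have "ord 4 (\<lambda>i. (Ssq i - 2 * Re (sg i 2)) + (2 * ((N - 2) / N)) * (Re (root_coeff 2 i) + N * D2 n * h i ^ 2))"
    by (intro ord_add ord_cmult Ssq_sig2 root_coeff2_first)
  moreover have "(Ssq i - 2 * Re (sg i 2)) + (2 * ((N - 2) / N)) * (Re (root_coeff 2 i) + N * D2 n * h i ^ 2)
     = Ssq i + 2 * (real n - 1) * D2 n * h i ^ 2" for i
  proof -
    define e where "e = Re (sg i 2)"
    have "Re (root_coeff 2 i) = N / (N - 2) * e" unfolding Re_root_coeff e_def by simp
    moreover have "(N - 2) / N * (N / (N - 2) * e) = e" using N2 N_pos by simp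
    ultimately have "(2 * ((N - 2) / N)) * Re (root_coeff 2 i) = 2 * e" by (simp only: mult.assoc)
    moreover have "(2 * ((N - 2) / N)) * (N * D2 n * h i ^ 2) = 2 * (real n - 1) * D2 n * h i ^ 2"
      using N_pos by (simp add: N_def)
    ultimately show ?thesis unfolding e_def[symmetric] by (simp only: distrib_left)
  qed
  ultimately show ?thesis by (rule ord_eqI)
qed

text \<open>The factor \<open>3 / 20\<close> is \<open>13 / 20 - 1 / 2\<close>.  In the generic case the quartic inequality is divided by \<open>Ssq\<close>, which is bounded
  below by a positive multiple of \<open>h^2\<close>; its error is the square of \<open>Y3 = O(h^4)\<close>.\<close>

lemma quartic_gap_lower: "ub (mu + 2) (\<lambda>i. - quartic_gap i - (if n = 5 then 3 / 20 else 0) * (Ssq i)^2)"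
proof -
  consider "n = 3" | "n = 5" | "n \<noteq> 3" "n \<noteq> 5" by blast
  then show ?thesis
  proof cases
    case 1
    have "quartic_gap i = 0" for i
    proof -
      have "(\<Sum>j<3. yy i j) = 0" using sum_yy[of i] unfolding 1 .
      from quartic_three[OF this] show ?thesis unfolding quartic_gap_def Ssq_def Y4_def unfolding 1 by simp
    qed
    then show ?thesis using ub_ord[OF ord_zero] by (simp add: 1)
  next
    case 2
    have "- quartic_gap i - 3 / 20 * (Ssq i)^2 \<le> 0" for i
    proof -
      have "(\<Sum>j<5. yy i j) = 0" using sum_yy[of i] unfolding 2 .
      from quartic_five[OF this] show ?thesis unfolding quartic_gap_def Ssq_def Y4_def unfolding 2 by simp
    qed
    then show ?thesis by (intro ub_of_nonpos) (simp add: 2)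
  next
    case 3
    then have Y: "ord 4 Y3" using Y3_mu by (simp add: mu_def)
    have "ord 8 (\<lambda>i. 32 * real n * (Y3 i)^2)" using ord_power[OF Y, of 2] by (intro ord_cmult) simp
    then obtain C where C: "C \<ge> 0" "\<forall>\<^sub>F i in sequentially. norm (32 * real n * (Y3 i)^2) \<le> C * h i ^ 8"
      by (rule ordE)
    obtain B where B: "B \<ge> 0"
      "\<forall>\<^sub>F i in sequentially. norm (Ssq i + 2 * (real n - 1) * D2 n * h i ^ 2) \<le> B * h i ^ 4"
      using Ssq_first by (rule ordE)
    \<comment> \<open>Half of the leading coefficient of \<open>Ssq\<close>, so that \<open>Ssq\<close> is eventually at least \<open>k * h^2\<close>.\<close>
    define k where "k = - (real n - 1) * D2 n"
    have k: "k > 0" using weights_first_order(4)[OF n3] n3 unfolding k_def by (intro mult_neg_neg) auto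
    have "ord 2 (\<lambda>i. B * h i ^ 2)" by (intro ord_cmult ord_h_power)
    from ord_small_ev[OF this _ k]
    have Bk: "\<forall>\<^sub>F i in sequentially. norm (B * h i ^ 2) < k" by simp
    have "\<forall>\<^sub>F i in sequentially. - quartic_gap i \<le> C / k * h i ^ 6"
      using C(2) B(2) Bk
    proof eventually_elim
      case (elim i)
      have hp: "h i ^ 2 > 0" using h_pos[of i] by simp
      have "B * h i ^ 2 * h i ^ 2 \<le> k * h i ^ 2" using elim(3) hp by (intro mult_right_mono) auto
      then have "B * h i ^ 4 \<le> k * h i ^ 2" by (simp add: eval_nat_numeral)
      then have "\<bar>Ssq i - 2 * k * h i ^ 2\<bar> \<le> k * h i ^ 2"
        using elim(2) unfolding k_def by (simp add: algebra_simps)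
      then have S: "k * h i ^ 2 \<le> Ssq i" by linarith
      have "Ssq i * quartic_gap i \<ge> - 32 * real n * (Y3 i)^2"
        using quartic_deficit[of "{..<n}" "yy i"] sum_yy[of i]
        unfolding quartic_gap_def Ssq_def Y4_def Y3_def by simp
      then have D: "- (Ssq i * quartic_gap i) \<le> C * h i ^ 8" using elim(1) by simp
      show ?case
      proof (cases "quartic_gap i \<ge> 0")
        case True
        have "0 \<le> C / k * h i ^ 6" using C(1) k by simp
        then show ?thesis using True by linarith
      next
        case False
        then have "k * h i ^ 2 * - quartic_gap i \<le> Ssq i * - quartic_gap i" using S by (intro mult_right_mono) auto
        also have "\<dots> \<le> C * h i ^ 8" using D by simp
        also have "\<dots> = k * h i ^ 2 * (C / k * h i ^ 6)" using k by (simp add: eval_nat_numeral)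
        finally show ?thesis using k hp by (simp only: mult_le_cancel_left_pos mult_pos_pos)
      qed
    qed
    then have "ub 6 (\<lambda>i. - quartic_gap i)" by (rule ubI)
    then show ?thesis using 3 by (simp add: mu_def)
  qed
qed

text \<open>The inequality \<open>|z| \<le> 1\<close> expanded to second order in \<open>h^2\<close>.  The terms with \<open>2 / N\<close> and with \<open>g i * root_coeff 2 i\<close> come from the
  displacement of the zero from the root of unity.\<close>

definition constraint_form6 :: "complex \<Rightarrow> nat \<Rightarrow> real" where
  "constraint_form6 s i = Re (root_coeff 2 i * (1 - s^2) + root_coeff 3 i * (1 - s ^ 3) + root_coeff 4 i * (1 - s ^ 4) + root_coeff 5 i * (1 - s ^ 5)
      + (root_coeff 2 i)^2 * (- (1 - s ^ 4) / 2 + 2 / of_real N * (s^2 - s ^ 4))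
      + of_real N * (g i * (s - 1)) - g i * root_coeff 2 i * (s - s ^ 3)
      - of_real N * ((g i)^2 * (s - 1)^2) / 2) - N * (h i ^ 2 + h i ^ 4 / 2)"

text \<open>The products of \<open>root_coeff 3 i\<close> with terms of order \<open>h^2\<close> are part of the error, which is why the error has order
  \<open>mu + 2\<close>.\<close>

lemma constraint6:
  assumes s: "s ^ (n + 1) = 1"
  shows "ub (mu + 2) (constraint_form6 s)"
proof -
  obtain w where w: "ord 2 (\<lambda>i. w i - s)"
    and rel: "\<forall>\<^sub>F i in sequentially. w i ^ (n + 1) * root_series i 1 = root_series i (w i)"
    and star: "\<forall>\<^sub>F i in sequentially. ln (cmod (root_series i 1)) - ln (cmod (root_series i (w i)))
        + (real n + 1) * ln (cmod (1 + g i * (w i - 1))) \<le> - (real n + 1) * ln (1 - h i ^ 2)"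
    using root_near[OF s] by blast
  note wb = root_near_bounded[OF w] and mb = mu_bounds
  define X where "X i = ln (cmod (root_series i 1)) - ln (cmod (root_series i (w i)))
        + N * ln (cmod (1 + g i * (w i - 1))) + N * ln (1 - h i ^ 2)" for i
  have X: "ub (mu + 2) X"
    by (rule ub_of_nonpos) (use star in eventually_elim, simp add: X_def N_def algebra_simps)
  define v where "v i = s * (root_coeff 2 i * (s^2 - 1)) / of_real N" for i
  have v: "ord mu (\<lambda>i. w i - s - v i)"
  proof -
    have "ord mu (\<lambda>i. (w i - s - s * (root_coeff 2 i * (s^2 - 1) + root_coeff 3 i * (s ^ 3 - 1)) / of_nat (n + 1))
        + s * (root_coeff 3 i * (s ^ 3 - 1)) / of_nat (n + 1))"
      by (intro ord_add ord_divc ord_cmult ord_multc root_coeff3_mu ord_weaken[OF root_expand[OF s w rel]] mb(2))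
    moreover have "complex_of_real N = of_nat (n + 1)" by (simp add: N_def)
    ultimately show ?thesis unfolding v_def by (simp add: algebra_simps add_divide_distrib diff_divide_distrib)
  qed
  define y where "y i = g i * (w i - 1)" for i
  have y: "ord 2 y" unfolding y_def
    by (intro ord_mono_mult[OF g_ord2 ord_diff[OF wb ord_const]]) simp
  define z where "z i = root_series i 1 - 1" for i
  define zw where "zw i = root_series i (w i) - 1" for i
  have z2: "ord 2 z" unfolding z_def by (rule root_series_ord2[OF ord_const])
  have zw2: "ord 2 zw" unfolding zw_def by (rule root_series_ord2[OF wb])
  have l1: "ord (mu + 2) (\<lambda>i. ln (cmod (1 + z i)) - Re (z i) + Re ((z i)^2) / 2)"
    by (rule ord_weaken[OF ord_ln_norm2[OF z2]]) (use mb in auto)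
  have l2: "ord (mu + 2) (\<lambda>i. ln (cmod (1 + zw i)) - Re (zw i) + Re ((zw i)^2) / 2)"
    by (rule ord_weaken[OF ord_ln_norm2[OF zw2]]) (use mb in auto)
  have l3: "ord (mu + 2) (\<lambda>i. ln (cmod (1 + y i)) - Re (y i) + Re ((y i)^2) / 2)"
    by (rule ord_weaken[OF ord_ln_norm2[OF y]]) (use mb in auto)
  have l4: "ord (mu + 2) (\<lambda>i. ln (1 - h i ^ 2) + h i ^ 2 + h i ^ 4 / 2)"
    by (rule ord_weaken[OF ord_ln_h6]) (use mb in auto)
  have wp: "ord 2 (\<lambda>i. w i ^ k - s ^ k)" for k by (rule ord_power_diff[OF w])
  have wpb: "ord 0 (\<lambda>i. w i ^ k)" for k using ord_power[OF wb, of k] by simp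
  have e1: "ord (mu + 2) (\<lambda>i. z i - (root_coeff 2 i * 1 ^ 2 + root_coeff 3 i * 1 ^ 3 + root_coeff 4 i * 1 ^ 4 + root_coeff 5 i * 1 ^ 5))"
    unfolding z_def by (rule ord_weaken[OF root_series_expand[OF ord_const]]) (use mb in auto)
  have e2: "ord (mu + 2) (\<lambda>i. zw i - (root_coeff 2 i * w i ^ 2 + root_coeff 3 i * w i ^ 3 + root_coeff 4 i * w i ^ 4 + root_coeff 5 i * w i ^ 5))"
    unfolding zw_def by (rule ord_weaken[OF root_series_expand[OF wb]]) (use mb in auto)
  have e3: "ord (mu + 2) (\<lambda>i. root_coeff 2 i * ((w i - s) * (w i - s) + 2 * s * (w i - s - v i)))"
  proof -
    have "ord mu (\<lambda>i. (w i - s) * (w i - s) + 2 * s * (w i - s - v i))"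
      by (intro ord_add ord_cmult v ord_mono_mult[OF w w]) (use mb in auto)
    from ord_mult[OF root_coeff_ord[of 2] this] show ?thesis by (simp add: add.commute)
  qed
  have e4: "ord (mu + 2) (\<lambda>i. root_coeff 3 i * (w i ^ 3 - s ^ 3))"
    by (rule ord_mult[OF root_coeff3_mu wp])
  have e5: "ord (mu + 2) (\<lambda>i. root_coeff 4 i * (w i ^ 4 - s ^ 4))" "ord (mu + 2) (\<lambda>i. root_coeff 5 i * (w i ^ 5 - s ^ 5))"
    by (rule ord_mono_mult[OF root_coeff_ord wp]; use mb in simp)+
  have e6: "ord (mu + 2) (\<lambda>i. (z i - root_coeff 2 i) * (z i + root_coeff 2 i))"
  proof (rule ord_mult)
    have "ord mu (\<lambda>i. (root_series i 1 - 1 - (root_coeff 2 i * 1 ^ 2 + root_coeff 3 i * 1 ^ 3)) + root_coeff 3 i)"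
      by (intro ord_add root_coeff3_mu ord_weaken[OF root_series_expand4[OF ord_const]] mb(2))
    then show "ord mu (\<lambda>i. z i - root_coeff 2 i)" unfolding z_def by (simp add: algebra_simps)
    show "ord 2 (\<lambda>i. z i + root_coeff 2 i)" by (intro ord_add z2 root_coeff_ord)
  qed
  have e7: "ord (mu + 2) (\<lambda>i. (zw i - root_coeff 2 i * s^2) * (zw i + root_coeff 2 i * s^2))"
  proof (rule ord_mult)
    have "ord mu (\<lambda>i. (root_series i (w i) - 1 - (root_coeff 2 i * w i ^ 2 + root_coeff 3 i * w i ^ 3)) + root_coeff 2 i * (w i ^ 2 - s ^ 2)
        + root_coeff 3 i * w i ^ 3)"
      by (intro ord_add ord_weaken[OF root_series_expand4[OF wb]] mb(2) ord_mono_mult[OF root_coeff_ord wp] ord_mono_mult[OF root_coeff3_mu wpb])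
        (use mb in auto)
    then show "ord mu (\<lambda>i. zw i - root_coeff 2 i * s^2)" unfolding zw_def by (simp add: algebra_simps)
    show "ord 2 (\<lambda>i. zw i + root_coeff 2 i * s^2)" by (intro ord_add ord_multc zw2 root_coeff_ord)
  qed
  have e8: "ord (mu + 2) (\<lambda>i. g i * (w i - s - v i))"
    using ord_mult[OF g_ord2 v] by (simp add: add.commute)
  have e9: "ord (mu + 2) (\<lambda>i. (g i * (w i - s)) * (y i + g i * (s - 1)))"
    by (intro ord_mono_mult[OF ord_mult[OF g_ord2 w] ord_add[OF y ord_multc[OF g_ord2]]]) (use mb in auto)
  define Z where "Z i = - (z i - (root_coeff 2 i * 1 ^ 2 + root_coeff 3 i * 1 ^ 3 + root_coeff 4 i * 1 ^ 4 + root_coeff 5 i * 1 ^ 5))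
     + (zw i - (root_coeff 2 i * w i ^ 2 + root_coeff 3 i * w i ^ 3 + root_coeff 4 i * w i ^ 4 + root_coeff 5 i * w i ^ 5))
     + root_coeff 2 i * ((w i - s) * (w i - s) + 2 * s * (w i - s - v i))
     + root_coeff 3 i * (w i ^ 3 - s ^ 3) + root_coeff 4 i * (w i ^ 4 - s ^ 4) + root_coeff 5 i * (w i ^ 5 - s ^ 5)
     + (z i - root_coeff 2 i) * (z i + root_coeff 2 i) / 2 - (zw i - root_coeff 2 i * s^2) * (zw i + root_coeff 2 i * s^2) / 2
     - of_real N * (g i * (w i - s - v i)) + of_real N * ((g i * (w i - s)) * (y i + g i * (s - 1))) / 2" for i
  have Z: "ord (mu + 2) Z"
    unfolding Z_def by (intro ord_add ord_diff ord_minus ord_cmult ord_divc e1 e2 e3 e4 e5 e6 e7 e8 e9)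
  have eq: "root_coeff 2 i * (1 - s^2) + root_coeff 3 i * (1 - s ^ 3) + root_coeff 4 i * (1 - s ^ 4) + root_coeff 5 i * (1 - s ^ 5)
      + (root_coeff 2 i)^2 * (- (1 - s ^ 4) / 2 + 2 / of_real N * (s^2 - s ^ 4))
      + of_real N * (g i * (s - 1)) - g i * root_coeff 2 i * (s - s ^ 3)
      - of_real N * ((g i)^2 * (s - 1)^2) / 2
    = (z i - (z i)^2 / 2) - (zw i - (zw i)^2 / 2) + of_real N * (y i - (y i)^2 / 2) + Z i" for i
  proof -
    define M where "M = complex_of_real N"
    have M0: "M \<noteq> 0" using N_pos by (simp add: M_def)
    define q where "q = inverse M"
    have vM: "v i = s * root_coeff 2 i * (s^2 - 1) * q" by (simp add: v_def M_def q_def divide_inverse)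
    have iM: "2 / M = 2 * q" by (simp add: q_def divide_inverse)
    have Mv: "M * v i = s * root_coeff 2 i * (s^2 - 1)" using M0 by (simp add: v_def M_def[symmetric] mult.assoc)
    have "M * (g i * (w i - s - v i)) = M * (g i * (w i - s)) - g i * (M * v i)"
      by (simp add: algebra_simps)
    then have a: "M * (g i * (w i - s - v i)) = M * (g i * (w i - s)) - g i * (s * root_coeff 2 i * (s^2 - 1))"
      unfolding Mv .
    show ?thesis unfolding Z_def M_def[symmetric] a iM unfolding vM y_def
      by (simp add: field_simps power2_eq_square power3_eq_cube power4_eq_xxxx)
  qed
  have "ord (mu + 2) (\<lambda>i. constraint_form6 s i - X i)"
  proof -
    have "ord (mu + 2) (\<lambda>i. - (ln (cmod (1 + z i)) - Re (z i) + Re ((z i)^2) / 2)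
        + (ln (cmod (1 + zw i)) - Re (zw i) + Re ((zw i)^2) / 2)
        - N * (ln (cmod (1 + y i)) - Re (y i) + Re ((y i)^2) / 2)
        - N * (ln (1 - h i ^ 2) + h i ^ 2 + h i ^ 4 / 2) + Re (Z i))"
      by (intro ord_add ord_diff ord_minus ord_cmult l1 l2 l3 l4 ord_Re Z)
    moreover have "- (ln (cmod (1 + z i)) - Re (z i) + Re ((z i)^2) / 2)
        + (ln (cmod (1 + zw i)) - Re (zw i) + Re ((zw i)^2) / 2)
        - N * (ln (cmod (1 + y i)) - Re (y i) + Re ((y i)^2) / 2)
        - N * (ln (1 - h i ^ 2) + h i ^ 2 + h i ^ 4 / 2) + Re (Z i) = constraint_form6 s i - X i" for i
    proof -
      have half: "Re (q / 2) = Re q / 2" for q by simp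
      have "constraint_form6 s i = (Re (z i) - Re ((z i)^2) / 2) - (Re (zw i) - Re ((zw i)^2) / 2)
          + N * (Re (y i) - Re ((y i)^2) / 2) + Re (Z i) - N * (h i ^ 2 + h i ^ 4 / 2)"
        unfolding constraint_form6_def eq by (simp only: plus_complex.sel minus_complex.sel Re_of_real_mult half)
      moreover have "1 + z i = root_series i 1" "1 + zw i = root_series i (w i)" by (simp_all add: z_def zw_def)
      ultimately show ?thesis unfolding X_def y_def[symmetric] by (simp add: algebra_simps)
    qed
    ultimately show ?thesis by (rule ord_eqI)
  qed
  from ub_replace[OF X this] show ?thesis .
qed

end

section \<open>The second-order bound\<close>

text \<open>The constants \<open>D1\<close> and \<open>D2\<close> are polynomials in \<open>t = 1 / ((1 - u1) * (1 - u2))\<close> and \<open>G = t * (u1 + u2)\<close>.  The second and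
  third moments of the weights become polynomials \<open>A\<close> and \<open>B\<close> in \<open>t\<close>, \<open>G\<close> and \<open>m\<close> after multiplication by \<open>t\<close> and \<open>t^2\<close>.
  So the comparison of the second-order terms with the constants \<open>D3\<close> to \<open>D6\<close> is an identity of polynomials.\<close>

lemma second_order_polynomial_identity:
  fixes m G t :: real
  assumes "m \<noteq> 0"
  defines "M \<equiv> m + 1" and "d1 \<equiv> - 1 + t / 2 - G" and "d2 \<equiv> - t / 2"
  defines "c \<equiv> d1 + d2 / m"
  defines "A \<equiv> - G * M / 2 - m * (1 - t + G)"
  defines "B \<equiv> G * A + t * (1 - t + G) * M / 2"
  defines "d3 \<equiv> (- 1 - 4 * d1 - 3 * d1^2 + 2 * d2^2) / 2"
    and "d4 \<equiv> (3 * d1 - 4 * d2 + 3 * d1^2 - 2 * d1 * d2 - 6 * d2^2) / 2"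
    and "d5 \<equiv> (2 + 4 * d1 + 5 * d2 + 2 * d1^2 + 4 * d1 * d2 + 3 * d2^2) / 2"
    and "d6 \<equiv> (2 * d2 + 2 * d1 * d2 + 3 * d2^2) / 2"
  shows "m / 2 + m / 2 * G^2 + ((m - 1) * t / 2)^2 / 2
      - ((m - 1)^2 / 4 * (t^2 * (m - 2) - (t^2 * (m - 2 * M) + 4 * t * A))) / m
      + (- M * (t * A + B) + (4 * t * A + 4 * B - t^2 * m + t^2 * M / 2)
         - 2 * G * (- t * M / 2 + A) - G^2 * M / 2 - m * (1 + c) / 2)
      = - m * ((d3 * m + d4 + d5 / m + d6 / m^2) - c^2 / 2)"
  unfolding M_def d3_def d4_def d5_def d6_def c_def B_def A_def d1_def d2_def using assms(1)
  by (simp add: field_simps power2_eq_square)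

context sendov_family
begin

text \<open>The first-order values of \<open>Re (root_coeff 2 i)\<close>, \<open>Re (g i)\<close> and \<open>Re (sg i 2)\<close> in units of \<open>h^2\<close>.\<close>

definition a0 :: real where "a0 = - N * D2 n"
definition g0 :: real where "g0 = - (1 + D1 n + D2 n)"
definition e0 :: real where "e0 = - (real n - 1) * D2 n"

lemma root_coeff2_a0: "ord 4 (\<lambda>i. Re (root_coeff 2 i) - a0 * h i ^ 2)"
  using root_coeff2_first by (simp add: a0_def)

lemma g_g0: "ord 4 (\<lambda>i. Re (g i) - g0 * h i ^ 2)"
  using g_first by (rule ord_eqI) (simp add: g0_def algebra_simps)

lemma Im_root_coeff2: "ord 3 (\<lambda>i. Im (root_coeff 2 i))"
  unfolding Im_root_coeff by (intro ord_cmult Im_sig2_ord)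

lemma root_coeff2_square: "ord 6 (\<lambda>i. Re ((root_coeff 2 i)^2) - a0^2 * h i ^ 4)"
proof (rule ord_eqI)
  show "ord 6 (\<lambda>i. (Re (root_coeff 2 i) - a0 * h i ^ 2) * (Re (root_coeff 2 i) + a0 * h i ^ 2) - Im (root_coeff 2 i) * Im (root_coeff 2 i))"
    by (intro ord_diff ord_mono_mult[OF root_coeff2_a0 ord_add[OF ord_Re[OF root_coeff_ord] ord_cmult[OF ord_h_power]]]
        ord_mono_mult[OF Im_root_coeff2 Im_root_coeff2]) auto
qed (simp add: power2_eq_square eval_nat_numeral algebra_simps)

lemma g_square: "ord 6 (\<lambda>i. Re ((g i)^2) - g0^2 * h i ^ 4)"
proof (rule ord_eqI)
  show "ord 6 (\<lambda>i. (Re (g i) - g0 * h i ^ 2) * (Re (g i) + g0 * h i ^ 2) - Im (g i) * Im (g i))"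
    by (intro ord_diff ord_mono_mult[OF g_g0 ord_add[OF ord_Re[OF g_ord2] ord_cmult[OF ord_h_power]]]
        ord_mono_mult[OF Im_g_mu Im_g_mu]) (use mu_bounds in auto)
qed (simp add: power2_eq_square eval_nat_numeral algebra_simps)

lemma g_root_coeff2: "ord (mu + 2) (\<lambda>i. Re (g i * root_coeff 2 i) - g0 * a0 * h i ^ 4)"
proof (rule ord_eqI)
  show "ord (mu + 2) (\<lambda>i. (Re (g i) - g0 * h i ^ 2) * Re (root_coeff 2 i) + g0 * (h i ^ 2 * (Re (root_coeff 2 i) - a0 * h i ^ 2))
      - Im (g i) * Im (root_coeff 2 i))"
    by (intro ord_add ord_diff ord_cmult ord_mono_mult[OF g_g0 ord_Re[OF root_coeff_ord]]
        ord_mono_mult[OF ord_h_power root_coeff2_a0] ord_mono_mult[OF Im_g_mu Im_root_coeff2]) (use mu_bounds in auto)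
qed (simp add: eval_nat_numeral algebra_simps)

lemma e_e0: "ord 4 (\<lambda>i. Re (sg i 2) - e0 * h i ^ 2)"
proof (rule ord_eqI)
  show "ord 4 (\<lambda>i. (1 / 2) * ((Ssq i + 2 * (real n - 1) * D2 n * h i ^ 2) - (Ssq i - 2 * Re (sg i 2))))"
    by (intro ord_cmult ord_diff Ssq_first Ssq_sig2)
qed (simp add: e0_def algebra_simps)

lemma Ssq_square: "ord 6 (\<lambda>i. (Ssq i)^2 - 4 * e0^2 * h i ^ 4)"
proof (rule ord_eqI)
  have "ord 4 (\<lambda>i. Ssq i - 2 * e0 * h i ^ 2)"
    using Ssq_first by (rule ord_eqI) (simp add: e0_def algebra_simps)
  then show "ord 6 (\<lambda>i. (Ssq i - 2 * e0 * h i ^ 2) * (Ssq i + 2 * e0 * h i ^ 2))"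
    by (rule ord_mono_mult[OF _ ord_add[OF Ssq_ord ord_cmult[OF ord_h_power]]]) auto
qed (simp add: power2_eq_square eval_nat_numeral algebra_simps)

text \<open>The coefficient of \<open>h^4\<close> in the averaged constraint, after insertion of the first-order values.\<close>

definition K :: "real \<Rightarrow> real" where
  "K u = a0^2 * (- 4 * (u^2 * (1 + u)) + 4 / N * ((4 * u^2 - 1) * (1 + u))) - 4 * g0 * a0 * (u * (1 + u))
     + N * g0^2 * u - N / 2 * (1 / (1 - u))"

definition A3 where "A3 i = Re (root_coeff 3 i)"
definition A4 where "A4 i = Re (root_coeff 4 i)"

lemma Re_root_coeff5: "ord 6 (\<lambda>i. Re (root_coeff 5 i))"
  unfolding Re_root_coeff by (intro ord_cmult Re_sig5)

lemma avg_constraint6_ub: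
  assumes t: "cis t ^ (n + 1) = 1" "cos t < 1"
  shows "ub (mu + 2) (\<lambda>i. avg_constraint (cos t) i + A3 i * (1 + 2 * cos t)^2 + A4 i * (8 * ((cos t)^2 * (1 + cos t)))
     + K (cos t) * h i ^ 4)" (is "ub _ ?F")
proof -
  define u where "u = cos t"
  define s where "s = cis t"
  have u1: "1 - u > 0" using t(2) by (simp add: u_def)
  have m6: "mu + 2 \<le> 6" using mu_bounds by simp
  have S: "ub (mu + 2) (\<lambda>i. constraint_form6 s i + constraint_form6 (cnj s) i)"
    unfolding s_def by (intro ub_add constraint6 t(1) cnj_root)
  have c: "Re s = u" "Re (s^2) = 2 * u^2 - 1" "Re (s ^ 3) = 4 * u ^ 3 - 3 * u" "Re (s ^ 4) = 8 * u ^ 4 - 8 * u^2 + 1"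
    unfolding s_def u_def by (simp_all only: cis.sel cis_powers cis_powers45)
  define q1 where "q1 = - (1 - Re (s ^ 4)) / 2 + 2 / N * (Re (s^2) - Re (s ^ 4))"
  define q2 where "q2 = Re s - Re (s ^ 3)"
  define q3 where "q3 = Re (s^2) - 2 * Re s + 1"
  have avg: "constraint_form6 s i + constraint_form6 (cnj s) i = 2 * (Re (root_coeff 2 i) * (1 - Re (s^2)) + Re (root_coeff 3 i) * (1 - Re (s ^ 3))
      + Re (root_coeff 4 i) * (1 - Re (s ^ 4)) + Re (root_coeff 5 i) * (1 - Re (s ^ 5)) + Re ((root_coeff 2 i)^2) * q1
      + N * (Re (g i) * (Re s - 1)) - Re (g i * root_coeff 2 i) * q2 - N * (Re ((g i)^2) * q3) / 2
      - N * (h i ^ 2 + h i ^ 4 / 2))" for i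
  proof -
    have R: "Re (z * f) + Re (z * cnj f) = 2 * (Re z * Re f)" for z f by (simp add: algebra_simps)
    have half: "Re (q / 2) = Re q / 2" for q by simp
    define f1 where "f1 = - (1 - s ^ 4) / 2 + 2 / of_real N * (s^2 - s ^ 4)"
    have f1: "Re f1 = q1" unfolding f1_def q1_def
    proof -
      have "2 / complex_of_real N = of_real (2 / N)" by simp
      then show "Re (- (1 - s ^ 4) / 2 + 2 / of_real N * (s^2 - s ^ 4)) = - (1 - Re (s ^ 4)) / 2 + 2 / N * (Re (s^2) - Re (s ^ 4))"
        by (simp only: plus_complex.sel minus_complex.sel uminus_complex.sel Re_of_real_mult half one_complex.sel)
    qed
    have f1c: "- (1 - cnj s ^ 4) / 2 + 2 / of_real N * ((cnj s)^2 - cnj s ^ 4) = cnj f1"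
      unfolding f1_def by simp
    have f3: "Re ((s - 1)^2) = q3"
    proof -
      have "(s - 1)^2 = s^2 - 2 * s + 1" by (simp add: power2_eq_square algebra_simps)
      then show ?thesis unfolding q3_def by simp
    qed
    have l: "constraint_form6 s i = Re (root_coeff 2 i * (1 - s^2)) + Re (root_coeff 3 i * (1 - s ^ 3)) + Re (root_coeff 4 i * (1 - s ^ 4))
       + Re (root_coeff 5 i * (1 - s ^ 5)) + Re ((root_coeff 2 i)^2 * f1) + N * Re (g i * (s - 1)) - Re (g i * root_coeff 2 i * (s - s ^ 3))
       - N * Re ((g i)^2 * (s - 1)^2) / 2 - N * (h i ^ 2 + h i ^ 4 / 2)"
      unfolding constraint_form6_def f1_def[symmetric] by (simp only: plus_complex.sel minus_complex.sel Re_of_real_mult half)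
    have lc: "constraint_form6 (cnj s) i = Re (root_coeff 2 i * cnj (1 - s^2)) + Re (root_coeff 3 i * cnj (1 - s ^ 3)) + Re (root_coeff 4 i * cnj (1 - s ^ 4))
       + Re (root_coeff 5 i * cnj (1 - s ^ 5)) + Re ((root_coeff 2 i)^2 * cnj f1) + N * Re (g i * cnj (s - 1)) - Re (g i * root_coeff 2 i * cnj (s - s ^ 3))
       - N * Re ((g i)^2 * cnj ((s - 1)^2)) / 2 - N * (h i ^ 2 + h i ^ 4 / 2)"
      unfolding constraint_form6_def f1c complex_cnj_diff complex_cnj_power complex_cnj_one
      by (simp only: plus_complex.sel minus_complex.sel Re_of_real_mult half)
    have r: "Re (1 - z) = 1 - Re z" "Re (z - 1) = Re z - 1" "Re (s - s ^ 3) = q2" for z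
      by (simp_all add: q2_def)
    have "constraint_form6 s i + constraint_form6 (cnj s) i =
      (Re (root_coeff 2 i * (1 - s^2)) + Re (root_coeff 2 i * cnj (1 - s^2))) + (Re (root_coeff 3 i * (1 - s ^ 3)) + Re (root_coeff 3 i * cnj (1 - s ^ 3)))
      + (Re (root_coeff 4 i * (1 - s ^ 4)) + Re (root_coeff 4 i * cnj (1 - s ^ 4))) + (Re (root_coeff 5 i * (1 - s ^ 5)) + Re (root_coeff 5 i * cnj (1 - s ^ 5)))
      + (Re ((root_coeff 2 i)^2 * f1) + Re ((root_coeff 2 i)^2 * cnj f1)) + N * (Re (g i * (s - 1)) + Re (g i * cnj (s - 1)))
      - (Re (g i * root_coeff 2 i * (s - s ^ 3)) + Re (g i * root_coeff 2 i * cnj (s - s ^ 3)))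
      - N * (Re ((g i)^2 * (s - 1)^2) + Re ((g i)^2 * cnj ((s - 1)^2))) / 2 - 2 * N * (h i ^ 2 + h i ^ 4 / 2)"
      unfolding l lc by (simp only: distrib_left add_divide_distrib)
    also have "\<dots> = 2 * (Re (root_coeff 2 i) * (1 - Re (s^2)) + Re (root_coeff 3 i) * (1 - Re (s ^ 3))
      + Re (root_coeff 4 i) * (1 - Re (s ^ 4)) + Re (root_coeff 5 i) * (1 - Re (s ^ 5)) + Re ((root_coeff 2 i)^2) * q1
      + N * (Re (g i) * (Re s - 1)) - Re (g i * root_coeff 2 i) * q2 - N * (Re ((g i)^2) * q3) / 2
      - N * (h i ^ 2 + h i ^ 4 / 2))"
      unfolding R f1 f3 r by (simp add: algebra_simps)
    finally show ?thesis .
  qed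
  have "ub (mu + 2) (\<lambda>i. (2 * (1 - u)) * ?F i)"
  proof (rule ub_replace[OF S])
    have "ord (mu + 2) (\<lambda>i. - 2 * (Re (root_coeff 5 i) * (1 - Re (s ^ 5)) + (Re ((root_coeff 2 i)^2) - a0^2 * h i ^ 4) * q1
        - (Re (g i * root_coeff 2 i) - g0 * a0 * h i ^ 4) * q2 - N * ((Re ((g i)^2) - g0^2 * h i ^ 4) * q3) / 2))"
      by (intro ord_cmult ord_add ord_diff ord_multc ord_divc g_root_coeff2 ord_weaken[OF Re_root_coeff5 m6]
          ord_weaken[OF root_coeff2_square m6] ord_weaken[OF g_square m6])
    then show "ord (mu + 2) (\<lambda>i. (2 * (1 - u)) * ?F i - (constraint_form6 s i + constraint_form6 (cnj s) i))"
    proof (rule ord_eqI)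
      fix i
      define Q where "Q = 1 / (1 - u)"
      have Q: "(1 - u) * Q = 1" using u1 by (simp add: Q_def)
      define J where "J = 4 / N"
      have J: "2 / N = J / 2" by (simp add: J_def)
      have cu: "avg_constraint u i = 2 * Re (root_coeff 2 i) * (1 + u) - N * Re (g i) - N * h i ^ 2 * Q"
        unfolding avg_constraint_def Q_def by simp
      have Ku: "K u = a0^2 * (- 4 * (u^2 * (1 + u)) + J * ((4 * u^2 - 1) * (1 + u))) - 4 * g0 * a0 * (u * (1 + u))
         + N * g0^2 * u - N / 2 * Q" unfolding K_def Q_def J_def by simp
      have p: "(1 - u) * ((1 + 2 * u)^2) = 1 - (4 * u ^ 3 - 3 * u)" 
        by (simp add: power2_eq_square power3_eq_cube algebra_simps)
      have p1: "q1 = (1 - u) * (- 4 * (u^2 * (1 + u)) + J * ((4 * u^2 - 1) * (1 + u)))"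
        unfolding q1_def c J by (simp add: power2_eq_square power3_eq_cube power4_eq_xxxx field_simps)
      have p2: "q2 = (1 - u) * (4 * (u * (1 + u)))"
        unfolding q2_def c by (simp add: power2_eq_square power3_eq_cube algebra_simps)
      have p3: "q3 = - 2 * ((1 - u) * u)"
        unfolding q3_def c by (simp add: power2_eq_square algebra_simps)
      have p4: "1 - Re (s ^ 4) = (1 - u) * (8 * (u^2 * (1 + u)))"
        unfolding c by (simp add: power2_eq_square power4_eq_xxxx algebra_simps)
      have p6: "1 - Re (s^2) = (1 - u) * (2 * (1 + u))"
        unfolding c by (simp add: power2_eq_square algebra_simps)
      have "(2 * (1 - u)) * ?F i = 2 * ((1 - u) * avg_constraint u i) + 2 * (A3 i * (1 - Re (s ^ 3)))
          + 2 * (A4 i * (1 - Re (s ^ 4))) + 2 * h i ^ 4 * ((1 - u) * K u)"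
        unfolding u_def[symmetric] p4 c(3) p[symmetric] by (simp add: algebra_simps)
      also have "(1 - u) * avg_constraint u i = Re (root_coeff 2 i) * (1 - Re (s^2)) + N * (Re (g i) * (Re s - 1)) - N * h i ^ 2"
      proof -
        have "(1 - u) * avg_constraint u i = Re (root_coeff 2 i) * ((1 - u) * (2 * (1 + u))) + N * (Re (g i) * (u - 1)) - N * h i ^ 2 * ((1 - u) * Q)"
          unfolding cu by (simp add: algebra_simps)
        then show ?thesis unfolding p6 Q c(1) by simp
      qed
      also have "(1 - u) * K u = a0^2 * q1 - g0 * a0 * q2 - N * g0^2 * q3 / 2 - N / 2"
      proof -
        have "(1 - u) * K u = a0^2 * q1 - g0 * a0 * q2 - N * g0^2 * q3 / 2 - N / 2 * ((1 - u) * Q)"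
          unfolding Ku p1 p2 p3 by (simp add: field_simps)
        then show ?thesis unfolding Q by simp
      qed
      finally show "- 2 * (Re (root_coeff 5 i) * (1 - Re (s ^ 5)) + (Re ((root_coeff 2 i)^2) - a0^2 * h i ^ 4) * q1
        - (Re (g i * root_coeff 2 i) - g0 * a0 * h i ^ 4) * q2 - N * ((Re ((g i)^2) - g0^2 * h i ^ 4) * q3) / 2)
        = (2 * (1 - u)) * ?F i - (constraint_form6 s i + constraint_form6 (cnj s) i)"
        unfolding avg A3_def A4_def by (simp add: field_simps)
    qed
  qed
  from ub_cmult_cancel[OF this] u1 show ?thesis by simp
qed

text \<open>The sum of the logarithmic slacks, now expanded up to \<open>O(h^6)\<close>.\<close>

lemma objective6_ub: "ub 6 (\<lambda>i. objective i + (real n / 2 + real n / 2 * g0^2 + e0^2 / 2) * h i ^ 4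
    - Re (sg i 3) - Re (sg i 4))"
proof -
  have U: "ub 6 (\<lambda>i. - (real n * log_gap i + ln (cmod (crit_prod i))))"
    by (rule ub_of_nonpos, rule always_eventually) (auto simp: slack_sum[symmetric] intro!: sum_nonneg slack_nonneg)
  define y where "y i = - g i" for i
  define z where "z i = crit_prod i - 1" for i
  have y: "ord 2 y" unfolding y_def by (intro ord_minus g_ord2)
  have z: "ord 2 z" unfolding z_def by (rule crit_prod_ord2)
  have l1: "ord 6 (\<lambda>i. ln (cmod (1 + y i)) - Re (y i) + Re ((y i)^2) / 2)" using ord_ln_norm2[OF y] by simp
  have l2: "ord 6 (\<lambda>i. ln (cmod (1 + z i)) - Re (z i) + Re ((z i)^2) / 2)" using ord_ln_norm2[OF z] by simp
  define s2 s3 s4 s5 where "s2 i = sg i 2" and "s3 i = sg i 3" and "s4 i = sg i 4"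
    and "s5 i = sg i 5" for i
  have e1: "ord 6 (\<lambda>i. z i - (s2 i + s3 i + s4 i + s5 i))" unfolding z_def s2_def s3_def s4_def s5_def by (rule crit_prod_expand)
  have z4: "ord 4 (\<lambda>i. z i - (s2 i + s3 i))" unfolding z_def s2_def s3_def by (rule crit_prod_expand4)
  have s2o: "ord 2 s2" and s3o: "ord 3 s3" unfolding s2_def s3_def by (rule signed_esym_ord)+
  have Im_z: "ord 3 (\<lambda>i. Im (z i))"
  proof (rule ord_eqI)
    show "ord 3 (\<lambda>i. Im (z i - (s2 i + s3 i)) + Im (s2 i) + Im (s3 i))"
      by (intro ord_add ord_Im[OF s3o] ord_Im[OF ord_weaken[OF z4]] Im_sig2_ord[folded s2_def]) simp
  qed simp
  have Re_z: "ord 4 (\<lambda>i. Re (z i) - e0 * h i ^ 2)"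
  proof (rule ord_eqI)
    show "ord 4 (\<lambda>i. Re (z i - (s2 i + s3 i)) + Re (s3 i) + (Re (s2 i) - e0 * h i ^ 2))"
      unfolding s2_def s3_def by (intro ord_add ord_Re z4[unfolded s2_def s3_def] Re_sig3 e_e0)
  qed simp
  have zsq: "ord 6 (\<lambda>i. Re ((z i)^2) - e0^2 * h i ^ 4)"
  proof (rule ord_eqI)
    show "ord 6 (\<lambda>i. (Re (z i) - e0 * h i ^ 2) * (Re (z i) + e0 * h i ^ 2) - Im (z i) * Im (z i))"
      by (intro ord_diff ord_mono_mult[OF Re_z ord_add[OF ord_Re[OF z] ord_cmult[OF ord_h_power]]]
          ord_mono_mult[OF Im_z Im_z]) auto
  qed (simp add: power2_eq_square eval_nat_numeral algebra_simps)
  show ?thesis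
  proof (rule ub_replace[OF U])
    show "ord 6 (\<lambda>i. objective i + (real n / 2 + real n / 2 * g0^2 + e0^2 / 2) * h i ^ 4
       - Re (sg i 3) - Re (sg i 4) - - (real n * log_gap i + ln (cmod (crit_prod i))))"
    proof (rule ord_eqI)
      show "ord 6 (\<lambda>i. real n * (ln (1 - h i ^ 2) + h i ^ 2 + h i ^ 4 / 2)
          + real n * (ln (cmod (1 + y i)) - Re (y i) + Re ((y i)^2) / 2)
          - real n / 2 * (Re ((g i)^2) - g0^2 * h i ^ 4)
          + (ln (cmod (1 + z i)) - Re (z i) + Re ((z i)^2) / 2)
          - (1 / 2) * (Re ((z i)^2) - e0^2 * h i ^ 4)
          + Re (z i - (s2 i + s3 i + s4 i + s5 i)) + Re (s5 i))"
        unfolding s5_def by (intro ord_add ord_diff ord_cmult ord_h_power ord_ln_h6 l1 l2 g_square zsq ord_Re e1[unfolded s5_def] Re_sig5)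
    next
      fix i
      have Y: "(y i)^2 = (g i)^2" "1 + y i = 1 - g i" "1 + z i = crit_prod i" "Re (y i) = - Re (g i)"
        by (simp_all add: y_def z_def)
      have R: "Re (z i - (s2 i + s3 i + s4 i + s5 i)) = Re (z i) - Re (s2 i) - Re (s3 i) - Re (s4 i) - Re (s5 i)" by simp
      show "real n * (ln (1 - h i ^ 2) + h i ^ 2 + h i ^ 4 / 2)
          + real n * (ln (cmod (1 + y i)) - Re (y i) + Re ((y i)^2) / 2)
          - real n / 2 * (Re ((g i)^2) - g0^2 * h i ^ 4)
          + (ln (cmod (1 + z i)) - Re (z i) + Re ((z i)^2) / 2)
          - (1 / 2) * (Re ((z i)^2) - e0^2 * h i ^ 4)
          + Re (z i - (s2 i + s3 i + s4 i + s5 i)) + Re (s5 i)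
        = objective i + (real n / 2 + real n / 2 * g0^2 + e0^2 / 2) * h i ^ 4
       - Re (sg i 3) - Re (sg i 4) - - (real n * log_gap i + ln (cmod (crit_prod i)))"
        unfolding R unfolding Y objective_def log_gap_def s2_def s3_def s4_def
        by (simp add: algebra_simps)
    qed
  qed
qed

lemma second_order_identity:
  defines "q \<equiv> weight1 n * (1 + 2 * u1 n)^2 + weight2 n * (1 + 2 * u2 n)^2"
  defines "c \<equiv> D1 n + D2 n / real n"
  shows "real n / 2 + real n / 2 * g0^2 + e0^2 / 2 - 4 * e0^2 * (1 / 4 - 1 / (2 * real n)) * (1 - q / (N - 3))
     + (weight1 n / N * K (u1 n) + weight2 n / N * K (u2 n)) = - real n * (D_const n - c^2 / 2)"
proof -
  note w = weights[OF n3] and u = u_bounds[OF n3]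
  define m1 m2 a b where ab: "m1 = weight1 n" "m2 = weight2 n" "a = u1 n" "b = u2 n"
  define m where "m = real n"
  have m0: "m \<noteq> 0" "N = m + 1" using n3 by (auto simp: m_def N_def)
  have W: "m1 + m2 = m" "m1 * a + m2 * b = - N / 2" using w(3,4) by (auto simp: ab m_def N_def)
  define t where "t = - 2 * D2 n"
  define G where "G = g0"
  have t1: "t * ((1 - a) * (1 - b)) = 1" using u by (simp add: t_def D2_def ab)
  have d2: "D2 n = - t / 2" by (simp add: t_def)
  have d1: "D1 n = - 1 + t / 2 - G" by (simp add: t_def G_def g0_def)
  have "D1 n = (- 2 * a * b - 1) * - D2 n" by (simp add: D1_def D2_def ab)
  then have D1t: "D1 n = (- 2 * a * b - 1) * t / 2" by (simp add: t_def)
  have tab: "t * (a * b) = 1 - t + G"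
    using d1 D1t by (simp add: field_simps)
  have tsum: "t * (a + b) = G"
    using t1 tab by (simp add: algebra_simps)
  define M2 where "M2 = m1 * a^2 + m2 * b^2"
  define M3 where "M3 = m1 * a ^ 3 + m2 * b ^ 3"
  define A where "A = - G * N / 2 - m * (1 - t + G)"
  define B where "B = G * A + t * (1 - t + G) * N / 2"
  have tM2: "t * M2 = A"
  proof -
    have "t * M2 = t * (a + b) * (m1 * a + m2 * b) - t * (a * b) * (m1 + m2)"
      unfolding M2_def by (simp add: algebra_simps power2_eq_square)
    then show ?thesis unfolding tsum tab W A_def by (simp add: algebra_simps)
  qed
  have tM3: "t^2 * M3 = B"
  proof -
    have "t^2 * M3 = t * (a + b) * (t * M2) - t * (t * (a * b)) * (m1 * a + m2 * b)"
      unfolding M2_def M3_def by (simp add: algebra_simps power2_eq_square power3_eq_cube)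
    then show ?thesis unfolding tsum tab W tM2 B_def by (simp add: field_simps)
  qed
  have q: "q = m - 2 * N + 4 * M2"
  proof -
    have "q = (m1 + m2) + 4 * (m1 * a + m2 * b) + 4 * M2"
      unfolding q_def ab[symmetric] M2_def by (simp add: algebra_simps power2_eq_square)
    then show ?thesis unfolding W by simp
  qed
  have e: "e0 = (m - 1) * t / 2" by (simp add: e0_def m_def t_def algebra_simps)
  have aa: "a0 = N * t / 2" by (simp add: a0_def t_def)
  have inv: "m1 / (1 - a) + m2 / (1 - b) = m * (1 + c)"
    using weights_first_order(1)[OF n3] unfolding ab m_def c_def .
  have KK: "m1 / N * K a + m2 / N * K b
     = - N * (t * A + B) + (4 * t * A + 4 * B - t^2 * m + t^2 * N / 2)
         - 2 * G * (- t * N / 2 + A) - G^2 * N / 2 - m * (1 + c) / 2"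
  proof -
    have N0: "N \<noteq> 0" using N_pos by simp
    have one: "z / N * K x = - N * (t * (t * (z * x^2)) + t^2 * (z * x ^ 3))
       + (4 * t * (t * (z * x^2)) + 4 * (t^2 * (z * x ^ 3)) - t^2 * z - t^2 * (z * x))
       - 2 * G * (t * (z * x) + t * (z * x^2)) + G^2 * (z * x) - z / (1 - x) / 2" for z x
    proof -
      define Q where "Q = 1 / (1 - x)"
      have Q: "z / (1 - x) / 2 = z * Q / 2" by (simp add: Q_def)
      show ?thesis unfolding K_def aa G_def[symmetric] Q Q_def[symmetric] using N0
        by (simp add: field_simps power2_eq_square power3_eq_cube)
    qed
    have "m1 / N * K a + m2 / N * K b = - N * (t * (t * M2) + t^2 * M3)
       + (4 * t * (t * M2) + 4 * (t^2 * M3) - t^2 * (m1 + m2) - t^2 * (m1 * a + m2 * b))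
       - 2 * G * (t * (m1 * a + m2 * b) + t * M2) + G^2 * (m1 * a + m2 * b) - (m1 / (1 - a) + m2 / (1 - b)) / 2"
      unfolding one M2_def M3_def by (simp add: algebra_simps add_divide_distrib)
    then show ?thesis unfolding tM2 tM3 W inv by (simp add: algebra_simps)
  qed
  have eq: "4 * e0^2 * (1 / 4 - 1 / (2 * real n)) * (1 - q / (N - 3))
     = ((m - 1)^2 / 4 * (t^2 * (m - 2) - (t^2 * (m - 2 * N) + 4 * t * A))) / m"
  proof -
    have m2: "m - 2 \<noteq> 0" using n3 by (simp add: m_def)
    have N3: "N - 3 = m - 2" using m0 by simp
    have "4 * e0^2 * (1 / 4 - 1 / (2 * m)) * (1 - q / (m - 2)) = (e0^2 * (m - 2 - q)) / m"
      using m0(1) m2 by (simp add: field_simps)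
    also have "e0^2 * (m - 2 - q) = (m - 1)^2 / 4 * (t^2 * (m - 2) - (t^2 * (m - 2 * N) + 4 * t * (t * M2)))"
      unfolding e q by (simp add: power2_eq_square field_simps)
    finally show ?thesis unfolding tM2 N3 m_def[symmetric] .
  qed
  show ?thesis
    unfolding eq KK[unfolded ab] unfolding e G_def[symmetric] m_def[symmetric] c_def
    using second_order_polynomial_identity[OF m0(1), of G t]
    unfolding m0(2)[symmetric] A_def[symmetric] B_def[symmetric] d1[symmetric] d2[symmetric]
      D_const_def D3_def D4_def D5_def D6_def m_def[symmetric]
    by (simp add: algebra_simps)
qed

text \<open>Since \<open>kappa\<close> is not positive for \<open>n \<ge> 4\<close>, the lower bound for the gap is an upper bound here.  For \<open>n = 5\<close> one has
  \<open>kappa = - 7 / 3\<close> and \<open>e0 = 2 / 3\<close>, hence \<open>5 * (7 / 225)\<close>.\<close>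

lemma kappa_quartic_gap: "ub (mu + 2) (\<lambda>i. kappa n * quartic_gap i / 4 - real n * Delta_const n * h i ^ 4)"
proof (cases "n = 3")
  case True
  have "quartic_gap i = 0" for i
  proof -
    have "(\<Sum>j<3. yy i j) = 0" using sum_yy[of i] unfolding True .
    from quartic_three[OF this] show ?thesis unfolding quartic_gap_def Ssq_def Y4_def unfolding True by simp
  qed
  then show ?thesis using ub_ord[OF ord_zero] by (simp add: Delta_const_def True)
next
  case False
  then have n4: "n \<ge> 4" using n3 by simp
  define tb :: real where "tb = (if n = 5 then 3 / 20 else 0)"
  have k: "0 \<le> - kappa n / 4" using kappa_nonpos[OF n4] by simp
  have m6: "mu + 2 \<le> 6" using mu_bounds by simp
  show ?thesis
  proof (rule ub_replace[OF ub_cmult[OF quartic_gap_lower k, folded tb_def]])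
    show "ord (mu + 2) (\<lambda>i. kappa n * quartic_gap i / 4 - real n * Delta_const n * h i ^ 4
        - - kappa n / 4 * (- quartic_gap i - tb * (Ssq i)^2))"
    proof (rule ord_eqI)
      show "ord (mu + 2) (\<lambda>i. (- kappa n / 4 * tb) * ((Ssq i)^2 - 4 * e0^2 * h i ^ 4))"
        by (intro ord_cmult ord_weaken[OF Ssq_square m6])
    next
      fix i
      have "real n * Delta_const n = - kappa n * tb * e0^2"
      proof (cases "n = 5")
        case True
        have "angle_index n = 2" by (simp add: angle_index_def True)
        then have th: "theta1 n = 2 * pi / 3" "theta2 n = pi"
          by (simp_all add: theta1_def theta2_def True)
        have u: "u1 n = - (1 / 2)" "u2 n = - 1" unfolding u1_theta u2_theta th cos_two_thirds_pi by simp_all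
        have w: "weight2 n = 1" "weight1 n = 4" unfolding weight1_def weight2_def u by (simp_all add: True)
        have "kappa n = - 7 / 3" unfolding kappa_def u w by (simp add: True power2_eq_square)
        moreover have "D2 n = - 1 / 6" unfolding D2_def u by simp
        ultimately show ?thesis unfolding Delta_const_def tb_def e0_def by (simp add: True power2_eq_square)
      next
        case False
        then show ?thesis by (simp add: Delta_const_def tb_def)
      qed
      then show "(- kappa n / 4 * tb) * ((Ssq i)^2 - 4 * e0^2 * h i ^ 4)
        = kappa n * quartic_gap i / 4 - real n * Delta_const n * h i ^ 4 - - kappa n / 4 * (- quartic_gap i - tb * (Ssq i)^2)"
        by (simp add: algebra_simps)
    qed
  qed
qed

text \<open>The second-order constraints are combined with the same dual weights, so that the first-order unknowns cancel
  again.  What remains is a multiple of \<open>h^4\<close> and the quartic gap.\<close>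

lemma ln_r_ub:
  defines "c \<equiv> D1 n + D2 n / real n"
  shows "ub (mu + 2) (\<lambda>i. ln (r i) - (c * h i ^ 2 + (D_const n + Delta_const n - c^2 / 2) * h i ^ 4))"
proof -
  note w = weights[OF n3] and u = u_bounds[OF n3]
  define m1 m2 where m: "m1 = weight1 n" "m2 = weight2 n"
  define q where "q = m1 * (1 + 2 * u1 n)^2 + m2 * (1 + 2 * u2 n)^2"
  define p where "p = m1 * ((u1 n)^2 * (1 + u1 n)) + m2 * ((u2 n)^2 * (1 + u2 n))"
  define E where "E = real n / 2 + real n / 2 * g0^2 + e0^2 / 2"
  define KK where "KK = m1 / N * K (u1 n) + m2 / N * K (u2 n)"
  have m6: "mu + 2 \<le> 6" using mu_bounds by simp
  define F where "F i = objective i + E * h i ^ 4 - Re (sg i 3) - Re (sg i 4)" for i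
  define H where "H x i = avg_constraint x i + A3 i * (1 + 2 * x)^2 + A4 i * (8 * (x^2 * (1 + x))) + K x * h i ^ 4" for x i
  have F: "ub (mu + 2) F" unfolding F_def E_def by (rule ub_weaken[OF objective6_ub m6])
  have H1: "ub (mu + 2) (H (u1 n))" unfolding H_def u1_theta
    by (rule avg_constraint6_ub[OF cis_theta(1)]) (use u in \<open>simp add: u1_theta\<close>)
  have H2: "ub (mu + 2) (H (u2 n))" unfolding H_def u2_theta
    by (rule avg_constraint6_ub[OF cis_theta(2)]) (use u in \<open>simp add: u2_theta\<close>)
  have pos: "0 \<le> m1 / N" "0 \<le> m2 / N" using w(1,2) N_pos by (simp_all add: m)
  have tot: "ub (mu + 2) (\<lambda>i. F i + m1 / N * H (u1 n) i + m2 / N * H (u2 n) i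
      + (kappa n * quartic_gap i / 4 - real n * Delta_const n * h i ^ 4))"
    by (intro ub_add F ub_cmult[OF H1 pos(1)] ub_cmult[OF H2 pos(2)] kappa_quartic_gap)
  define \<alpha> where "\<alpha> = 1 - q / (N - 3)"
  define \<beta> where "\<beta> = 1 - 8 * p / (N - 4)"
  have kap: "kappa n = - 1 + 2 * (1 - \<alpha>) - (1 - \<beta>)"
    unfolding kappa_def \<alpha>_def \<beta>_def q_def p_def m N_def by (simp add: diff_diff_eq)
  have "ub (mu + 2) (\<lambda>i. real n * (ln (r i) - (c * h i ^ 2 + (D_const n + Delta_const n - c^2 / 2) * h i ^ 4)))"
  proof (rule ub_replace[OF tot])
    define O3 where "O3 i = Re (sg i 3) - Y4 i / 2 + (Ssq i)^2 / (2 * real n)" for i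
    define O4 where "O4 i = Re (sg i 4) - (Ssq i)^2 / 8 + Y4 i / 4" for i
    define OS where "OS i = (Ssq i)^2 - 4 * e0^2 * h i ^ 4" for i
    define \<nu> where "\<nu> = 1 / (2 * real n)"
    show "ord (mu + 2) (\<lambda>i. real n * (ln (r i) - (c * h i ^ 2 + (D_const n + Delta_const n - c^2 / 2) * h i ^ 4))
      - (F i + m1 / N * H (u1 n) i + m2 / N * H (u2 n) i + (kappa n * quartic_gap i / 4 - real n * Delta_const n * h i ^ 4)))"
    proof (rule ord_eqI)
      show "ord (mu + 2) (\<lambda>i. \<alpha> * O3 i + \<beta> * O4 i + ((1 / 4 - \<nu>) * \<alpha>) * OS i)"
        unfolding O3_def O4_def OS_def
        by (intro ord_add ord_cmult ord_weaken[OF _ m6] Re_sig3_expand Re_sig4_expand Ssq_square)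
    next
      fix i
      define s3 s4 where "s3 = Re (sg i 3)" and "s4 = Re (sg i 4)"
      have o3: "O3 i = s3 - Y4 i / 2 + (Ssq i)^2 * \<nu>" unfolding O3_def s3_def \<nu>_def by simp
      have A: "A3 i = N / (N - 3) * s3" "A4 i = N / (N - 4) * s4"
        unfolding A3_def A4_def Re_root_coeff s3_def s4_def by simp_all
      have 1: "A3 i * q / N = s3 * (1 - \<alpha>)" "A4 i * (8 * p) / N = s4 * (1 - \<beta>)"
        unfolding A \<alpha>_def \<beta>_def using N_pos by simp_all
      have "m1 / N * H (u1 n) i + m2 / N * H (u2 n) i
         = (m1 / N * avg_constraint (u1 n) i + m2 / N * avg_constraint (u2 n) i) + A3 i * q / N + A4 i * (8 * p) / N + KK * h i ^ 4"
        unfolding H_def q_def p_def KK_def by (simp add: algebra_simps add_divide_distrib)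
      also have "\<dots> = (m1 / N * avg_constraint (u1 n) i + m2 / N * avg_constraint (u2 n) i) + s3 * (1 - \<alpha>) + s4 * (1 - \<beta>) + KK * h i ^ 4"
        unfolding 1 ..
      finally have 2: "F i + m1 / N * H (u1 n) i + m2 / N * H (u2 n) i
         = (objective i + m1 / N * avg_constraint (u1 n) i + m2 / N * avg_constraint (u2 n) i) + (E + KK) * h i ^ 4 - s3 * \<alpha> - s4 * \<beta>"
        unfolding F_def s3_def s4_def by (simp add: algebra_simps)
      have 3: "objective i + m1 / N * avg_constraint (u1 n) i + m2 / N * avg_constraint (u2 n) i = real n * (ln (r i) - c * h i ^ 2)"
        using lp_identity[of i] unfolding m c_def by (simp add: algebra_simps)
      have 4: "E + KK = - real n * (D_const n - c^2 / 2) + 4 * e0^2 * (1 / 4 - \<nu>) * \<alpha>"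
        using second_order_identity unfolding E_def KK_def \<alpha>_def q_def m c_def \<nu>_def by linarith
      have y4: "Y4 i = (Ssq i)^2 / 2 - quartic_gap i" by (simp add: quartic_gap_def)
      show "\<alpha> * O3 i + \<beta> * O4 i + ((1 / 4 - \<nu>) * \<alpha>) * OS i
        = real n * (ln (r i) - (c * h i ^ 2 + (D_const n + Delta_const n - c^2 / 2) * h i ^ 4))
      - (F i + m1 / N * H (u1 n) i + m2 / N * H (u2 n) i + (kappa n * quartic_gap i / 4 - real n * Delta_const n * h i ^ 4))"
        unfolding 2 3 4 kap o3 O4_def OS_def s4_def[symmetric] y4
        by (simp add: field_simps)
    qed
  qed
  from ub_cmult_cancel[OF this] n3 show ?thesis by simp
qed

theorem r_ub: "ub (mu + 2) (\<lambda>i. r i - (1 + (D1 n + D2 n / real n) * h i ^ 2 + (D_const n + Delta_const n) * h i ^ 4))"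
proof -
  define c where "c = D1 n + D2 n / real n"
  define l where "l = D_const n + Delta_const n - c^2 / 2"
  obtain C where C: "\<forall>\<^sub>F i in sequentially. ln (r i) - (c * h i ^ 2 + l * h i ^ 4) \<le> C * h i ^ (mu + 2)"
    using ln_r_ub unfolding ub_def c_def l_def by blast
  have mb: "4 \<le> mu + 2" "mu + 2 \<le> 6" using mu_bounds by auto
  define f where "f i = c * h i ^ 2 + l * h i ^ 4 + C * h i ^ (mu + 2)" for i
  have f4: "ord 4 (\<lambda>i. f i - c * h i ^ 2)"
  proof (rule ord_eqI)
    show "ord 4 (\<lambda>i. l * h i ^ 4 + C * h i ^ (mu + 2))"
      by (intro ord_add ord_cmult ord_h_power ord_weaken[OF ord_h_power mb(1)])
  qed (simp add: f_def)
  have f2: "ord 2 f"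
  proof (rule ord_eqI)
    show "ord 2 (\<lambda>i. (f i - c * h i ^ 2) + c * h i ^ 2)"
      by (intro ord_add ord_cmult ord_h_power ord_weaken[OF f4]) simp
  qed simp
  have "\<forall>\<^sub>F i in sequentially. norm (exp (f i) - 1 - f i - (f i)^2 / 2) \<le> exp 1 * norm (f i ^ 3)"
    using ord_small_ev[OF f2 _ zero_less_one, simplified]
  proof eventually_elim
    case (elim i)
    have s: "(\<Sum>j\<le>2. f i ^ j / fact j) = 1 + f i + (f i)^2 / 2" by (simp add: eval_nat_numeral)
    have "norm (exp (f i) - (1 + f i + (f i)^2 / 2)) \<le> exp (norm (f i)) * norm (f i) ^ 3 / 2"
      using Taylor_exp_field[of "f i" 2] unfolding s by (simp add: eval_nat_numeral)
    also have "\<dots> \<le> exp (norm (f i)) * norm (f i) ^ 3 / 1" by (intro divide_left_mono) auto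
    also have "\<dots> \<le> exp 1 * norm (f i) ^ 3" using elim by (simp add: mult_right_mono)
    finally show ?case by (simp add: norm_power power_abs diff_diff_eq add.assoc)
  qed
  then have "ord 6 (\<lambda>i. exp (f i) - 1 - f i - (f i)^2 / 2)"
    by (rule ord_dominated) (use ord_power[OF f2, of 3] in simp)
  note ex = ord_weaken[OF this mb(2)]
  have sq: "ord (mu + 2) (\<lambda>i. (f i)^2 - c^2 * h i ^ 4)"
  proof (rule ord_weaken[OF _ mb(2)], rule ord_eqI)
    show "ord 6 (\<lambda>i. (f i - c * h i ^ 2) * (f i + c * h i ^ 2))"
      by (intro ord_mono_mult[OF f4 ord_add[OF f2 ord_cmult[OF ord_h_power]]]) simp
  qed (simp add: power2_eq_square eval_nat_numeral algebra_simps)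
  have "ub (mu + 2) (\<lambda>i. exp (f i) - (1 + c * h i ^ 2 + (D_const n + Delta_const n) * h i ^ 4))"
  proof (rule ub_ord, rule ord_eqI)
    show "ord (mu + 2) (\<lambda>i. (exp (f i) - 1 - f i - (f i)^2 / 2) + (1 / 2) * ((f i)^2 - c^2 * h i ^ 4) + C * h i ^ (mu + 2))"
      by (intro ord_add ord_cmult ord_h_power ex sq)
  qed (simp add: f_def l_def field_simps)
  moreover have "\<forall>\<^sub>F i in sequentially. r i - (1 + c * h i ^ 2 + (D_const n + Delta_const n) * h i ^ 4)
     \<le> exp (f i) - (1 + c * h i ^ 2 + (D_const n + Delta_const n) * h i ^ 4)"
    using C
  proof eventually_elim
    case (elim i)
    then have "ln (r i) \<le> f i" by (simp add: f_def)
    then have "exp (ln (r i)) \<le> exp (f i)" by simp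
    then show ?case using r_pos[of i] by simp
  qed
  ultimately show ?thesis unfolding c_def[symmetric] by (rule ub_mono_ev[rotated])
qed

end

section \<open>Normalisation of a polynomial\<close>

lemma linear_factors:
  fixes p :: "complex poly"
  assumes "p \<noteq> 0"
  obtains a where "p = smult (lead_coeff p) (\<Prod>j<degree p. [:- a j, 1:])"
proof -
  obtain A where A: "size A = degree p" "p = smult (lead_coeff p) (\<Prod>x\<in>#A. [:- x, 1:])"
    using alg_closed_imp_factorization[OF assms] by blast
  obtain xs where xs: "mset xs = A" using ex_mset by blast
  have len: "length xs = degree p" using A(1) xs by (metis size_mset)
  have "(\<Prod>x\<in>#A. [:- x, 1:]) = (\<Prod>x\<leftarrow>xs. [:- x, 1:])" unfolding xs[symmetric] by (simp add: prod_mset_prod_list flip: mset_map)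
  also have "\<dots> = (\<Prod>j<degree p. [:- (xs ! j), 1:])"
    unfolding prod.list_conv_set_nth by (simp add: len atLeast0LessThan)
  finally show thesis using A(2) that[of "\<lambda>j. xs ! j"] by metis
qed

lemma pderiv_linear_factors:
  fixes a :: "nat \<Rightarrow> complex"
  assumes "\<And>j. j < m \<Longrightarrow> x \<noteq> a j"
  shows "poly (pderiv (\<Prod>j<m. [:- a j, 1:])) x = poly (\<Prod>j<m. [:- a j, 1:]) x * (\<Sum>j<m. 1 / (x - a j))"
  using assms
proof (induction m)
  case 0
  then show ?case by (simp add: pderiv_1)
next
  case (Suc m)
  have x: "x - a m \<noteq> 0" using Suc.prems[of m] by simp
  have A: "poly (pderiv (F * [:- a m, 1:])) x = poly F x + (x - a m) * poly (pderiv F) x" for F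
  proof -
    have "pderiv [:- a m, 1:] = 1" by (simp add: pderiv_pCons)
    then show ?thesis unfolding pderiv_mult by (simp add: algebra_simps)
  qed
  have IH: "poly (pderiv (\<Prod>j<m. [:- a j, 1:])) x = poly (\<Prod>j<m. [:- a j, 1:]) x * (\<Sum>j<m. 1 / (x - a j))"
    using Suc by simp
  show ?case
    unfolding prod.lessThan_Suc sum.lessThan_Suc A IH poly_mult using x by (simp add: field_simps)
qed

lemma signed_esym_reflected: "(\<Sum>k\<le>m. signed_esym m d k * v ^ (m - k)) = (\<Prod>j<m. (v - d j))"
proof (induction m)
  case 0
  show ?case by simp
next
  case (Suc m)
  have "(\<Sum>k\<le>Suc m. signed_esym (Suc m) d k * v ^ (Suc m - k))
      = (\<Sum>k\<le>Suc m. signed_esym m d k * v ^ (Suc m - k))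
        - d m * (\<Sum>k\<le>Suc m. (if k = 0 then 0 else signed_esym m d (k - 1)) * v ^ (Suc m - k))"
    unfolding signed_esym_Suc by (simp only: left_diff_distrib sum_subtractf sum_distrib_left mult.assoc)
  also have "(\<Sum>k\<le>Suc m. signed_esym m d k * v ^ (Suc m - k)) = v * (\<Sum>k\<le>m. signed_esym m d k * v ^ (m - k))"
    unfolding sum.atMost_Suc sum_distrib_left
    by (simp add: signed_esym_eq_0 Suc_diff_le mult.left_commute cong: sum.cong_simp)
  also have "(\<Sum>k\<le>Suc m. (if k = 0 then 0 else signed_esym m d (k - 1)) * v ^ (Suc m - k))
      = (\<Sum>k\<le>m. signed_esym m d k * v ^ (m - k))"
    unfolding sum.atMost_Suc_shift by simp
  finally show ?case unfolding Suc.IH by (simp add: algebra_simps)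
qed

lemma pderiv_sum: "pderiv (\<Sum>k\<in>K. f k) = (\<Sum>k\<in>K. pderiv (f k))"
  by (induction K rule: infinite_finite_induct) (simp_all add: pderiv_add)

text \<open>This identifies the sum in the normalised description of the zeros: it is the antiderivative of \<open>n + 1\<close> times the product of the
  critical factors.\<close>

lemma antiderivative_of_product:
  fixes d :: "nat \<Rightarrow> complex"
  shows "pderiv (\<Sum>k\<le>n. monom (of_real ((real n + 1) / (real n + 1 - real k)) * signed_esym n d k) (n + 1 - k))
    = smult (of_nat (n + 1)) (\<Prod>j<n. [:- d j, 1:])"
proof (rule poly_ext)
  fix v
  have *: "poly (pderiv (monom (of_real ((real n + 1) / (real n + 1 - real k)) * signed_esym n d k) (n + 1 - k))) v
      = of_nat (n + 1) * (signed_esym n d k * v ^ (n - k))" if "k \<in> {..n}" for k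
  proof -
    have "real n + 1 - real k = real (n + 1 - k)" using that by simp
    moreover have "real (n + 1 - k) \<noteq> 0" using that by simp
    ultimately have "of_nat (n + 1 - k) * complex_of_real ((real n + 1) / (real n + 1 - real k)) = of_nat (n + 1)"
      by (metis (no_types, lifting) nonzero_mult_div_cancel_left of_nat_1 of_nat_add of_real_mult of_real_of_nat_eq times_divide_eq_right)
    moreover have "n + 1 - k - 1 = n - k" by simp
    ultimately show ?thesis unfolding pderiv_monom poly_monom by (metis mult.assoc)
  qed
  have "poly (pderiv (\<Sum>k\<le>n. monom (of_real ((real n + 1) / (real n + 1 - real k)) * signed_esym n d k) (n + 1 - k))) v
      = (\<Sum>k\<le>n. of_nat (n + 1) * (signed_esym n d k * v ^ (n - k)))"
    unfolding pderiv_sum poly_sum by (intro sum.cong refl *)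
  also have "\<dots> = of_nat (n + 1) * (\<Prod>j<n. (v - d j))"
    unfolding sum_distrib_left[symmetric] signed_esym_reflected ..
  finally show "poly (pderiv (\<Sum>k\<le>n. monom (of_real ((real n + 1) / (real n + 1 - real k)) * signed_esym n d k) (n + 1 - k))) v
      = poly (smult (of_nat (n + 1)) (\<Prod>j<n. [:- d j, 1:])) v" by (simp add: poly_prod)
qed

text \<open>Both polynomials in \<open>v\<close> have proportional derivatives and vanish at \<open>1\<close>.\<close>

lemma recentred_roots:
  fixes P :: "complex poly" and z :: "nat \<Rightarrow> complex"
  assumes P': "pderiv P = smult a (\<Prod>j<n. [:- z j, 1:])" and b0: "b \<noteq> 0"
    and root: "poly P (c + b) = 0"
    and d: "\<And>j. z j = c + b * d j"
    and eq: "(\<Sum>k\<le>n. of_real ((real n + 1) / (real n + 1 - real k)) * signed_esym n d k * (v ^ (n + 1 - k) - 1)) = 0"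
  shows "poly P (c + b * v) = 0"
proof -
  define R where "R = (\<Sum>k\<le>n. monom (of_real ((real n + 1) / (real n + 1 - real k)) * signed_esym n d k) (n + 1 - k))"
  define M :: complex where "M = of_nat (n + 1)"
  have M0: "M \<noteq> 0" unfolding M_def by (simp del: of_nat_add of_nat_Suc)
  define p where "p = pcompose P [:c, b:]"
  have fac: "pcompose [:- z j, 1:] [:c, b:] = smult b [:- d j, 1:]" for j
    unfolding d by (simp add: pcompose_pCons)
  have "pderiv p = smult (a * b ^ n * b) (\<Prod>j<n. [:- d j, 1:])"
    unfolding p_def pderiv_pcompose P' pcompose_smult pcompose_prod fac prod_smult
    by (simp add: pderiv_pCons mult.commute mult.left_commute)
  then have "pderiv (smult M p - smult (a * b ^ n * b) R) = 0"
    unfolding R_def pderiv_diff pderiv_smult antiderivative_of_product M_def by (simp add: mult.commute)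
  then have "degree (smult M p - smult (a * b ^ n * b) R) = 0" by (simp only: pderiv_eq_0_iff)
  then obtain e where e: "smult M p - smult (a * b ^ n * b) R = [:e:]" by (rule degree_eq_zeroE)
  have pv: "M * poly p x - a * b ^ n * b * poly R x = e" for x
    using arg_cong[OF e, of "\<lambda>q. poly q x"] by simp
  have "poly R v - poly R 1 = 0"
    using eq unfolding R_def by (simp add: poly_sum poly_monom right_diff_distrib sum_subtractf)
  then have "poly R v = poly R 1" by simp
  then have "M * poly p v = M * poly p 1" using pv[of v] pv[of 1] by (metis diff_add_cancel)
  then have "poly p v = poly p 1" using M0 by simp
  moreover have "poly p x = poly P (c + b * x)" for x by (simp add: p_def poly_pcompose mult.commute)
  ultimately show ?thesis using root by simp
qed

text \<open>Write \<open>P = (X - \<beta>) * Q\<close>, so that \<open>P' = Q\<close> and \<open>P'' = 2 * Q'\<close> at \<open>\<beta>\<close>.  The first relation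
  compares the products of the distances to the critical points \<open>z\<close> and to the other zeros \<open>u\<close>; as no distance to a zero exceeds
  \<open>1 + \<bar>\<beta>\<bar>\<close>, none is small.  The quotient of the two relations compares the sums of reciprocals.\<close>

lemma critical_data:
  assumes n: "n \<ge> 1" and P: "P \<in> S (n + 1) \<beta>" and r: "0 < crit_dist P \<beta>"
  obtains a z u where
    "pderiv P = smult a (\<Prod>j<n. [:- z j, 1:])"
    "\<And>j. j < n \<Longrightarrow> crit_dist P \<beta> \<le> cmod (of_real \<beta> - z j)"
    "\<And>j. j < n \<Longrightarrow> cmod (u j) \<le> 1"
    "\<And>j. j < n \<Longrightarrow> (real n + 1) * crit_dist P \<beta> ^ n \<le> cmod (of_real \<beta> - u j) * (1 + \<bar>\<beta>\<bar>) ^ (n - 1)"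
    "(\<Sum>j<n. 1 / (of_real \<beta> - z j)) = 2 * (\<Sum>j<n. 1 / (of_real \<beta> - u j))"
proof -
  define B :: complex where "B = of_real \<beta>"
  have deg: "degree P = n + 1" and roots: "\<And>x. poly P x = 0 \<Longrightarrow> cmod x \<le> 1" and PB: "poly P B = 0"
    using P by (auto simp: S_def B_def)
  have P0: "P \<noteq> 0" using deg by auto
  have degP': "degree (pderiv P) = n" by (simp add: degree_pderiv deg)
  have P'0: "pderiv P \<noteq> 0" using deg by (simp add: pderiv_eq_0_iff)
  define a where "a = lead_coeff (pderiv P)"
  obtain z where z: "pderiv P = smult a (\<Prod>j<n. [:- z j, 1:])"
    using linear_factors[OF P'0] unfolding degP' a_def by blast
  obtain Q where Q: "P = [:- B, 1:] * Q" using PB by (auto simp: poly_eq_0_iff_dvd elim: dvdE)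
  have Q0: "Q \<noteq> 0" using P0 Q by auto
  have degQ: "degree Q = n"
    using deg Q0 unfolding Q by (subst (asm) degree_mult_eq) auto
  obtain u where u: "Q = smult (lead_coeff Q) (\<Prod>j<n. [:- u j, 1:])"
    using linear_factors[OF Q0] unfolding degQ by blast
  define q where "q = lead_coeff Q"
  have Qeq: "smult q (\<Prod>j<n. [:- u j, 1:]) = Q" unfolding q_def by (rule u[symmetric])
  have Qv: "poly Q x = q * (\<Prod>j<n. x - u j)" for x
    unfolding Qeq[symmetric] by (simp add: poly_prod)
  have q0: "q \<noteq> 0" using Q0 by (simp add: q_def)
  have lc: "a = of_nat (n + 1) * q"
  proof -
    have "coeff (pderiv P) n = of_nat (n + 1) * coeff P (n + 1)" by (simp add: coeff_pderiv)
    moreover have "lead_coeff P = q" unfolding Q lead_coeff_mult q_def by simp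
    ultimately show ?thesis unfolding a_def degP' using deg by simp
  qed
  have rz: "crit_dist P \<beta> \<le> cmod (B - z j)" if "j < n" for j
  proof -
    have "poly (pderiv P) (z j) = 0" unfolding z using that by (auto simp: poly_prod)
    moreover have "finite {w. poly (pderiv P) w = 0}" by (rule poly_roots_finite[OF P'0])
    ultimately have "crit_dist P \<beta> \<le> dist (complex_of_real \<beta>) (z j)"
      unfolding crit_dist_def by (intro Min_le) auto
    then show ?thesis by (simp add: B_def dist_norm)
  qed
  have ur: "cmod (u j) \<le> 1" if "j < n" for j
  proof (rule roots)
    have "poly Q (u j) = 0" unfolding Qv using that by auto
    then show "poly P (u j) = 0" unfolding Q by simp
  qed
  have "pderiv [:- B, 1:] = 1" by (simp add: pderiv_pCons)
  then have lin: "pderiv ([:- B, 1:] * X) = X + [:- B, 1:] * pderiv X" for X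
    unfolding pderiv_mult by (simp only: mult_1_right add.commute)
  have PQ: "pderiv P = Q + [:- B, 1:] * pderiv Q"
    unfolding Q lin ..
  have "poly (pderiv P) B = poly Q B" unfolding PQ by simp
  then have prods: "a * (\<Prod>j<n. B - z j) = q * (\<Prod>j<n. B - u j)"
    unfolding z Qv by (simp add: poly_prod)
  have zne: "B \<noteq> z j" if "j < n" for j using rz[OF that] r by auto
  have "q * (\<Prod>j<n. B - u j) \<noteq> 0"
    unfolding prods[symmetric] using zne lc q0 by (auto simp del: of_nat_add of_nat_Suc)
  then have une: "B \<noteq> u j" if "j < n" for j using that by auto
  have cm: "(real n + 1) * (\<Prod>j<n. cmod (B - z j)) = (\<Prod>j<n. cmod (B - u j))"
  proof -
    have "cmod a * (\<Prod>j<n. cmod (B - z j)) = cmod q * (\<Prod>j<n. cmod (B - u j))"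
      using arg_cong[OF prods, of cmod] by (simp add: norm_mult prod_norm)
    moreover have "cmod a = (real n + 1) * cmod q" unfolding lc norm_mult norm_of_nat by simp
    ultimately have "cmod q * ((real n + 1) * (\<Prod>j<n. cmod (B - z j))) = cmod q * (\<Prod>j<n. cmod (B - u j))"
      by (simp only: mult.assoc mult.left_commute)
    then show ?thesis using q0 by simp
  qed
  have sep: "(real n + 1) * crit_dist P \<beta> ^ n \<le> cmod (B - u j) * (1 + \<bar>\<beta>\<bar>) ^ (n - 1)" if j: "j < n" for j
  proof -
    have "crit_dist P \<beta> ^ n = (\<Prod>j<n. crit_dist P \<beta>)" by simp
    also have "\<dots> \<le> (\<Prod>j<n. cmod (B - z j))" using rz r by (intro prod_mono) auto
    finally have "(real n + 1) * crit_dist P \<beta> ^ n \<le> (\<Prod>j<n. cmod (B - u j))"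
      unfolding cm[symmetric] by (intro mult_left_mono) auto
    also have "\<dots> = cmod (B - u j) * (\<Prod>j\<in>{..<n} - {j}. cmod (B - u j))"
      using j by (subst prod.remove[of _ j]) auto
    also have "\<dots> \<le> cmod (B - u j) * (\<Prod>j\<in>{..<n} - {j}. 1 + \<bar>\<beta>\<bar>)"
    proof (intro mult_left_mono prod_mono conjI)
      fix l assume "l \<in> {..<n} - {j}"
      then show "cmod (B - u l) \<le> 1 + \<bar>\<beta>\<bar>"
        using norm_triangle_ineq4[of B "u l"] ur[of l] by (auto simp: B_def)
    qed auto
    finally show ?thesis using j by simp
  qed
  have "poly (pderiv (pderiv P)) B = 2 * poly (pderiv Q) B"
    unfolding PQ pderiv_add lin by simp
  moreover have "poly (pderiv (pderiv P)) B = poly (pderiv P) B * (\<Sum>j<n. 1 / (B - z j))"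
    unfolding z pderiv_smult using pderiv_linear_factors[of n B z] zne by simp
  moreover have "poly (pderiv Q) B = poly Q B * (\<Sum>j<n. 1 / (B - u j))"
  proof -
    have "poly (pderiv (smult q (\<Prod>j<n. [:- u j, 1:]))) B = poly (smult q (\<Prod>j<n. [:- u j, 1:])) B * (\<Sum>j<n. 1 / (B - u j))"
      unfolding pderiv_smult using pderiv_linear_factors[of n B u] une by simp
    then show ?thesis unfolding Qeq .
  qed
  moreover have QB: "poly (pderiv P) B = poly Q B" unfolding PQ by simp
  ultimately have "poly Q B * (\<Sum>j<n. 1 / (B - z j)) = poly Q B * (2 * (\<Sum>j<n. 1 / (B - u j)))" by simp
  moreover have "poly Q B \<noteq> 0"
    unfolding QB[symmetric] z using lc q0 zne by (auto simp: poly_prod simp del: of_nat_add of_nat_Suc)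
  ultimately have "(\<Sum>j<n. 1 / (B - z j)) = 2 * (\<Sum>j<n. 1 / (B - u j))" by simp
  then show thesis using that[OF z] rz ur sep unfolding B_def by blast
qed

section \<open>Critical points near the origin\<close>

context small_scale
begin

lemma ord_sqrt:
  fixes f :: "nat \<Rightarrow> real"
  assumes "ord 2 (\<lambda>i. (f i)^2)"
  shows "ord 1 f"
proof -
  obtain C where C: "C \<ge> 0" "\<forall>\<^sub>F i in sequentially. norm ((f i)^2) \<le> C * h i ^ 2"
    using assms by (rule ordE)
  have "\<forall>\<^sub>F i in sequentially. norm (f i) \<le> sqrt C * h i ^ 1"
    using C(2)
  proof eventually_elim
    case (elim i)
    have "(f i)^2 \<le> (sqrt C * h i)^2" using elim C(1) by (simp add: power_mult_distrib)
    then have "\<bar>f i\<bar> \<le> \<bar>sqrt C * h i\<bar>" by (simp only: abs_le_square_iff)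
    then show ?case using C(1) by (simp add: abs_mult)
  qed
  then show ?thesis by (rule ordI)
qed

text \<open>A zero \<open>u\<close> in the unit disk that stays away from \<open>\<beta>\<close> satisfies \<open>Re (1 / (\<beta> - u)) \<ge> 1 / 2 - O(h^2)\<close>, so the reciprocals
  \<open>q = 1 / (\<beta> - z)\<close> have real parts with sum at least \<open>n - O(h^2)\<close>.  But \<open>Re q \<le> cmod q \<le> 1 + O(h^2)\<close> for each of them,
  so every real part is \<open>1 + O(h^2)\<close>, and \<open>(Im q)^2 = (cmod q)^2 - (Re q)^2\<close> is \<open>O(h^2)\<close>.\<close>

lemma critical_points_near_origin:
  fixes z u :: "nat \<Rightarrow> nat \<Rightarrow> complex" and r :: "nat \<Rightarrow> real"
  assumes rz: "\<And>i j. j < n \<Longrightarrow> r i \<le> cmod (of_real (1 - h i ^ 2) - z i j)"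
    and ru: "\<And>i j. j < n \<Longrightarrow> cmod (u i j) \<le> 1"
    and sep: "\<And>i j. j < n \<Longrightarrow> (real n + 1) * r i ^ n \<le> cmod (of_real (1 - h i ^ 2) - u i j) * (1 + \<bar>1 - h i ^ 2\<bar>) ^ (n - 1)"
    and sums: "\<And>i. (\<Sum>j<n. 1 / (of_real (1 - h i ^ 2) - z i j)) = 2 * (\<Sum>j<n. 1 / (of_real (1 - h i ^ 2) - u i j))"
    and r: "ub 2 (\<lambda>i. 1 - r i)" and j: "j < n"
  shows "ord 2 (\<lambda>i. Re (z i j))" "ord 1 (\<lambda>i. Im (z i j))"
proof -
  obtain C' where C': "\<forall>\<^sub>F i in sequentially. 1 - r i \<le> C' * h i ^ 2" using r unfolding ub_def by blast
  define C where "C = \<bar>C'\<bar>"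
  have C: "\<forall>\<^sub>F i in sequentially. 1 - r i \<le> C * h i ^ 2" using C'
  proof eventually_elim
    case (elim i)
    have "C' * h i ^ 2 \<le> C * h i ^ 2" unfolding C_def by (intro mult_right_mono) auto
    then show ?case using elim by linarith
  qed
  have Co: "ord 2 (\<lambda>i. C * h i ^ 2)" by (intro ord_cmult ord_h_power)
  have rhalf: "\<forall>\<^sub>F i in sequentially. 1 / 2 \<le> r i"
    using C ord_small_ev[OF Co _ half_gt_zero[OF zero_less_one], simplified]
    by eventually_elim linarith
  \<comment> \<open>A lower bound for the distance from \<open>\<beta>\<close> to the other zeros as soon as \<open>r \<ge> 1 / 2\<close>.\<close>
  define k where "k = (real n + 1) * (1 / 2) ^ n / 2 ^ (n - 1)"
  have k: "k > 0" by (simp add: k_def)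
  have small: "\<forall>\<^sub>F i in sequentially. norm (h i) < 1" by (rule ord_small_ev[OF ord_h order_refl zero_less_one])
  have sepk: "\<forall>\<^sub>F i in sequentially. \<forall>j<n. k \<le> cmod (of_real (1 - h i ^ 2) - u i j)"
    using rhalf small
  proof eventually_elim
    case (elim i)
    show ?case
    proof (intro allI impI)
      fix j assume j: "j < n"
      have h2: "h i ^ 2 \<le> 1" using elim(2) by (simp add: abs_square_le_1)
      have "(real n + 1) * (1 / 2) ^ n \<le> (real n + 1) * r i ^ n"
        using elim(1) by (intro mult_left_mono power_mono) auto
      also have "\<dots> \<le> cmod (of_real (1 - h i ^ 2) - u i j) * (1 + \<bar>1 - h i ^ 2\<bar>) ^ (n - 1)" by (rule sep[OF j])
      also have "\<dots> \<le> cmod (of_real (1 - h i ^ 2) - u i j) * 2 ^ (n - 1)"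
        using h2 by (intro mult_left_mono power_mono) auto
      finally show "k \<le> cmod (of_real (1 - h i ^ 2) - u i j)" unfolding k_def by (simp add: field_simps)
    qed
  qed
  have U: "ub 2 (\<lambda>i. 1 / 2 - Re (1 / (of_real (1 - h i ^ 2) - u i j)))" if j: "j < n" for j
  proof (rule ubI)
    show "\<forall>\<^sub>F i in sequentially. 1 / 2 - Re (1 / (of_real (1 - h i ^ 2) - u i j)) \<le> (1 / k + 1 / k^2) * h i ^ 2"
      using sepk
    proof eventually_elim
      case (elim i)
      define b where "b = 1 - h i ^ 2"
      define w where "w = of_real b - u i j"
      have wk: "k \<le> cmod w" using elim j by (simp add: w_def b_def)
      then have w0: "w \<noteq> 0" using k by auto
      have uu: "u i j = of_real b - w" by (simp add: w_def)
      have "(cmod (of_real b - w))^2 \<le> 1" using ru[OF j, of i] unfolding uu[symmetric] by (simp add: abs_square_le_1)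
      moreover have "(cmod (of_real b - w))^2 = b^2 - 2 * b * Re w + (cmod w)^2"
        unfolding cmod_power2 by (simp add: power2_eq_square algebra_simps)
      ultimately have le: "(cmod w)^2 \<le> 2 * b * Re w + (1 - b^2)" by linarith
      define R where "R = Re (1 / w)"
      define I where "I = 1 / cmod w"
      have Rw: "R = Re w / (cmod w)^2" unfolding R_def by (simp add: Re_divide cmod_power2)
      have c0: "(cmod w)^2 > 0" using w0 by simp
      have "(cmod w)^2 / (cmod w)^2 \<le> (2 * b * Re w + (1 - b^2)) / (cmod w)^2"
        using le c0 by (intro divide_right_mono) auto
      then have 1: "1 \<le> 2 * b * R + (1 - b^2) * I^2"
        unfolding Rw I_def using c0 by (simp add: add_divide_distrib power_divide)
      have Ik: "0 \<le> I" "I \<le> 1 / k" unfolding I_def using wk k w0 by (auto simp: frac_le)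
      have "\<bar>R\<bar> \<le> I" unfolding R_def I_def using abs_Re_le_cmod[of "1 / w"] by (simp add: norm_divide)
      then have "h i ^ 2 * - R \<le> h i ^ 2 * (1 / k)" using Ik by (intro mult_left_mono) auto
      moreover have "I^2 \<le> (1 / k)^2" using Ik by (intro power_mono) auto
      then have "(2 * h i ^ 2) * I^2 \<le> (2 * h i ^ 2) * (1 / k)^2" by (intro mult_left_mono) auto
      moreover have "(1 - b^2) * I^2 \<le> (2 * h i ^ 2) * I^2"
        by (intro mult_right_mono) (auto simp: b_def power2_eq_square algebra_simps)
      moreover have "2 * b * R = 2 * R + 2 * (h i ^ 2 * - R)" by (simp add: b_def algebra_simps)
      ultimately have "1 \<le> 2 * R + 2 * (h i ^ 2 * (1 / k)) + (2 * h i ^ 2) * (1 / k)^2" using 1 by linarith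
      then have "1 / 2 - R \<le> (1 / k + 1 / k^2) * h i ^ 2" by (simp add: power_divide algebra_simps)
      then show ?case unfolding R_def w_def b_def .
    qed
  qed
  define q where "q i j = 1 / (of_real (1 - h i ^ 2) - z i j)" for i j
  have qr: "\<forall>\<^sub>F i in sequentially. \<forall>j<n. cmod (q i j) - 1 \<le> 2 * C * h i ^ 2"
    using C rhalf
  proof eventually_elim
    case (elim i)
    show ?case
    proof (intro allI impI)
      fix j assume j: "j < n"
      have "cmod (q i j) \<le> 1 / r i" unfolding q_def norm_divide
        using rz[OF j, of i] elim(2) by (simp add: frac_le)
      moreover have "1 / r i - 1 \<le> 2 * C * h i ^ 2"
      proof (cases "r i \<le> 1")
        case True
        have "1 / r i - 1 = (1 - r i) * (1 / r i)" using elim(2) by (simp add: field_simps)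
        also have "\<dots> \<le> (1 - r i) * 2" using True elim(2) by (intro mult_left_mono) (auto simp: field_simps)
        also have "\<dots> \<le> (C * h i ^ 2) * 2" using elim(1) by (intro mult_right_mono) auto
        finally show ?thesis by (simp add: mult.commute mult.left_commute)
      next
        case False
        then have "1 / r i - 1 \<le> 0" by simp
        moreover have "0 \<le> 2 * C * h i ^ 2" by (simp add: C_def)
        ultimately show ?thesis by linarith
      qed
      ultimately show "cmod (q i j) - 1 \<le> 2 * C * h i ^ 2" by linarith
    qed
  qed
  have qn: "ub 2 (\<lambda>i. cmod (q i j) - 1)" if "j < n" for j
    by (rule ubI[of _ "2 * C"]) (use qr in eventually_elim, use that in auto)
  have qlo: "ub 2 (\<lambda>i. - (1 - Re (q i j)))" if "j < n" for j
    by (rule ub_mono_ev[OF always_eventually qn[OF that]]) (simp add: complex_Re_le_cmod)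
  have ub_sum: "ub 2 (\<lambda>i. \<Sum>j\<in>J. f j i)" if "finite J" "\<And>j. j \<in> J \<Longrightarrow> ub 2 (f j)" for J :: "nat set" and f
    using that by (induction J rule: finite_induct) (auto intro: ub_add ub_ord[OF ord_zero])
  have "ub 2 (\<lambda>i. 2 * (\<Sum>j<n. 1 / 2 - Re (1 / (of_real (1 - h i ^ 2) - u i j))))"
    by (intro ub_cmult ub_sum U) auto
  moreover have "2 * (\<Sum>j<n. 1 / 2 - Re (1 / (of_real (1 - h i ^ 2) - u i j))) = (\<Sum>j<n. 1 - Re (q i j))" for i
  proof -
    have "(\<Sum>j<n. Re (q i j)) = Re (\<Sum>j<n. q i j)" by simp
    also have "\<dots> = 2 * (\<Sum>j<n. Re (1 / (of_real (1 - h i ^ 2) - u i j)))"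
      unfolding q_def sums[of i] by simp
    finally show ?thesis by (simp add: sum_subtractf)
  qed
  ultimately have tot: "ub 2 (\<lambda>i. \<Sum>j<n. 1 - Re (q i j))" by simp
  have Req: "ord 2 (\<lambda>i. 1 - Re (q i j))"
  proof (rule ord_of_ub[OF _ qlo[OF j]])
    have "ub 2 (\<lambda>i. (\<Sum>j<n. 1 - Re (q i j)) + (\<Sum>j\<in>{..<n} - {j}. - (1 - Re (q i j))))"
      by (intro ub_add tot ub_sum qlo) auto
    moreover have "(\<Sum>j<n. 1 - Re (q i j)) + (\<Sum>j\<in>{..<n} - {j}. - (1 - Re (q i j))) = 1 - Re (q i j)" for i
      unfolding sum_negf using j by (subst sum.remove[of _ j]) auto
    ultimately show "ub 2 (\<lambda>i. 1 - Re (q i j))" by simp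
  qed
  have Nq: "ord 2 (\<lambda>i. cmod (q i j) - 1)"
  proof (rule ord_of_ub[OF qn[OF j]])
    show "ub 2 (\<lambda>i. - (cmod (q i j) - 1))"
      by (rule ub_mono_ev[OF always_eventually ub_ord[OF Req]]) (simp add: complex_Re_le_cmod)
  qed
  have qlim: "(\<lambda>i. cmod (q i j)) \<longlonglongrightarrow> 1"
    using tendsto_add[OF ord_tendsto[OF Nq] tendsto_const[of 1]] by simp
  have qb: "ord 0 (\<lambda>i. cmod (q i j))" by (rule ord_bounded[OF qlim])
  have Rb: "ord 0 (\<lambda>i. Re (q i j))"
    by (rule ord_dominated[OF always_eventually qb, of _ 1]) (simp add: abs_Re_le_cmod)
  have "ord 2 (\<lambda>i. ((cmod (q i j) - 1) + (1 - Re (q i j))) * (cmod (q i j) + Re (q i j)))"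
    by (intro ord_mono_mult[OF ord_add[OF Nq Req] ord_add[OF qb Rb]]) simp
  moreover have "((cmod (q i j) - 1) + (1 - Re (q i j))) * (cmod (q i j) + Re (q i j)) = (Im (q i j))^2" for i
    using cmod_power2[of "q i j"] by (simp add: power2_eq_square algebra_simps)
  ultimately have "ord 2 (\<lambda>i. (Im (q i j))^2)" by simp
  then have Imq: "ord 1 (\<lambda>i. Im (q i j))" by (rule ord_sqrt)
  have inv: "ord 0 (\<lambda>i. inverse ((cmod (q i j))^2))"
    by (rule ord_bounded[OF tendsto_inverse[OF tendsto_power[OF qlim, of 2]]]) simp
  have zq: "\<forall>\<^sub>F i in sequentially. z i j = of_real (1 - h i ^ 2) - 1 / q i j \<and> cmod (q i j) > 0"
    using rhalf
  proof eventually_elim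
    case (elim i)
    have "of_real (1 - h i ^ 2) - z i j \<noteq> 0" using rz[OF j, of i] elim by auto
    then show ?case unfolding q_def by (simp add: field_simps)
  qed
  show "ord 2 (\<lambda>i. Re (z i j))"
  proof (rule ord_cong_ev)
    have "ord 2 (\<lambda>i. ((cmod (q i j) - 1) * (cmod (q i j) + 1) + (1 - Re (q i j))) * inverse ((cmod (q i j))^2))"
      by (intro ord_mono_mult[OF ord_add[OF ord_mono_mult[OF Nq ord_add[OF qb ord_const]] Req] inv]) auto
    then show "ord 2 (\<lambda>i. ((cmod (q i j) - 1) * (cmod (q i j) + 1) + (1 - Re (q i j))) * inverse ((cmod (q i j))^2) - h i ^ 2)"
      by (intro ord_diff ord_h_power)
    show "\<forall>\<^sub>F i in sequentially. ((cmod (q i j) - 1) * (cmod (q i j) + 1) + (1 - Re (q i j))) * inverse ((cmod (q i j))^2) - h i ^ 2 = Re (z i j)"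
      using zq
    proof eventually_elim
      case (elim i)
      have "Re (1 / q i j) = Re (q i j) * inverse ((cmod (q i j))^2)"
        by (simp add: Re_divide cmod_power2 divide_inverse)
      then have "Re (z i j) = 1 - h i ^ 2 - Re (q i j) * inverse ((cmod (q i j))^2)"
        using elim by (metis Re_complex_of_real minus_complex.sel(1))
      moreover have "((cmod (q i j) - 1) * (cmod (q i j) + 1) + (1 - Re (q i j))) * inverse ((cmod (q i j))^2)
         = 1 - Re (q i j) * inverse ((cmod (q i j))^2)"
        using elim by (simp add: field_simps power2_eq_square)
      ultimately show ?case by simp
    qed
  qed
  show "ord 1 (\<lambda>i. Im (z i j))"
  proof (rule ord_cong_ev)
    show "ord 1 (\<lambda>i. Im (q i j) * inverse ((cmod (q i j))^2))" by (intro ord_mono_mult[OF Imq inv]) simp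
    show "\<forall>\<^sub>F i in sequentially. Im (q i j) * inverse ((cmod (q i j))^2) = Im (z i j)"
      using zq
    proof eventually_elim
      case (elim i)
      have "Im (1 / q i j) = - Im (q i j) * inverse ((cmod (q i j))^2)"
        by (simp add: Im_divide cmod_power2 divide_inverse)
      moreover have "Im (z i j) = - Im (1 / q i j)" using elim by (metis Im_complex_of_real minus_complex.sel(2) diff_0)
      ultimately show ?case by simp
    qed
  qed
qed

end

section \<open>The theorem\<close>

lemma small_scale_shift:
  assumes "small_scale h"
  shows "small_scale (\<lambda>i. h (i + k))"
  using assms unfolding small_scale_def by (auto intro: LIMSEQ_ignore_initial_segment)

lemma ord_shift:
  assumes h: "small_scale h" and "small_scale.ord h s f"
  shows "small_scale.ord (\<lambda>i. h (i + k)) s (\<lambda>i. f (i + k))"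
proof -
  obtain C where "\<forall>\<^sub>F i in sequentially. norm (f i) \<le> C * h i ^ s"
    using assms(2) unfolding small_scale.ord_def[OF h] by blast
  then have "\<forall>\<^sub>F i in sequentially. norm (f (i + k)) \<le> C * h (i + k) ^ s"
    by (rule sequentially_offset)
  then show ?thesis unfolding small_scale.ord_def[OF small_scale_shift[OF h]] by blast
qed

text \<open>The normalisation requires that the centroid of the critical points differs from \<open>\<beta>\<close>.  This holds from some index \<open>k\<close> on, so the second-order
  bound is applied to the shifted sequence; there it contradicts the unbounded factor \<open>real i\<close>.\<close>

lemma no_extremal_sequence:
  fixes h :: "nat \<Rightarrow> real" and P :: "nat \<Rightarrow> complex poly"
  defines "E \<equiv> \<lambda>n::nat. if n = 3 \<or> n = 5 then 5 else 6 :: nat"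
  assumes n: "3 \<le> n" and h: "small_scale h" and h1: "\<And>i. h i < 1"
    and P: "\<And>i. P i \<in> S (n + 1) (1 - h i ^ 2)"
    and r0: "\<And>i. 0 < crit_dist (P i) (1 - h i ^ 2)"
    and large: "\<And>i. 1 + (D1 n + D2 n / real n) * h i ^ 2 + (D_const n + Delta_const n) * h i ^ 4
       + real i * h i ^ E n < crit_dist (P i) (1 - h i ^ 2)"
  shows False
proof -
  interpret H: small_scale h by (rule h)
  define r where "r i = crit_dist (P i) (1 - h i ^ 2)" for i
  define Dt where "Dt = D_const n + Delta_const n"
  define c where "c = D1 n + D2 n / real n"
  have lo: "1 + c * h i ^ 2 - r i \<le> \<bar>Dt\<bar> * h i ^ 4" for i
  proof -
    have "0 \<le> real i * h i ^ E n" by simp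
    moreover have "- (Dt * h i ^ 4) \<le> \<bar>Dt\<bar> * h i ^ 4"
      using mult_right_mono[of "- Dt" "\<bar>Dt\<bar>" "h i ^ 4"] by simp
    ultimately show ?thesis using large[of i] unfolding r_def c_def Dt_def by linarith
  qed
  then have lower: "H.ub 4 (\<lambda>i. 1 + c * h i ^ 2 - r i)" by (intro H.ubI always_eventually) auto
  have "H.ub 2 (\<lambda>i. (1 + c * h i ^ 2 - r i) + (- c) * h i ^ 2)"
    by (intro H.ub_add H.ub_weaken[OF lower] H.ub_ord H.ord_cmult H.ord_h_power) simp
  then have r2: "H.ub 2 (\<lambda>i. 1 - r i)" by simp
  have n1: "1 \<le> n" using n by simp
  have "\<forall>i. \<exists>a z u. pderiv (P i) = smult a (\<Prod>j<n. [:- z j, 1:]) \<and>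
    (\<forall>j<n. r i \<le> cmod (of_real (1 - h i ^ 2) - z j)) \<and> (\<forall>j<n. cmod (u j) \<le> 1) \<and>
    (\<forall>j<n. (real n + 1) * r i ^ n \<le> cmod (of_real (1 - h i ^ 2) - u j) * (1 + \<bar>1 - h i ^ 2\<bar>) ^ (n - 1)) \<and>
    (\<Sum>j<n. 1 / (of_real (1 - h i ^ 2) - z j)) = 2 * (\<Sum>j<n. 1 / (of_real (1 - h i ^ 2) - u j))"
  proof
    fix i
    show "\<exists>a z u. pderiv (P i) = smult a (\<Prod>j<n. [:- z j, 1:]) \<and>
      (\<forall>j<n. r i \<le> cmod (of_real (1 - h i ^ 2) - z j)) \<and> (\<forall>j<n. cmod (u j) \<le> 1) \<and>
      (\<forall>j<n. (real n + 1) * r i ^ n \<le> cmod (of_real (1 - h i ^ 2) - u j) * (1 + \<bar>1 - h i ^ 2\<bar>) ^ (n - 1)) \<and>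
      (\<Sum>j<n. 1 / (of_real (1 - h i ^ 2) - z j)) = 2 * (\<Sum>j<n. 1 / (of_real (1 - h i ^ 2) - u j))"
      using critical_data[OF n1 P[of i] r0[of i], folded r_def] by metis
  qed
  then obtain a z u where dat: "\<And>i. pderiv (P i) = smult (a i) (\<Prod>j<n. [:- z i j, 1:])"
    "\<And>i j. j < n \<Longrightarrow> r i \<le> cmod (of_real (1 - h i ^ 2) - z i j)" "\<And>i j. j < n \<Longrightarrow> cmod (u i j) \<le> 1"
    "\<And>i j. j < n \<Longrightarrow> (real n + 1) * r i ^ n \<le> cmod (of_real (1 - h i ^ 2) - u i j) * (1 + \<bar>1 - h i ^ 2\<bar>) ^ (n - 1)"
    "\<And>i. (\<Sum>j<n. 1 / (of_real (1 - h i ^ 2) - z i j)) = 2 * (\<Sum>j<n. 1 / (of_real (1 - h i ^ 2) - u i j))"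
    by metis
  have zo: "H.ord 2 (\<lambda>i. Re (z i j))" "H.ord 1 (\<lambda>i. Im (z i j))" if "j < n" for j
    by (rule H.critical_points_near_origin[OF dat(2-5) r2 that]; assumption)+
  define m where "m i = (\<Sum>j<n. z i j) / of_nat n" for i
  define B where "B i = complex_of_real (1 - h i ^ 2)" for i
  define b where "b i = B i - m i" for i
  have n0: "complex_of_nat n \<noteq> 0" using n by simp
  have "H.ord 2 (\<lambda>i. (\<Sum>j<n. Re (z i j)) / real n)" "H.ord 1 (\<lambda>i. (\<Sum>j<n. Im (z i j)) / real n)"
    by (intro H.ord_divc H.ord_sum zo; simp)+
  then have mRe: "H.ord 2 (\<lambda>i. Re (m i))" and mIm: "H.ord 1 (\<lambda>i. Im (m i))"
    unfolding m_def Re_divide_of_nat Im_divide_of_nat Re_sum Im_sum by simp_all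
  have B1: "H.ord 2 (\<lambda>i. B i - 1)"
  proof (rule H.ord_eqI)
    show "H.ord 2 (\<lambda>i. - complex_of_real (h i ^ 2))" by (intro H.ord_minus H.ord_of_real H.ord_h_power)
  qed (simp add: B_def)
  have m1: "H.ord 1 m" by (intro H.ord_complexI mIm H.ord_weaken[OF mRe]) simp
  have b1: "H.ord 1 (\<lambda>i. b i - 1)"
  proof (rule H.ord_eqI)
    show "H.ord 1 (\<lambda>i. (B i - 1) - m i)" by (intro H.ord_diff m1 H.ord_weaken[OF B1]) simp
  qed (simp add: b_def)
  have blim: "b \<longlonglongrightarrow> 1" using tendsto_add[OF H.ord_tendsto[OF b1] tendsto_const[of 1]] by simp
  have Blim: "B \<longlonglongrightarrow> 1" using tendsto_add[OF H.ord_tendsto[OF B1] tendsto_const[of 1]] by simp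
  have binv: "H.ord 0 (\<lambda>i. inverse (b i))" by (rule H.ord_bounded[OF tendsto_inverse[OF blim]]) simp
  have Binv: "H.ord 0 (\<lambda>i. inverse (1 - h i ^ 2))"
  proof (rule H.ord_bounded)
    have "(\<lambda>i. 1 - h i ^ 2) \<longlonglongrightarrow> 1 - 0 ^ 2" by (intro tendsto_intros H.h_lim)
    from tendsto_inverse[OF this] show "(\<lambda>i. inverse (1 - h i ^ 2)) \<longlonglongrightarrow> inverse (1 - 0 ^ 2)" by simp
  qed
  have bne: "\<forall>\<^sub>F i in sequentially. b i \<noteq> 0" by (rule tendsto_imp_eventually_ne[OF blim]) simp
  then obtain k where k: "\<And>i. i \<ge> k \<Longrightarrow> b i \<noteq> 0" unfolding eventually_sequentially by blast
  define d where "d i j = (z i j - m i) / b i" for i j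
  define g where "g i = m i / B i" for i
  have zm: "H.ord 2 (\<lambda>i. Re (z i j - m i))" "H.ord 1 (\<lambda>i. z i j - m i)" if "j < n" for j
  proof -
    show 1: "H.ord 2 (\<lambda>i. Re (z i j - m i))" using H.ord_diff[OF zo(1)[OF that] mRe] by simp
    show "H.ord 1 (\<lambda>i. z i j - m i)"
      by (intro H.ord_complexI H.ord_weaken[OF 1]) (use H.ord_diff[OF zo(2)[OF that] mIm] in auto)
  qed
  have d1: "H.ord 1 (\<lambda>i. d i j)" if "j < n" for j
    unfolding d_def divide_inverse by (intro H.ord_mono_mult[OF zm(2)[OF that] binv]) simp
  have dRe: "H.ord 2 (\<lambda>i. Re (d i j))" if "j < n" for j
  proof (rule H.ord_cong_ev)
    show "H.ord 2 (\<lambda>i. Re (z i j - m i) - Re (d i j * (b i - 1)))"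
      by (intro H.ord_diff zm(1)[OF that] H.ord_Re H.ord_mono_mult[OF d1[OF that] b1]) simp
    show "\<forall>\<^sub>F i in sequentially. Re (z i j - m i) - Re (d i j * (b i - 1)) = Re (d i j)"
      using bne
    proof eventually_elim
      case (elim i)
      then have "z i j - m i = d i j * b i" by (simp add: d_def)
      then show ?case by (simp add: algebra_simps)
    qed
  qed
  have gRe: "H.ord 2 (\<lambda>i. Re (g i))" and gIm: "H.ord 1 (\<lambda>i. Im (g i))"
  proof -
    have e: "Re (g i) = Re (m i) * inverse (1 - h i ^ 2)" "Im (g i) = Im (m i) * inverse (1 - h i ^ 2)" for i
      unfolding g_def B_def Re_divide_of_real Im_divide_of_real by (simp_all only: divide_inverse)
    show "H.ord 2 (\<lambda>i. Re (g i))" "H.ord 1 (\<lambda>i. Im (g i))"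
      unfolding e by (intro H.ord_mono_mult[OF mRe Binv] H.ord_mono_mult[OF mIm Binv]; simp)+
  qed
  have hp: "0 < 1 - h i ^ 2" for i using h1[of i] H.h_nonneg[of i] by (simp add: power_less_one_iff)
  have B0: "B i \<noteq> 0" for i unfolding B_def using hp[of i] by (metis less_irrefl of_real_eq_0_iff)
  have zd: "z i j = m i + b i * d i j" if "b i \<noteq> 0" for i j using that by (simp add: d_def)
  have bg: "b i = B i * (1 - g i)" for i using B0[of i] by (simp add: b_def g_def field_simps)
  define h' where "h' i = h (i + k)" for i
  have shift: "small_scale.ord h' s (\<lambda>i. f (i + k))" if "H.ord s f" for s and f :: "nat \<Rightarrow> real"
    unfolding h'_def[abs_def] by (rule ord_shift[OF h that])
  interpret H': small_scale h' unfolding h'_def[abs_def] by (rule small_scale_shift[OF h])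
  have "sendov_family h' n (\<lambda>i. d (i + k)) (\<lambda>i. g (i + k)) (\<lambda>i. r (i + k))"
  proof unfold_locales
    show "3 \<le> n" by (rule n)
    show "(\<Sum>j<n. d (i + k) j) = 0" for i
    proof -
      have "(\<Sum>j<n. d (i + k) j) = ((\<Sum>j<n. z (i + k) j) - of_nat n * m (i + k)) / b (i + k)"
        unfolding d_def by (simp add: sum_divide_distrib[symmetric] sum_subtractf)
      then show ?thesis using n0 by (simp add: m_def)
    qed
    show "H'.ord 2 (\<lambda>i. Re (d (i + k) j))" if "j < n" for j by (rule shift[OF dRe[OF that]])
    show "H'.ord 1 (\<lambda>i. Im (d (i + k) j))" if "j < n" for j by (rule shift[OF H.ord_Im[OF d1[OF that]]])
    show "H'.ord 2 (\<lambda>i. Re (g (i + k)))" by (rule shift[OF gRe])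
    show "H'.ord 1 (\<lambda>i. Im (g (i + k)))" by (rule shift[OF gIm])
    show "0 < r (i + k)" for i unfolding r_def by (rule r0)
    show "H'.ub 4 (\<lambda>i. 1 + (D1 n + D2 n / real n) * h' i ^ 2 - r (i + k))"
      by (rule H'.ubI[of _ "\<bar>Dt\<bar>"], rule always_eventually) (use lo in \<open>simp add: h'_def c_def\<close>)
    show "r (i + k) \<le> (1 - h' i ^ 2) * cmod (1 - g (i + k)) * cmod (1 - d (i + k) j)" if "j < n" for i j
    proof -
      have b0: "b (i + k) \<noteq> 0" by (rule k) simp
      have "B (i + k) - z (i + k) j = B (i + k) * (1 - g (i + k)) * (1 - d (i + k) j)"
        unfolding zd[OF b0] bg[symmetric] by (simp add: b_def algebra_simps)
      then have "cmod (B (i + k) - z (i + k) j) = cmod (B (i + k)) * cmod (1 - g (i + k)) * cmod (1 - d (i + k) j)"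
        by (simp add: norm_mult)
      moreover have "cmod (B (i + k)) = 1 - h' i ^ 2"
        unfolding B_def h'_def norm_of_real using hp[of "i + k"] by simp
      ultimately show ?thesis using dat(2)[OF that, of "i + k"] unfolding B_def by simp
    qed
    show "cmod (v + g (i + k) * (1 - v)) * (1 - h' i ^ 2) \<le> 1"
      if "(\<Sum>l\<le>n. of_real ((real n + 1) / (real n + 1 - real l)) * signed_esym n (d (i + k)) l * (v ^ (n + 1 - l) - 1)) = 0"
      for i v
    proof -
      have b0: "b (i + k) \<noteq> 0" by (rule k) simp
      have PB: "poly (P (i + k)) (m (i + k) + b (i + k)) = 0"
        using P[of "i + k"] by (simp add: S_def b_def B_def)
      have "poly (P (i + k)) (m (i + k) + b (i + k) * v) = 0"
        by (rule recentred_roots[OF dat(1) b0 PB zd[OF b0] that])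
      then have "cmod (m (i + k) + b (i + k) * v) \<le> 1" using P[of "i + k"] by (auto simp: S_def)
      moreover have "m (i + k) + b (i + k) * v = (v + g (i + k) * (1 - v)) * B (i + k)"
      proof -
        have "g (i + k) * B (i + k) = m (i + k)" using B0[of "i + k"] by (simp add: g_def)
        then show ?thesis unfolding b_def by (simp add: algebra_simps)
      qed
      moreover have "cmod (B (i + k)) = 1 - h' i ^ 2"
        unfolding B_def h'_def norm_of_real using hp[of "i + k"] by simp
      ultimately show ?thesis by (simp add: norm_mult)
    qed
  qed
  then interpret F: sendov_family h' n "\<lambda>i. d (i + k)" "\<lambda>i. g (i + k)" "\<lambda>i. r (i + k)" .
  have E: "F.mu + 2 = E n" by (simp add: F.mu_def E_def)
  obtain C where C: "\<forall>\<^sub>F i in sequentially. r (i + k) - (1 + c * h' i ^ 2 + Dt * h' i ^ 4) \<le> C * h' i ^ E n"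
    using F.r_ub unfolding H'.ub_def E c_def Dt_def by blast
  have "\<forall>\<^sub>F i in sequentially. real i \<le> C"
    using C
  proof eventually_elim
    case (elim i)
    have "real (i + k) * h' i ^ E n < C * h' i ^ E n"
      using large[of "i + k"] elim unfolding r_def h'_def c_def Dt_def by linarith
    then have "real (i + k) < C" using H'.h_pos[of i] by (simp add: mult_less_cancel_right_pos)
    then show ?case by simp
  qed
  moreover have "\<forall>\<^sub>F i in sequentially. C < real i"
    using filterlim_real_sequentially by (auto simp: filterlim_at_top_dense)
  ultimately have "\<forall>\<^sub>F i in sequentially. False" by eventually_elim linarith
  then show False by simp
qed

text \<open>If no constant worked, each \<open>C = i\<close> would have a counterexample with \<open>1 - \<beta> < e i\<close>, and these form a sequence that
  \<open>no_extremal_sequence\<close> excludes.\<close>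

theorem proposition5:
  fixes n :: nat
  assumes "n \<ge> 3"
  shows "\<exists>(C::real) (\<beta>\<^sub>0::real). 0 \<le> \<beta>\<^sub>0 \<and> \<beta>\<^sub>0 < 1 \<and>
    (\<forall>\<beta>\<in>{\<beta>\<^sub>0<..<1}. \<forall>P\<in>S (n + 1) \<beta>.
       crit_dist P \<beta> \<le> 1 + (D1 n + D2 n / real n) * (1 - \<beta>)
         + (D_const n + Delta_const n) * (1 - \<beta>)^2
         + C * (1 - \<beta>) powr (alpha_const n + 1))"
proof (rule ccontr)
  assume neg: "\<not> ?thesis"
  define c where "c = D1 n + D2 n / real n"
  define Dt where "Dt = D_const n + Delta_const n"
  \<comment> \<open>For \<open>1 - \<beta> \<le> e0\<close> the asserted bound is positive, so the counterexamples have positive critical distance.\<close>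
  define e0 where "e0 = 1 / (1 + \<bar>c\<bar> + \<bar>Dt\<bar>)"
  have e0: "0 < e0" "e0 \<le> 1" unfolding e0_def by (auto simp: field_simps add_pos_nonneg)
  define e where "e i = e0 / (real i + 1)" for i
  have e: "0 < e i" "e i \<le> e0" for i
    using e0 unfolding e_def by (auto simp: field_simps mult_nonneg_nonneg)
  have "\<forall>i. \<exists>\<beta> P. 1 - e i < \<beta> \<and> \<beta> < 1 \<and> P \<in> S (n + 1) \<beta> \<and>
    1 + c * (1 - \<beta>) + Dt * (1 - \<beta>)^2 + real i * (1 - \<beta>) powr (alpha_const n + 1) < crit_dist P \<beta>"
  proof
    fix i
    have "0 \<le> 1 - e i" "1 - e i < 1" using e[of i] e0 by auto
    then have "\<not> (\<forall>\<beta>\<in>{1 - e i<..<1}. \<forall>P\<in>S (n + 1) \<beta>.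
       crit_dist P \<beta> \<le> 1 + c * (1 - \<beta>) + Dt * (1 - \<beta>)^2 + real i * (1 - \<beta>) powr (alpha_const n + 1))"
      using neg unfolding c_def Dt_def by blast
    then show "\<exists>\<beta> P. 1 - e i < \<beta> \<and> \<beta> < 1 \<and> P \<in> S (n + 1) \<beta> \<and>
      1 + c * (1 - \<beta>) + Dt * (1 - \<beta>)^2 + real i * (1 - \<beta>) powr (alpha_const n + 1) < crit_dist P \<beta>"
      by (auto simp: not_le)
  qed
  then obtain \<beta> P where \<beta>: "\<And>i. 1 - e i < \<beta> i" "\<And>i. \<beta> i < 1" and P: "\<And>i. P i \<in> S (n + 1) (\<beta> i)"
    and large: "\<And>i. 1 + c * (1 - \<beta> i) + Dt * (1 - \<beta> i)^2 + real i * (1 - \<beta> i) powr (alpha_const n + 1) < crit_dist (P i) (\<beta> i)"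
    by metis
  define h where "h i = sqrt (1 - \<beta> i)" for i
  have hpos: "0 < h i" for i using \<beta>(2)[of i] by (simp add: h_def)
  have h2: "h i ^ 2 = 1 - \<beta> i" for i using \<beta>(2)[of i] by (simp add: h_def)
  have \<beta>h: "1 - h i ^ 2 = \<beta> i" for i unfolding h2 by simp
  have he: "h i ^ 2 < e i" for i using \<beta>(1)[of i] unfolding h2 by simp
  have h21: "h i ^ 2 < 1" for i using he[of i] e(2)[of i] e0(2) by linarith
  have h1: "h i < 1" for i using h21[of i] hpos[of i] by (simp add: power_less_one_iff)
  have elim: "e \<longlonglongrightarrow> 0"
    unfolding e_def by (rule real_tendsto_divide_at_top[OF tendsto_const])
      (use filterlim_tendsto_add_at_top[OF tendsto_const[of 1] filterlim_real_sequentially]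
       in \<open>simp add: add.commute\<close>)
  have "(\<lambda>i. h i ^ 2) \<longlonglongrightarrow> 0"
    by (rule tendsto_sandwich[OF _ _ tendsto_const elim]) (auto intro!: always_eventually less_imp_le he)
  from tendsto_real_sqrt[OF this] have "h \<longlonglongrightarrow> 0" using hpos by (simp add: less_imp_le)
  then have hs: "small_scale h" using hpos by unfold_locales
  have pw: "(1 - \<beta> i) powr (alpha_const n + 1) = h i ^ (if n = 3 \<or> n = 5 then 5 else 6)" for i
  proof -
    have "(1 - \<beta> i) powr (alpha_const n + 1) = (h i powr 2) powr (alpha_const n + 1)"
      using hpos[of i] by (simp add: h2)
    also have "\<dots> = h i powr real (if n = 3 \<or> n = 5 then 5 else 6)"
      unfolding powr_powr by (simp add: alpha_const_def)
    also have "\<dots> = h i ^ (if n = 3 \<or> n = 5 then 5 else 6)" by (rule powr_realpow[OF hpos])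
    finally show ?thesis .
  qed
  have h4: "h i ^ 4 = (1 - \<beta> i)^2" for i unfolding h2[symmetric] by (simp flip: power_mult)
  have pos: "0 < crit_dist (P i) (\<beta> i)" for i
  proof -
    define x where "x = 1 - \<beta> i"
    have x: "0 < x" "x \<le> e0" "x \<le> 1" using \<beta>(2)[of i] he[of i] e(2)[of i] e0(2) unfolding h2 x_def by linarith+
    have "\<bar>c * x + Dt * x^2\<bar> \<le> \<bar>c\<bar> * x + \<bar>Dt\<bar> * x^2"
      using x by (intro order_trans[OF abs_triangle_ineq]) (simp add: abs_mult)
    also have "\<dots> \<le> \<bar>c\<bar> * x + \<bar>Dt\<bar> * x"
      using x by (intro add_left_mono mult_left_mono) (auto simp: power2_eq_square mult_left_le)
    also have "\<dots> \<le> (\<bar>c\<bar> + \<bar>Dt\<bar>) * e0" unfolding distrib_right[symmetric] using x by (intro mult_left_mono) auto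
    also have "\<dots> < 1" unfolding e0_def by (simp add: field_simps)
    finally have "0 < 1 + c * x + Dt * x^2" by linarith
    moreover have "0 \<le> real i * (1 - \<beta> i) powr (alpha_const n + 1)" by simp
    ultimately show ?thesis using large[of i] unfolding x_def by linarith
  qed
  show False
  proof (rule no_extremal_sequence[OF assms hs h1])
    show "P i \<in> S (n + 1) (1 - h i ^ 2)" for i unfolding \<beta>h by (rule P)
    show "0 < crit_dist (P i) (1 - h i ^ 2)" for i unfolding \<beta>h by (rule pos)
    show "1 + (D1 n + D2 n / real n) * h i ^ 2 + (D_const n + Delta_const n) * h i ^ 4
       + real i * h i ^ (if n = 3 \<or> n = 5 then 5 else 6) < crit_dist (P i) (1 - h i ^ 2)" for i
      unfolding \<beta>h h4 using large[of i] unfolding pw c_def Dt_def h2 .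
  qed
qed

end
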